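(* Let $\mathcal P$ be the (unweighted) Bratteli diagram of finite prefix trees and $\partial\mathcal P$ its Martin boundary. (1) An infinite path $(\tau_n)_{n\ge 0}$ in $\mathcal P$ is regular if and only if, for all $i\in\mathcal I$, there exists $0\le \alpha_i\le 1$ such that $$\lim_{n\to\infty} \frac{|\tau_n^{(i)}|}{n}=\alpha_i.$$ (2) Consequently, there is a one-to-one correspondence between the Martin boundary $\partial\mathcal P$ and the labeled infinite genealogical trees $(\alpha_i)_{i\in\mathcal I}\in[0,1]^{\mathcal I}$ satisfying $$\alpha_\emptyset=1\quad\text{and}\quad \forall i\in\mathcal I,\ \ \alpha_i=\sum_{n\in\mathbb N}\alpha_{in}.$$ The corresponding extremal non-negative harmonic functions and ergodic saturated central Markov kernels are then given respectively by $$\varphi(\tau)=\prod_{i\in\tau}\alpha_i\quad\text{and}\quad p(\tau,\sigma)=\alpha_{ij},$$ for any $\tau,\sigma\in\mathcal P$ with $\sigma=\tau\sqcup\{ij\}$, where $i\in\tau$ and $j\in\mathbb N$ with $ij\notin\tau$. (3) In particular, for all $n\ge 1$ and arbitrary labels $(\alpha_i)_{i\in\mathcal I}\in[0,1]^{\mathcal I}$ satisfying the conditions displayed in (2), $$\sum_{\sigma\in\mathcal P_n}\frac{n!}{\prod_{i\in\sigma}|\sigma^{(i)}|}\prod_{i\in\sigma}\alpha_i=1.$$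
   Context: $\mathbb N=\{1,2,\dots\}$. The infinite genealogical tree is $\mathcal I=\bigcup_{n\ge 0}\mathbb N^n$ with $\mathbb N^0=\{\emptyset\}$; for $i,j\in\mathcal I$, $ij$ denotes concatenation, and for $i\in\mathcal I$, $j\in\mathbb N$, $ij$ is the $j$-th child of $i$. A subset $\tau\subset\mathcal I$ is a prefix tree if $\emptyset\in\tau$ and, for all $i,j\in\mathcal I$, $ij\in\tau$ implies $i\in\tau$. $|\tau|$ is the cardinality of $\tau$; $\mathcal P_n$ is the set of prefix trees of size $n\ge 1$, and $\mathcal P=\bigsqcup_{n\ge 0}\mathcal P_{n+1}$. For $i\in\mathcal I$, $\tau^{(i)}=\{j\in\mathcal I: ij\in\tau\}$ (empty if $i\notin\tau$). $\mathcal P$ is a graded graph whose $n$-th level is $\mathcal P_{n+1}$, with an edge $\tau\nearrow\sigma$ iff $\sigma=\tau\sqcup\{ij\}$ for some $i\in\tau$, $j\in\mathbb N$ with $ij\notin\tau$; its root is $\varnothing=\{\emptyset\}$. All weights are $1$; $d(\tau,\sigma)$ is the number of directed paths from $\tau$ to $\sigma$ (equal to $1$ if $\tau=\sigma$). Infinite paths start from the root: $\varnothing=\tau_0\nearrow\tau_1\nearrow\cdots$, so $|\tau_n|=n+1$. Martin boundary: for $\tau,\sigma\in\mathcal P$ let $K(\tau,\sigma)=d(\tau,\sigma)/d(\varnothing,\sigma)\le C_\tau:=1/d(\varnothing,\tau)$. With $(\varepsilon_\tau)_{\tau\in\mathcal P}$ a summable family of positive numbers and $n_\tau=|\tau|-1$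 the level of $\tau$, define the distance $$\rho(\sigma,\sigma')=\sum_{\tau\in\mathcal P}\varepsilon_\tau\frac{|K(\tau,\sigma)-K(\tau,\sigma')|+|\delta_{\tau,\sigma}-\delta_{\tau,\sigma'}|+|\delta_{n_\tau,n_\sigma}-\delta_{n_\tau,n_{\sigma'}}|}{C_\tau+1}$$ (Kronecker symbols). $\overline{\mathcal P}$ is the completion of $\mathcal P$ for $\rho$, $\overline{\mathcal P_{n+1}}$ the completion of the $n$-th level, and $\partial\mathcal P=\overline{\mathcal P}\setminus\bigsqcup_{n\ge0}\overline{\mathcal P_{n+1}}$. An infinite path $(\tau_n)$ is regular if it converges for $\rho$ to a point $\zeta\in\partial\mathcal P$, i.e. if $\lim_{n\to\infty} d(\tau,\tau_n)/d(\varnothing,\tau_n)$ exists for every $\tau\in\mathcal P$; this limit is denoted $K(\tau,\zeta)=\varphi_\zeta(\tau)$, and $\varphi_\zeta$ is the function on $\mathcal P$ corresponding to $\zeta$. A non-negative harmonic function (NNHF) is $\varphi:\mathcal P\to[0,\infty)$ with $\varphi(\varnothing)=1$ and $\varphi(\tau)=\sum_{\sigma:\tau\nearrow\sigma}\varphi(\sigma)$ for all $\tau$; extremal means an extreme point of the convex set of NNHFs. Let $\mathcal T$ be the set of infinite paths from the root, with the $\sigma$-algebra generated by the cylinders $C_s$ (infinite paths extending the finite path $s$). A saturated central measure is a probability measure $\mu$ on $\mathcal T$ such that $\mu(C_s)=\mu(C_t)$ for all finite paths $s,t$ from $\varnothing$ with the same endpoint; the corresponding NNHF is $\varphi(\tau)=\mu(C_s)$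 for any path $s$ from $\varnothing$ to $\tau$, and on $\{\varphi>0\}$ the measure $\mu$ is the law of the Markov chain started at $\varnothing$ with kernel $p(\tau,\sigma)=\varphi(\sigma)/\varphi(\tau)$, $\tau\nearrow\sigma$ (the saturated central Markov kernel). $\mu$ is ergodic if $\mu(A)\in\{0,1\}$ for every $A$ in the tail $\sigma$-field $\bigcap_{n}\sigma(\tau_k:k\ge n)$; the kernel is then also called ergodic.
   Formalization: In (2) the correspondence with labels is stated for those ζ in ∂P whose φ_ζ is harmonic: the stars {∅,1,…,n} converge to a point of ∂P with α_∅=1 and all other α_i=0, violating the label equations. The kernel formula is stated where φ(τ)>0. *)

theory Defs
  imports "HOL-Probability.Probability"
begin

section \<open>Prefix trees and their graded graph\<close>

text \<open>Individuals are words over $\{1,2,\dots\}$; the empty word is the ancestor.\<close>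

type_synonym indiv = "nat list"
type_synonym tree = "indiv set"

definition indivs :: "indiv set" where
  "indivs = lists {1..}"

definition prefix_tree :: "tree \<Rightarrow> bool" where
  "prefix_tree \<tau> \<longleftrightarrow> \<tau> \<subseteq> indivs \<and> [] \<in> \<tau> \<and>
     (\<forall>i\<in>indivs. \<forall>j\<in>indivs. i @ j \<in> \<tau> \<longrightarrow> i \<in> \<tau>)"

definition trees_of_size :: "nat \<Rightarrow> tree set" where
  "trees_of_size n = {\<tau>. prefix_tree \<tau> \<and> finite \<tau> \<and> card \<tau> = n}"

definition ptrees :: "tree set" where
  "ptrees = (\<Union>n. trees_of_size (Suc n))"

definition level :: "tree \<Rightarrow> nat" where
  "level \<tau> = card \<tau> - 1"

definition root_tree :: tree where
  "root_tree = {[]}"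

definition subtree :: "tree \<Rightarrow> indiv \<Rightarrow> tree" where
  "subtree \<tau> i = {j \<in> indivs. i @ j \<in> \<tau>}"

definition tree_edge :: "tree \<Rightarrow> tree \<Rightarrow> bool" where
  "tree_edge \<tau> \<sigma> \<longleftrightarrow> \<tau> \<in> ptrees \<and> \<sigma> \<in> ptrees \<and>
     (\<exists>i\<in>\<tau>. \<exists>j\<ge>1. i @ [j] \<notin> \<tau> \<and> \<sigma> = insert (i @ [j]) \<tau>)"

definition finite_path :: "tree list \<Rightarrow> bool" where
  "finite_path s \<longleftrightarrow> s \<noteq> [] \<and> set s \<subseteq> ptrees \<and> successively tree_edge s"

definition num_paths :: "tree \<Rightarrow> tree \<Rightarrow> nat" where
  "num_paths \<tau> \<sigma> = card {s. finite_path s \<and> hd s = \<tau> \<and> last s = \<sigma>}"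

definition infinite_paths :: "(nat \<Rightarrow> tree) set" where
  "infinite_paths = {\<omega>. \<omega> 0 = root_tree \<and> (\<forall>n. tree_edge (\<omega> n) (\<omega> (Suc n)))}"


section \<open>Martin boundary\<close>

definition martin_kernel :: "tree \<Rightarrow> tree \<Rightarrow> real" where
  "martin_kernel \<tau> \<sigma> = real (num_paths \<tau> \<sigma>) / real (num_paths root_tree \<sigma>)"

definition martin_bound :: "tree \<Rightarrow> real" where
  "martin_bound \<tau> = 1 / real (num_paths root_tree \<tau>)"

definition martin_dist :: "(tree \<Rightarrow> real) \<Rightarrow> tree \<Rightarrow> tree \<Rightarrow> real" where
  "martin_dist \<epsilon> \<sigma> \<sigma>' = (\<Sum>\<^sub>\<infinity>\<tau>\<in>ptrees. \<epsilon> \<tau> *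
     (\<bar>martin_kernel \<tau> \<sigma> - martin_kernel \<tau> \<sigma>'\<bar>
      + \<bar>of_bool (\<tau> = \<sigma>) - of_bool (\<tau> = \<sigma>')\<bar>
      + \<bar>of_bool (level \<tau> = level \<sigma>) - of_bool (level \<tau> = level \<sigma>')\<bar>)
     / (martin_bound \<tau> + 1))"

text \<open>A completion of \<^term>\<open>(M, d)\<close> is a complete metric space \<^term>\<open>(X, D)\<close> together with an
  isometric embedding of \<^term>\<open>M\<close> with dense image; it is unique up to isometry, so nothing
  depends on which one is used.\<close>

definition is_completion ::
    "'a set \<Rightarrow> ('a \<Rightarrow> 'a \<Rightarrow> real) \<Rightarrow> 'b set \<Rightarrow> ('b \<Rightarrow> 'b \<Rightarrow> real) \<Rightarrow> ('a \<Rightarrow> 'b) \<Rightarrow> bool" where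
  "is_completion M d X D emb \<longleftrightarrow>
     Metric_space X D \<and> Metric_space.mcomplete X D \<and>
     emb \<in> M \<rightarrow> X \<and> (\<forall>x\<in>M. \<forall>y\<in>M. D (emb x) (emb y) = d x y) \<and>
     Metric_space.mtopology X D closure_of (emb ` M) = X"

text \<open>The completion of a level is its closure in the completion of the whole graph.\<close>

definition martin_boundary ::
    "'b set \<Rightarrow> ('b \<Rightarrow> 'b \<Rightarrow> real) \<Rightarrow> (tree \<Rightarrow> 'b) \<Rightarrow> 'b set" where
  "martin_boundary X D emb =
     X - (\<Union>n. Metric_space.mtopology X D closure_of (emb ` trees_of_size (Suc n)))"

definition converges_to ::
    "'b set \<Rightarrow> ('b \<Rightarrow> 'b \<Rightarrow> real) \<Rightarrow> (tree \<Rightarrow> 'b) \<Rightarrow> (nat \<Rightarrow> tree) \<Rightarrow> 'b \<Rightarrow> bool" where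
  "converges_to X D emb \<omega> \<zeta> \<longleftrightarrow>
     limitin (Metric_space.mtopology X D) (\<lambda>n. emb (\<omega> n)) \<zeta> sequentially"

definition regular_path ::
    "'b set \<Rightarrow> ('b \<Rightarrow> 'b \<Rightarrow> real) \<Rightarrow> (tree \<Rightarrow> 'b) \<Rightarrow> (nat \<Rightarrow> tree) \<Rightarrow> bool" where
  "regular_path X D emb \<omega> \<longleftrightarrow> (\<exists>\<zeta>\<in>martin_boundary X D emb. converges_to X D emb \<omega> \<zeta>)"

text \<open>The function $\varphi_\zeta = K(\cdot,\zeta)$: the extension by continuity of the Martin
  kernel to the completion. Functions on trees are taken to be \<^const>\<open>undefined\<close> off
  \<^const>\<open>ptrees\<close>, so that equality of functions is equality on \<^const>\<open>ptrees\<close>.\<close>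

definition boundary_fun ::
    "'b set \<Rightarrow> ('b \<Rightarrow> 'b \<Rightarrow> real) \<Rightarrow> (tree \<Rightarrow> 'b) \<Rightarrow> 'b \<Rightarrow> tree \<Rightarrow> real" where
  "boundary_fun X D emb \<zeta> = (\<lambda>\<tau>\<in>ptrees. THE c.
     \<forall>\<sigma>. (\<forall>n. \<sigma> n \<in> ptrees) \<and> converges_to X D emb \<sigma> \<zeta> \<longrightarrow>
       (\<lambda>n. martin_kernel \<tau> (\<sigma> n)) \<longlonglongrightarrow> c)"


section \<open>Harmonic functions\<close>

definition nnhf :: "(tree \<Rightarrow> real) set" where
  "nnhf = {\<phi> \<in> ptrees \<rightarrow>\<^sub>E {0..}. \<phi> root_tree = 1 \<and>
     (\<forall>\<tau>\<in>ptrees. (\<phi> has_sum \<phi> \<tau>) {\<sigma>. tree_edge \<tau> \<sigma>})}"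

text \<open>Vertices have infinitely many children, so mass may escape in the limit: along the stars
  $\{\emptyset, 1, \dots, n\}$ the Martin kernels converge to a boundary point \<open>\<zeta>\<close> whose function
  $\varphi_\zeta$ is $1$ at the root and $0$ elsewhere, hence is not harmonic and its labels violate
  $\alpha_\emptyset = \sum_n \alpha_n$. The boundary points to which a non-negative harmonic function
  corresponds are singled out here.\<close>

definition harmonic_boundary ::
    "'b set \<Rightarrow> ('b \<Rightarrow> 'b \<Rightarrow> real) \<Rightarrow> (tree \<Rightarrow> 'b) \<Rightarrow> 'b set" where
  "harmonic_boundary X D emb =
     {\<zeta> \<in> martin_boundary X D emb. boundary_fun X D emb \<zeta> \<in> nnhf}"

definition extremal_nnhf :: "(tree \<Rightarrow> real) set" where
  "extremal_nnhf = {\<phi> \<in> nnhf. \<forall>\<phi>\<^sub>1\<in>nnhf. \<forall>\<phi>\<^sub>2\<in>nnhf. \<forall>t::real. 0 < t \<and> t < 1 \<and>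
     (\<forall>\<tau>\<in>ptrees. \<phi> \<tau> = t * \<phi>\<^sub>1 \<tau> + (1 - t) * \<phi>\<^sub>2 \<tau>) \<longrightarrow> \<phi>\<^sub>1 = \<phi>\<^sub>2}"


section \<open>Saturated central measures\<close>

definition rooted_path :: "tree list \<Rightarrow> bool" where
  "rooted_path s \<longleftrightarrow> finite_path s \<and> hd s = root_tree"

definition cylinder :: "tree list \<Rightarrow> (nat \<Rightarrow> tree) set" where
  "cylinder s = {\<omega> \<in> infinite_paths. \<forall>k<length s. \<omega> k = s ! k}"

definition path_space :: "(nat \<Rightarrow> tree) measure" where
  "path_space = sigma infinite_paths (cylinder ` {s. rooted_path s})"

definition sat_central :: "(nat \<Rightarrow> tree) measure set" where
  "sat_central = {\<mu>. prob_space \<mu> \<and> space \<mu> = infinite_paths \<and> sets \<mu> = sets path_space \<and>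
     (\<forall>s t. rooted_path s \<and> rooted_path t \<and> last s = last t \<longrightarrow>
        measure \<mu> (cylinder s) = measure \<mu> (cylinder t))}"

text \<open>By centrality, the choice of the path to \<open>\<tau>\<close> is irrelevant.\<close>

definition nnhf_of :: "(nat \<Rightarrow> tree) measure \<Rightarrow> tree \<Rightarrow> real" where
  "nnhf_of \<mu> = (\<lambda>\<tau>\<in>ptrees. measure \<mu> (cylinder (SOME s. rooted_path s \<and> last s = \<tau>)))"

text \<open>The Markov kernel lives on $\{\varphi > 0\}$; elsewhere the quotient below is meaningless.\<close>

definition central_kernel :: "(nat \<Rightarrow> tree) measure \<Rightarrow> tree \<Rightarrow> tree \<Rightarrow> real" where
  "central_kernel \<mu> \<tau> \<sigma> = nnhf_of \<mu> \<sigma> / nnhf_of \<mu> \<tau>"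

definition ergodic_central :: "(nat \<Rightarrow> tree) measure set" where
  "ergodic_central = {\<mu> \<in> sat_central.
     \<forall>A \<in> prob_space.tail_events \<mu> (\<lambda>k. {{\<omega> \<in> space \<mu>. \<omega> k \<in> B} | B. B \<subseteq> ptrees}).
       measure \<mu> A \<in> {0, 1}}"


section \<open>Labeled infinite genealogical trees\<close>

text \<open>Labels are \<^const>\<open>undefined\<close> off \<^const>\<open>indivs\<close>, again to make equality extensional.\<close>

definition labels :: "(indiv \<Rightarrow> real) set" where
  "labels = {\<alpha> \<in> indivs \<rightarrow>\<^sub>E {0..1}. \<alpha> [] = 1 \<and>
     (\<forall>i\<in>indivs. ((\<lambda>n. \<alpha> (i @ [n])) has_sum \<alpha> i) {1..})}"

definition label_fun :: "(indiv \<Rightarrow> real) \<Rightarrow> tree \<Rightarrow> real" where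
  "label_fun \<alpha> = (\<lambda>\<tau>\<in>ptrees. \<Prod>i\<in>\<tau>. \<alpha> i)"

end

theory Submission
  imports Defs
begin

text \<open>The hook formula for the number of paths gives
  $K(\tau,\sigma) = \frac{(|\sigma|-|\tau|)!}{|\sigma|!} \prod_{i\in\tau} |\sigma^{(i)}|$, so Martin
  kernels converge iff the proportions $|\sigma^{(i)}|/|\sigma|$ do, and the limits multiply along
  \<open>\<tau>\<close>. For a harmonic function \<open>\<phi>\<close>, the mass of the transitions that insert a vertex below a
  child \<open>v\<close> of \<open>i\<close> is again harmonic on the trees containing \<open>i\<close>; if \<open>\<phi>\<close> is extremal, it is
  therefore a multiple of \<open>\<phi>\<close>, which makes \<open>\<phi>\<close> a product of labels. Conversely a harmonic
  function dominated by a product of labels is an eigenfunction of the same operators, by the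
  Choquet--Deny argument, hence equal to that product. Ergodicity is compared with extremality by
  conditioning on tail events and by the martingale of ratios of harmonic functions.\<close>

section \<open>Prefix trees\<close>

text \<open>Every tree has infinitely many successors, so limits can lose mass and compactness
  arguments break down. Extremality is therefore tested by domination
  (\<open>extremal_dominated\<close>, \<open>extremal_nnhf_not_mono\<close>). The operator used for
  this counts all insertions into the branch of a child \<open>v\<close> of \<open>i\<close>, not
  only that of \<open>v\<close> itself: the latter is possible just once, whereas the branch can
  keep growing, so the operator preserves harmonicity and can be iterated. It behaves well only on
  trees that contain \<open>i\<close>, and \<open>harmonic_extension\<close> bridges this when a
  globally harmonic function is wanted. Two existence questions are answered by explicit
  constructions rather than by limit theorems for random paths: boundary points with given labels
  are limits of trees built by hand, which need not form a path, and central measures are built for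
  products of labels, which suffices because every extremal function is such a product.\<close>

definition addable :: "tree \<Rightarrow> indiv set" where
  "addable \<tau> = {i @ [j] | i j. i \<in> \<tau> \<and> j \<ge> 1 \<and> i @ [j] \<notin> \<tau>}"

lemma indivs_simps [simp]:
  "[] \<in> indivs"
  "i @ j \<in> indivs \<longleftrightarrow> i \<in> indivs \<and> j \<in> indivs"
  "[n] \<in> indivs \<longleftrightarrow> n \<ge> 1"
  by (auto simp: indivs_def)

lemma prefix_tree_card: "prefix_tree \<tau> \<Longrightarrow> finite \<tau> \<Longrightarrow> \<exists>n. card \<tau> = Suc n"
  unfolding prefix_tree_def by (metis card_0_eq empty_iff not0_implies_Suc)

lemma ptrees_iff:
  "\<tau> \<in> ptrees \<longleftrightarrow> finite \<tau> \<and> [] \<in> \<tau> \<and> \<tau> \<subseteq> indivs \<and> (\<forall>i j. i @ j \<in> \<tau> \<longrightarrow> i \<in> \<tau>)"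
proof -
  have "\<tau> \<in> ptrees \<longleftrightarrow> prefix_tree \<tau> \<and> finite \<tau>"
    using prefix_tree_card by (auto simp: ptrees_def trees_of_size_def)
  also have "\<dots> \<longleftrightarrow> finite \<tau> \<and> [] \<in> \<tau> \<and> \<tau> \<subseteq> indivs \<and> (\<forall>i j. i @ j \<in> \<tau> \<longrightarrow> i \<in> \<tau>)"
    unfolding prefix_tree_def using indivs_simps(2) by blast
  finally show ?thesis .
qed

lemma ptreesD:
  assumes "\<tau> \<in> ptrees"
  shows ptrees_finite: "finite \<tau>" and ptrees_Nil: "[] \<in> \<tau>" and ptrees_indivs: "\<tau> \<subseteq> indivs"
    and ptrees_prefix: "i @ j \<in> \<tau> \<Longrightarrow> i \<in> \<tau>"
    and ptrees_card_pos: "card \<tau> > 0"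
  using assms unfolding ptrees_iff by (auto simp: card_gt_0_iff)

lemma trees_of_size_eq: "trees_of_size n = {\<tau> \<in> ptrees. card \<tau> = n}"
  using prefix_tree_card by (auto simp: trees_of_size_def ptrees_def)

lemma ptrees_prefix': "\<tau> \<in> ptrees \<Longrightarrow> prefix i k \<Longrightarrow> k \<in> \<tau> \<Longrightarrow> i \<in> \<tau>"
  by (auto simp: prefix_def dest: ptrees_prefix)

lemma countable_ptrees: "countable ptrees"
  by (rule countable_subset[of _ "{A. finite A}"])
     (auto simp: ptrees_finite intro: countable_Collect_finite)

lemma root_in_ptrees [simp]: "root_tree \<in> ptrees"
  by (auto simp: ptrees_iff root_tree_def)

lemma root_subset: "\<tau> \<in> ptrees \<Longrightarrow> root_tree \<subseteq> \<tau>"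
  by (auto simp: root_tree_def ptrees_Nil)

lemma addable_iff:
  "v \<in> addable \<tau> \<longleftrightarrow> v \<noteq> [] \<and> butlast v \<in> \<tau> \<and> last v \<ge> 1 \<and> v \<notin> \<tau>"
  unfolding addable_def
  by (auto intro!: exI[of _ "butlast v"] exI[of _ "last v"])

lemma addable_notin: "v \<in> addable \<tau> \<Longrightarrow> v \<notin> \<tau>"
  by (auto simp: addable_iff)

lemma addable_snoc [simp]: "i @ [j] \<in> addable \<tau> \<longleftrightarrow> i \<in> \<tau> \<and> j \<ge> 1 \<and> i @ [j] \<notin> \<tau>"
  by (auto simp: addable_iff)

lemma addable_prefix_in:
  assumes "\<tau> \<in> ptrees" "w \<in> addable \<tau>" "strict_prefix v w"
  shows "v \<in> \<tau>"
proof -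
  have "w \<noteq> []" "butlast w \<in> \<tau>" using assms by (auto simp: addable_iff)
  moreover have "prefix v (butlast w)"
    using assms(3) \<open>w \<noteq> []\<close>
    by (metis append_butlast_last_id prefix_snoc strict_prefix_def)
  ultimately show ?thesis using assms(1) ptrees_prefix' by blast
qed

lemma addable_indivs: "\<tau> \<in> ptrees \<Longrightarrow> v \<in> addable \<tau> \<Longrightarrow> v \<in> indivs"
  unfolding addable_def using ptrees_indivs[of \<tau>] by auto

lemma insert_ptrees:
  assumes "\<tau> \<in> ptrees" "v \<in> addable \<tau>"
  shows "insert v \<tau> \<in> ptrees"
  unfolding ptrees_iff
proof (intro conjI allI impI)
  show "insert v \<tau> \<subseteq> indivs" using assms addable_indivs ptrees_indivs by blast
  fix i j assume "i @ j \<in> insert v \<tau>"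
  then show "i \<in> insert v \<tau>"
    using addable_prefix_in[OF assms, of i] ptrees_prefix[OF assms(1)]
    by (cases "j = []") (auto simp: strict_prefix_def)
qed (use assms ptreesD in auto)

lemma tree_edge_iff: "tree_edge \<tau> \<sigma> \<longleftrightarrow> \<tau> \<in> ptrees \<and> (\<exists>v\<in>addable \<tau>. \<sigma> = insert v \<tau>)"
  unfolding tree_edge_def using insert_ptrees by (auto simp: addable_def)

lemma tree_edgeD:
  assumes "tree_edge \<tau> \<sigma>"
  shows "\<tau> \<in> ptrees" "\<sigma> \<in> ptrees" "\<tau> \<subseteq> \<sigma>" "card \<sigma> = Suc (card \<tau>)" "\<tau> \<noteq> \<sigma>"
  using assms insert_ptrees ptrees_finite
  by (auto simp: tree_edge_iff addable_notin) (metis addable_notin insertI1)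

lemma edges_eq: "\<tau> \<in> ptrees \<Longrightarrow> {\<sigma>. tree_edge \<tau> \<sigma>} = (\<lambda>v. insert v \<tau>) ` addable \<tau>"
  by (auto simp: tree_edge_iff)

lemma inj_on_insert_addable: "inj_on (\<lambda>v. insert v \<tau>) (addable \<tau>)"
  by (auto simp: inj_on_def addable_iff)

lemma has_sum_edges:
  "\<tau> \<in> ptrees \<Longrightarrow>
    (f has_sum c) {\<sigma>. tree_edge \<tau> \<sigma>} \<longleftrightarrow> ((\<lambda>v. f (insert v \<tau>)) has_sum c) (addable \<tau>)"
  by (simp add: edges_eq has_sum_reindex inj_on_insert_addable o_def)

text \<open>No child of \<open>w\<close> can already lie in \<open>\<tau>\<close>, since prefix
  closure would put \<open>w\<close> there; hence all children open up at once.\<close>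

lemma addable_insert:
  assumes "\<tau> \<in> ptrees" "w \<in> addable \<tau>"
  shows "addable (insert w \<tau>) = (addable \<tau> - {w}) \<union> (\<lambda>j. w @ [j]) ` {1..}"
proof -
  have "w @ [j] \<notin> \<tau>" for j
    using assms ptrees_prefix[OF assms(1)] by (auto simp: addable_iff)
  then show ?thesis
    using assms(2) by (auto simp: addable_def)
qed

lemma child_notin_addable:
  assumes "\<tau> \<in> ptrees" "w \<notin> \<tau>"
  shows "w @ [j] \<notin> addable \<tau>"
  using assms by auto

lemma addable_root: "addable root_tree = (\<lambda>j. [j]) ` {1..}"
  by (auto simp: addable_def root_tree_def)

text \<open>The witness is the shortest prefix of \<open>x\<close> outside \<open>\<tau>\<close>:
  its parent is in \<open>\<tau>\<close>, and prefix closure keeps it inside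
  \<open>\<sigma>\<close>.\<close>

lemma addable_between:
  assumes "\<tau> \<in> ptrees" "\<sigma> \<in> ptrees" "x \<in> \<sigma>" "x \<notin> \<tau>"
  obtains v where "v \<in> addable \<tau>" "v \<in> \<sigma>" "prefix v x"
proof -
  have "\<exists>v. v \<in> addable \<tau> \<and> v \<in> \<sigma> \<and> prefix v x"
    using assms(3,4)
  proof (induction x rule: rev_induct)
    case Nil
    then show ?case using assms(1) ptrees_Nil by blast
  next
    case (snoc j x)
    have "x \<in> \<sigma>" using snoc.prems assms(2) ptrees_prefix by blast
    moreover have "j \<ge> 1" using snoc.prems ptrees_indivs[OF assms(2)] by auto
    ultimately show ?case
      using snoc by (cases "x \<in> \<tau>") (auto intro: exI[of _ "x @ [j]"])
  qed
  then show ?thesis using that by blast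
qed

text \<open>Growth induction that never leaves \<open>\<sigma>\<close>: while a vertex is missing,
  \<open>addable_between\<close> offers one whose insertion stays inside
  \<open>\<sigma>\<close>.\<close>

lemma ptrees_between_induct [consumes 3, case_names base step]:
  assumes "\<tau> \<in> ptrees" "\<sigma> \<in> ptrees" "\<tau> \<subseteq> \<sigma>"
    and "P \<tau>"
    and "\<And>\<rho> v. \<rho> \<in> ptrees \<Longrightarrow> \<tau> \<subseteq> \<rho> \<Longrightarrow> \<rho> \<subseteq> \<sigma> \<Longrightarrow> P \<rho> \<Longrightarrow> v \<in> addable \<rho> \<Longrightarrow> v \<in> \<sigma> \<Longrightarrow> P (insert v \<rho>)"
  shows "P \<sigma>"
proof -
  have "\<rho> \<in> ptrees \<Longrightarrow> \<tau> \<subseteq> \<rho> \<Longrightarrow> \<rho> \<subseteq> \<sigma> \<Longrightarrow> P \<rho> \<Longrightarrow> P \<sigma>" for \<rho>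
  proof (induction "card (\<sigma> - \<rho>)" arbitrary: \<rho> rule: less_induct)
    case less
    show ?case
    proof (cases "\<rho> = \<sigma>")
      case False
      then obtain x where "x \<in> \<sigma>" "x \<notin> \<rho>" using less.prems by blast
      then obtain v where v: "v \<in> addable \<rho>" "v \<in> \<sigma>"
        using addable_between less.prems(1) assms(2) by metis
      have "\<sigma> - insert v \<rho> \<subset> \<sigma> - \<rho>" using v addable_notin by auto
      then have "card (\<sigma> - insert v \<rho>) < card (\<sigma> - \<rho>)"
        using ptrees_finite[OF assms(2)] by (intro psubset_card_mono) auto
      then show ?thesis
        using less v assms(5)[of \<rho> v] insert_ptrees by (meson insert_subset subset_insertI2)
    qed (use less in auto)
  qed
  then show ?thesis using assms by blast
qed

lemma ptrees_induct [consumes 1, case_names root insert]: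
  assumes "\<tau> \<in> ptrees" "P root_tree"
    and "\<And>\<rho> v. \<rho> \<in> ptrees \<Longrightarrow> P \<rho> \<Longrightarrow> v \<in> addable \<rho> \<Longrightarrow> P (insert v \<rho>)"
  shows "P \<tau>"
  using root_in_ptrees assms(1) root_subset[OF assms(1)] assms(2,3)
  by (rule ptrees_between_induct)

section \<open>Counting paths\<close>

lemma finite_path_hd_subset_last: "finite_path s \<Longrightarrow> hd s \<subseteq> last s"
proof (induction s)
  case (Cons a s)
  then show ?case
    by (cases "s = []") (auto simp: finite_path_def successively_Cons dest: tree_edgeD)
qed (simp add: finite_path_def)

text \<open>Trees only grow along a path, so the first inserted vertex already belongs to
  \<open>\<sigma>\<close>. This makes the union finite for finite \<open>\<sigma>\<close>, although
  \<open>\<tau>\<close> has infinitely many successors.\<close>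

lemma num_paths_set_rec:
  assumes "\<tau> \<in> ptrees" "\<tau> \<noteq> \<sigma>"
  shows "{s. finite_path s \<and> hd s = \<tau> \<and> last s = \<sigma>} =
    (\<Union>v\<in>addable \<tau> \<inter> \<sigma>. (#) \<tau> ` {s. finite_path s \<and> hd s = insert v \<tau> \<and> last s = \<sigma>})"
    (is "?L = ?R")
proof (intro equalityI subsetI)
  fix s assume s: "s \<in> ?L"
  then obtain s' where s': "s = \<tau> # s'" by (auto simp: finite_path_def neq_Nil_conv)
  with s assms have "s' \<noteq> []" by auto
  with s s' have *: "tree_edge \<tau> (hd s')" "finite_path s'" "last s' = \<sigma>"
    by (auto simp: finite_path_def successively_Cons)
  then obtain v where "v \<in> addable \<tau>" "hd s' = insert v \<tau>" by (auto simp: tree_edge_iff)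
  moreover from this have "v \<in> \<sigma>" using * finite_path_hd_subset_last by blast
  ultimately show "s \<in> ?R" using s' * by blast
next
  fix s assume "s \<in> ?R"
  then obtain v s' where "v \<in> addable \<tau>" "v \<in> \<sigma>" "s = \<tau> # s'" "finite_path s'" "hd s' = insert v \<tau>"
    "last s' = \<sigma>" by blast
  then show "s \<in> ?L" using assms
    by (auto simp: finite_path_def successively_Cons tree_edge_iff)
qed

lemma num_paths_eq_0:
  assumes "\<not> \<tau> \<subseteq> \<sigma>"
  shows "num_paths \<tau> \<sigma> = 0"
proof -
  have "{s. finite_path s \<and> hd s = \<tau> \<and> last s = \<sigma>} = {}"
    using assms finite_path_hd_subset_last by blast
  then show ?thesis unfolding num_paths_def by (metis card.empty)
qed

lemma finite_paths_refl:
  assumes "\<tau> \<in> ptrees"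
  shows "{s. finite_path s \<and> hd s = \<tau> \<and> last s = \<tau>} = {[\<tau>]}"
proof (intro equalityI subsetI)
  fix s assume s: "s \<in> {s. finite_path s \<and> hd s = \<tau> \<and> last s = \<tau>}"
  then obtain s' where s': "s = \<tau> # s'" by (auto simp: finite_path_def neq_Nil_conv)
  have "s' = []"
  proof (rule ccontr)
    assume "s' \<noteq> []"
    then have "tree_edge \<tau> (hd s')" "finite_path s'" "last s' = \<tau>"
      using s s' by (auto simp: finite_path_def successively_Cons)
    then show False using finite_path_hd_subset_last[of s'] tree_edgeD[of \<tau> "hd s'"] by auto
  qed
  then show "s \<in> {[\<tau>]}" using s' by simp
qed (use assms in \<open>auto simp: finite_path_def\<close>)

lemma num_paths_refl: "\<tau> \<in> ptrees \<Longrightarrow> num_paths \<tau> \<tau> = 1"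
  by (simp add: num_paths_def finite_paths_refl)

text \<open>\<open>card\<close> is 0 on infinite sets, so \<open>num_paths\<close> really counts
  paths only once finiteness is known.\<close>

lemma finite_paths_between:
  assumes "\<tau> \<in> ptrees" "\<sigma> \<in> ptrees" 
  shows "finite {s. finite_path s \<and> hd s = \<tau> \<and> last s = \<sigma>}"
  using assms
proof (induction "card (\<sigma> - \<tau>)" arbitrary: \<tau> rule: less_induct)
  case less
  show ?case
  proof (cases "\<tau> \<subset> \<sigma>")
    case False
    then consider "\<tau> = \<sigma>" | "\<not> \<tau> \<subseteq> \<sigma>" by blast
    then show ?thesis
    proof cases
      case 1 then show ?thesis using finite_paths_refl less.prems by simp
    next
      case 2
      then have "{s. finite_path s \<and> hd s = \<tau> \<and> last s = \<sigma>} = {}"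
        using finite_path_hd_subset_last by blast
      then show ?thesis by (metis finite.emptyI)
    qed
  next
    case True
    have "finite {s. finite_path s \<and> hd s = insert v \<tau> \<and> last s = \<sigma>}"
      if "v \<in> addable \<tau> \<inter> \<sigma>" for v
    proof (rule less.hyps)
      have "\<sigma> - insert v \<tau> \<subset> \<sigma> - \<tau>" using that addable_notin by auto
      then show "card (\<sigma> - insert v \<tau>) < card (\<sigma> - \<tau>)"
        using ptrees_finite[OF less.prems(2)] by (intro psubset_card_mono) auto
    qed (use that less.prems insert_ptrees in auto)
    then show ?thesis
      using num_paths_set_rec[OF less.prems(1), of \<sigma>] True ptrees_finite[OF less.prems(2)]
      by (simp add: psubset_eq)
  qed
qed

lemma num_paths_rec:
  assumes "\<tau> \<in> ptrees" "\<sigma> \<in> ptrees" "\<tau> \<noteq> \<sigma>"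
  shows "num_paths \<tau> \<sigma> = (\<Sum>v\<in>addable \<tau> \<inter> \<sigma>. num_paths (insert v \<tau>) \<sigma>)"
proof -
  let ?S = "\<lambda>\<tau>. {s. finite_path s \<and> hd s = \<tau> \<and> last s = \<sigma>}"
  have "?S \<tau> = (\<Union>v\<in>addable \<tau> \<inter> \<sigma>. (#) \<tau> ` ?S (insert v \<tau>))"
    by (rule num_paths_set_rec[OF assms(1,3)])
  then have "num_paths \<tau> \<sigma> = card (\<Union>v\<in>addable \<tau> \<inter> \<sigma>. (#) \<tau> ` ?S (insert v \<tau>))"
    unfolding num_paths_def by simp
  also have "\<dots> = (\<Sum>v\<in>addable \<tau> \<inter> \<sigma>. card ((#) \<tau> ` ?S (insert v \<tau>)))"
  proof (intro card_UN_disjoint ballI impI finite_imageI)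
    fix v w assume "v \<in> addable \<tau> \<inter> \<sigma>" "w \<in> addable \<tau> \<inter> \<sigma>" "v \<noteq> w"
    then have "insert v \<tau> \<noteq> insert w \<tau>" using addable_notin by blast
    then show "(#) \<tau> ` ?S (insert v \<tau>) \<inter> (#) \<tau> ` ?S (insert w \<tau>) = {}" by auto
  next
    fix v assume "v \<in> addable \<tau> \<inter> \<sigma>"
    then show "finite (?S (insert v \<tau>))"
      using assms insert_ptrees by (intro finite_paths_between) auto
  qed (use ptrees_finite[OF assms(2)] in simp)
  also have "\<dots> = (\<Sum>v\<in>addable \<tau> \<inter> \<sigma>. num_paths (insert v \<tau>) \<sigma>)"
    unfolding num_paths_def by (intro sum.cong refl card_image) auto
  finally show ?thesis .
qed

text \<open>Prefixes of one word are comparable, and a proper prefix of an addable vertex is already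
  present.\<close>

lemma addable_prefix_unique:
  assumes "\<tau> \<in> ptrees" "v \<in> addable \<tau>" "w \<in> addable \<tau>" "prefix v x" "prefix w x"
  shows "v = w"
proof (rule ccontr)
  assume "v \<noteq> w"
  then consider "strict_prefix v w" | "strict_prefix w v"
    using assms(4,5) prefix_same_cases[of v x w] by (auto simp: strict_prefix_def)
  then show False using assms addable_prefix_in addable_notin by metis
qed

section \<open>Hook lengths and the hook formula\<close>

lemma card_subtree:
  assumes "\<sigma> \<in> ptrees"
  shows "card (subtree \<sigma> i) = card {k \<in> \<sigma>. prefix i k}"
proof -
  have "{k \<in> \<sigma>. prefix i k} = (@) i ` subtree \<sigma> i"
    using ptrees_indivs[OF assms] by (auto simp: subtree_def prefix_def)
  then show ?thesis by (metis append_eq_append_conv card_image inj_onI)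
qed

lemma card_subtree_pos:
  assumes "\<sigma> \<in> ptrees" "i \<in> \<sigma>"
  shows "card (subtree \<sigma> i) > 0"
  unfolding card_subtree[OF assms(1)]
  using assms ptrees_finite by (auto simp: card_gt_0_iff)

lemma card_subtree_eq_0:
  assumes "\<sigma> \<in> ptrees" "i \<notin> \<sigma>"
  shows "card (subtree \<sigma> i) = 0"
proof -
  have "{k \<in> \<sigma>. prefix i k} = {}" using assms ptrees_prefix' by blast
  then show ?thesis using card_subtree[OF assms(1)] by (metis card.empty)
qed

lemma card_subtree_Nil: "\<sigma> \<in> ptrees \<Longrightarrow> card (subtree \<sigma> []) = card \<sigma>"
  by (simp add: card_subtree)

text \<open>Each missing vertex extends exactly one addable vertex, by
  \<open>addable_between\<close> and \<open>addable_prefix_unique\<close>. This identity makes the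
  hook formula reproduce itself under the first-step recursion.\<close>

lemma card_diff_eq_sum_subtrees:
  assumes "\<tau> \<in> ptrees" "\<sigma> \<in> ptrees"
  shows "card (\<sigma> - \<tau>) = (\<Sum>v\<in>addable \<tau> \<inter> \<sigma>. card (subtree \<sigma> v))"
proof -
  have "\<sigma> - \<tau> = (\<Union>v\<in>addable \<tau> \<inter> \<sigma>. {k \<in> \<sigma>. prefix v k})"
  proof (intro equalityI subsetI)
    fix x assume "x \<in> \<sigma> - \<tau>"
    then obtain v where "v \<in> addable \<tau>" "v \<in> \<sigma>" "prefix v x"
      using addable_between[OF assms] by (metis DiffD1 DiffD2)
    with \<open>x \<in> \<sigma> - \<tau>\<close> show "x \<in> (\<Union>v\<in>addable \<tau> \<inter> \<sigma>. {k \<in> \<sigma>. prefix v k})" by blast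
  next
    fix x assume "x \<in> (\<Union>v\<in>addable \<tau> \<inter> \<sigma>. {k \<in> \<sigma>. prefix v k})"
    then show "x \<in> \<sigma> - \<tau>" using addable_notin ptrees_prefix'[OF assms(1)] by blast
  qed
  then have "card (\<sigma> - \<tau>) = card (\<Union>v\<in>addable \<tau> \<inter> \<sigma>. {k \<in> \<sigma>. prefix v k})"
    by simp
  also have "\<dots> = (\<Sum>v\<in>addable \<tau> \<inter> \<sigma>. card {k \<in> \<sigma>. prefix v k})"
  proof (intro card_UN_disjoint ballI impI)
    fix v w assume "v \<in> addable \<tau> \<inter> \<sigma>" "w \<in> addable \<tau> \<inter> \<sigma>" "v \<noteq> w"
    then show "{k \<in> \<sigma>. prefix v k} \<inter> {k \<in> \<sigma>. prefix w k} = {}"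
      using addable_prefix_unique[OF assms(1)] by blast
  qed (use ptrees_finite[OF assms(2)] in auto)
  finally show ?thesis using card_subtree[OF assms(2)] by simp
qed

text \<open>Splitting off the first inserted vertex keeps \<open>\<sigma>\<close>, hence all hook lengths, fixed; removing
  the last one would not.\<close>

lemma num_paths_hook:
  assumes "\<tau> \<in> ptrees" "\<sigma> \<in> ptrees" "\<tau> \<subseteq> \<sigma>"
  shows "real (num_paths \<tau> \<sigma>) * (\<Prod>i\<in>\<sigma> - \<tau>. real (card (subtree \<sigma> i))) = fact (card (\<sigma> - \<tau>))"
  using assms
proof (induction "card (\<sigma> - \<tau>)" arbitrary: \<tau> rule: less_induct)
  case less
  show ?case
  proof (cases "\<tau> = \<sigma>")
    case True
    then show ?thesis using less.prems by (simp add: num_paths_refl)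
  next
    case False
    let ?N = "\<lambda>i. real (card (subtree \<sigma> i))"
    have fin: "finite \<sigma>" by (rule ptrees_finite[OF less.prems(2)])
    have pos: "card (\<sigma> - \<tau>) > 0" using False less.prems fin by (auto simp: card_gt_0_iff)
    have step: "real (num_paths (insert v \<tau>) \<sigma>) * (\<Prod>i\<in>\<sigma> - \<tau>. ?N i) =
        ?N v * fact (card (\<sigma> - \<tau>) - 1)" if v: "v \<in> addable \<tau> \<inter> \<sigma>" for v
    proof -
      have c: "card (\<sigma> - insert v \<tau>) = card (\<sigma> - \<tau>) - 1"
        using v addable_notin[of v \<tau>] by (intro card_Diff_insert) auto
      have "(\<Prod>i\<in>\<sigma> - \<tau>. ?N i) = ?N v * (\<Prod>i\<in>\<sigma> - insert v \<tau>. ?N i)"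
        using prod.remove[of "\<sigma> - \<tau>" v ?N] v fin addable_notin[of v \<tau>]
        unfolding Diff_insert[of \<sigma> v \<tau>] by blast
      moreover have "real (num_paths (insert v \<tau>) \<sigma>) * (\<Prod>i\<in>\<sigma> - insert v \<tau>. ?N i) =
          fact (card (\<sigma> - insert v \<tau>))"
        using v less.prems pos c insert_ptrees[of \<tau> v] by (intro less.hyps) auto
      ultimately show ?thesis using c by (simp add: algebra_simps)
    qed
    have "real (num_paths \<tau> \<sigma>) * (\<Prod>i\<in>\<sigma> - \<tau>. ?N i) =
        (\<Sum>v\<in>addable \<tau> \<inter> \<sigma>. real (num_paths (insert v \<tau>) \<sigma>) * (\<Prod>i\<in>\<sigma> - \<tau>. ?N i))"
      using num_paths_rec[OF less.prems(1,2) False] by (simp add: sum_distrib_right)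
    also have "\<dots> = (\<Sum>v\<in>addable \<tau> \<inter> \<sigma>. ?N v) * fact (card (\<sigma> - \<tau>) - 1)"
      using step by (simp add: sum_distrib_right)
    also have "\<dots> = real (card (\<sigma> - \<tau>)) * fact (card (\<sigma> - \<tau>) - 1)"
      using card_diff_eq_sum_subtrees[OF less.prems(1,2)] by simp
    also have "\<dots> = fact (card (\<sigma> - \<tau>))"
      by (rule fact_reduce[OF pos, symmetric])
    finally show ?thesis .
  qed
qed

lemma num_paths_eq:
  assumes "\<tau> \<in> ptrees" "\<sigma> \<in> ptrees" "\<tau> \<subseteq> \<sigma>"
  shows "real (num_paths \<tau> \<sigma>) = fact (card \<sigma> - card \<tau>) / (\<Prod>i\<in>\<sigma> - \<tau>. real (card (subtree \<sigma> i)))"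
proof -
  have "(\<Prod>i\<in>\<sigma> - \<tau>. real (card (subtree \<sigma> i))) \<noteq> 0"
    using card_subtree_pos[OF assms(2)] ptrees_finite[OF assms(2)] by auto
  moreover have "card (\<sigma> - \<tau>) = card \<sigma> - card \<tau>"
    using assms ptrees_finite by (simp add: card_Diff_subset)
  ultimately show ?thesis using num_paths_hook[OF assms] by (simp add: field_simps)
qed

text \<open>Counting from the root omits the hook of the root, which is
  \<open>card \<sigma>\<close>; expanding the fraction by it turns
  \<open>fact (card \<sigma> - 1)\<close> into \<open>fact (card \<sigma>)\<close>.\<close>

lemma num_paths_root:
  assumes "\<sigma> \<in> ptrees"
  shows "real (num_paths root_tree \<sigma>) = fact (card \<sigma>) / (\<Prod>i\<in>\<sigma>. real (card (subtree \<sigma> i)))"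
proof -
  have "(\<Prod>i\<in>\<sigma>. real (card (subtree \<sigma> i))) =
      real (card \<sigma>) * (\<Prod>i\<in>\<sigma> - {[]}. real (card (subtree \<sigma> i)))"
    using assms ptrees_Nil ptrees_finite card_subtree_Nil by (subst prod.remove[of _ "[]"]) auto
  moreover have "fact (card \<sigma>) = real (card \<sigma>) * fact (card \<sigma> - 1)"
    by (rule fact_reduce[OF ptrees_card_pos[OF assms]])
  ultimately show ?thesis
    using num_paths_eq[OF root_in_ptrees assms root_subset[OF assms]] ptrees_card_pos[OF assms]
    by (simp add: root_tree_def)
qed

lemma num_paths_root_pos:
  assumes "\<sigma> \<in> ptrees"
  shows "num_paths root_tree \<sigma> > 0"
proof -
  have "(\<Prod>i\<in>\<sigma>. real (card (subtree \<sigma> i))) > 0"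
    using card_subtree_pos[OF assms] by (intro prod_pos) simp
  then have "real (num_paths root_tree \<sigma>) > 0"
    unfolding num_paths_root[OF assms] by (intro divide_pos_pos) simp_all
  then show ?thesis by simp
qed

text \<open>The left side counts only those paths that pass through \<open>\<tau>\<close>. This is
  the source of the bound \<open>martin_bound\<close> on the kernel.\<close>

lemma num_paths_mult_le:
  assumes "\<rho> \<in> ptrees" "\<tau> \<in> ptrees" "\<sigma> \<in> ptrees"
  shows "num_paths \<rho> \<tau> * num_paths \<tau> \<sigma> \<le> num_paths \<rho> \<sigma>"
proof (cases "\<rho> \<subseteq> \<tau> \<and> \<tau> \<subseteq> \<sigma>")
  case False
  then have "num_paths \<rho> \<tau> = 0 \<or> num_paths \<tau> \<sigma> = 0" using num_paths_eq_0 by metis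
  then show ?thesis by auto
next
  case True
  with assms show ?thesis
  proof (induction "card (\<tau> - \<rho>)" arbitrary: \<rho> rule: less_induct)
    case less
    show ?case
    proof (cases "\<rho> = \<tau>")
      case True
      then show ?thesis using less.prems by (simp add: num_paths_refl)
    next
      case False
      have ne: "\<rho> \<noteq> \<sigma>" using False less.prems by auto
      have "num_paths \<rho> \<tau> * num_paths \<tau> \<sigma> =
          (\<Sum>v\<in>addable \<rho> \<inter> \<tau>. num_paths (insert v \<rho>) \<tau> * num_paths \<tau> \<sigma>)"
        using num_paths_rec[OF _ _ False] less.prems by (simp add: sum_distrib_right)
      also have "\<dots> \<le> (\<Sum>v\<in>addable \<rho> \<inter> \<tau>. num_paths (insert v \<rho>) \<sigma>)"
      proof (rule sum_mono)
        fix v assume v: "v \<in> addable \<rho> \<inter> \<tau>"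
        have "\<tau> - insert v \<rho> \<subset> \<tau> - \<rho>" using v addable_notin by auto
        then have "card (\<tau> - insert v \<rho>) < card (\<tau> - \<rho>)"
          using ptrees_finite[OF less.prems(2)] by (intro psubset_card_mono) auto
        then show "num_paths (insert v \<rho>) \<tau> * num_paths \<tau> \<sigma> \<le> num_paths (insert v \<rho>) \<sigma>"
          using less.hyps[of "insert v \<rho>"] v less.prems insert_ptrees[of \<rho> v] by auto
      qed
      also have "\<dots> \<le> (\<Sum>v\<in>addable \<rho> \<inter> \<sigma>. num_paths (insert v \<rho>) \<sigma>)"
        using less.prems ptrees_finite[of \<sigma>] by (intro sum_mono2) auto
      also have "\<dots> = num_paths \<rho> \<sigma>"
        using num_paths_rec[OF _ _ ne] less.prems by simp
      finally show ?thesis .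
    qed
  qed
qed

section \<open>The Martin kernel\<close>

lemma martin_kernel_nonneg [simp]: "martin_kernel \<tau> \<sigma> \<ge> 0"
  by (simp add: martin_kernel_def)

lemma martin_kernel_le:
  assumes "\<tau> \<in> ptrees" "\<sigma> \<in> ptrees"
  shows "martin_kernel \<tau> \<sigma> \<le> martin_bound \<tau>"
proof -
  have "real (num_paths root_tree \<tau>) * real (num_paths \<tau> \<sigma>) \<le> real (num_paths root_tree \<sigma>)"
    using num_paths_mult_le[OF root_in_ptrees assms] by (simp flip: of_nat_mult)
  then show ?thesis
    using num_paths_root_pos assms by (simp add: martin_kernel_def martin_bound_def field_simps)
qed

text \<open>The hooks of vertices outside \<open>\<tau>\<close> cancel in the quotient. If
  \<open>\<tau>\<close> is not contained in \<open>\<sigma>\<close> both sides vanish, the right one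
  because an absent vertex has an empty subtree.\<close>

lemma martin_kernel_eq:
  assumes "\<tau> \<in> ptrees" "\<sigma> \<in> ptrees"
  shows "martin_kernel \<tau> \<sigma> =
    fact (card \<sigma> - card \<tau>) / fact (card \<sigma>) * (\<Prod>i\<in>\<tau>. real (card (subtree \<sigma> i)))"
proof (cases "\<tau> \<subseteq> \<sigma>")
  case True
  have "(\<Prod>i\<in>\<sigma>. real (card (subtree \<sigma> i))) =
      (\<Prod>i\<in>\<sigma> - \<tau>. real (card (subtree \<sigma> i))) * (\<Prod>i\<in>\<tau>. real (card (subtree \<sigma> i)))"
    using prod.subset_diff[OF True ptrees_finite[OF assms(2)]] .
  moreover have "(\<Prod>i\<in>\<sigma> - \<tau>. real (card (subtree \<sigma> i))) \<noteq> 0"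
    using card_subtree_pos[OF assms(2)] ptrees_finite[OF assms(2)] by auto
  ultimately show ?thesis
    unfolding martin_kernel_def num_paths_eq[OF assms True] num_paths_root[OF assms(2)]
    by simp
next
  case False
  then obtain i where "i \<in> \<tau>" "i \<notin> \<sigma>" by blast
  then have "(\<Prod>i\<in>\<tau>. real (card (subtree \<sigma> i))) = 0"
    using card_subtree_eq_0[OF assms(2)] ptrees_finite[OF assms(1)] by (intro prod_zero bexI) auto
  then show ?thesis using False by (simp add: martin_kernel_def num_paths_eq_0)
qed

section \<open>Harmonic functions\<close>

lemma has_sum_diff:
  fixes f g :: "'a \<Rightarrow> real"
  assumes "(f has_sum a) A" "(g has_sum b) A"
  shows "((\<lambda>x. f x - g x) has_sum (a - b)) A"
  using has_sum_add[OF assms(1) has_sum_uminusI[OF assms(2)]] by simp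

lemma has_sum_nonneg_Sigma:
  fixes f :: "'a \<Rightarrow> 'b \<Rightarrow> real"
  assumes "\<And>x. x \<in> A \<Longrightarrow> (f x has_sum g x) (B x)" "(g has_sum S) A"
    and "\<And>x y. x \<in> A \<Longrightarrow> y \<in> B x \<Longrightarrow> f x y \<ge> 0"
  shows "((\<lambda>(x, y). f x y) has_sum S) (Sigma A B)"
  using assms
  by (intro has_sum_SigmaI[where g = g] summable_on_SigmaI[where g = g])
     (auto intro: has_sum_imp_summable)

text \<open>Tonelli's theorem: by nonnegativity the iterated sum already yields summability of the
  double family.\<close>

lemma has_sum_nonneg_swap:
  fixes f :: "'a \<Rightarrow> 'b \<Rightarrow> real"
  assumes "\<And>x. x \<in> A \<Longrightarrow> (f x has_sum g x) B" "(g has_sum S) A"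
    and "\<And>y. y \<in> B \<Longrightarrow> ((\<lambda>x. f x y) has_sum h y) A"
    and "\<And>x y. x \<in> A \<Longrightarrow> y \<in> B \<Longrightarrow> f x y \<ge> 0"
  shows "(h has_sum S) B"
proof -
  have "((\<lambda>(x, y). f x y) has_sum S) (A \<times> B)"
    using assms by (intro has_sum_nonneg_Sigma) auto
  then have "((\<lambda>(y, x). f x y) has_sum S) (B \<times> A)"
    by (subst (asm) has_sum_swap) (simp add: case_prod_unfold)
  then show ?thesis by (rule has_sum_SigmaD) (use assms(3) in simp)
qed

text \<open>A bridge between two styles: \<open>has_sum\<close> for subtraction and uniqueness of
  real sums, \<open>ennreal\<close> integrals for monotone convergence and countable additivity of
  measures.\<close>

lemma has_sum_iff_nn_integral:
  fixes f :: "'a \<Rightarrow> real"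
  assumes nn: "\<And>x. x \<in> A \<Longrightarrow> f x \<ge> 0" and c: "c \<ge> 0"
  shows "(f has_sum c) A \<longleftrightarrow> (\<integral>\<^sup>+x. ennreal (f x) \<partial>count_space A) = ennreal c"
proof -
  let ?abs = "Infinite_Set_Sum.abs_summable_on f A"
  have abs: "f summable_on A \<longleftrightarrow> ?abs"
    using nn by (simp flip: abs_summable_equivalent cong: summable_on_cong)
  have *: "(\<integral>\<^sup>+x. ennreal (f x) \<partial>count_space A) = ennreal (infsum f A)" if ?abs
    using that nn by (simp add: nn_integral_conv_infsetsum infsetsum_infsum)
  show ?thesis
  proof
    assume h: "(f has_sum c) A"
    then show "(\<integral>\<^sup>+x. ennreal (f x) \<partial>count_space A) = ennreal c"
      using * abs by (simp add: infsumI has_sum_imp_summable)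
  next
    assume h: "(\<integral>\<^sup>+x. ennreal (f x) \<partial>count_space A) = ennreal c"
    have "integrable (count_space A) f"
      using h nn by (intro integrableI_nonneg) (auto simp: AE_count_space)
    then have s: ?abs by (simp add: Infinite_Set_Sum.abs_summable_on_def)
    then have "infsum f A = c"
      using * h c nn by (simp add: infsum_nonneg)
    then show "(f has_sum c) A" using s abs by (simp add: has_sum_infsum flip: \<open>infsum f A = c\<close>)
  qed
qed

text \<open>A pointwise condition, so that it can be required only on trees containing a given
  vertex. Indexing by inserted vertices gives access to sums over parts of
  \<open>addable \<tau>\<close>.\<close>

definition harmonic_at :: "(tree \<Rightarrow> real) \<Rightarrow> tree \<Rightarrow> bool" where
  "harmonic_at f \<tau> \<longleftrightarrow> ((\<lambda>v. f (insert v \<tau>)) has_sum f \<tau>) (addable \<tau>)"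

lemma nnhf_iff:
  "\<phi> \<in> nnhf \<longleftrightarrow> \<phi> \<in> ptrees \<rightarrow>\<^sub>E {0..} \<and> \<phi> root_tree = 1 \<and> (\<forall>\<tau>\<in>ptrees. harmonic_at \<phi> \<tau>)"
  by (simp add: nnhf_def harmonic_at_def has_sum_edges)

lemma nnhfD:
  assumes "\<phi> \<in> nnhf"
  shows nnhf_extensional: "\<phi> \<in> extensional ptrees"
    and nnhf_nonneg: "\<tau> \<in> ptrees \<Longrightarrow> \<phi> \<tau> \<ge> 0"
    and nnhf_root: "\<phi> root_tree = 1"
    and nnhf_harmonic: "\<tau> \<in> ptrees \<Longrightarrow> harmonic_at \<phi> \<tau>"
  using assms by (auto simp: nnhf_iff PiE_def Pi_def)

lemma harmonic_ge_child:
  assumes "harmonic_at f \<tau>" "\<And>w. w \<in> addable \<tau> \<Longrightarrow> f (insert w \<tau>) \<ge> 0" "v \<in> addable \<tau>"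
  shows "f (insert v \<tau>) \<le> f \<tau>"
proof (rule has_sum_mono2)
  show "((\<lambda>v. f (insert v \<tau>)) has_sum f \<tau>) (addable \<tau>)"
    using assms(1) by (simp add: harmonic_at_def)
  show "((\<lambda>v. f (insert v \<tau>)) has_sum f (insert v \<tau>)) {v}"
    by (rule has_sum_finiteI) auto
qed (use assms in auto)

lemma harmonic_antimono:
  assumes "\<And>\<tau>. \<tau> \<in> ptrees \<Longrightarrow> harmonic_at f \<tau>" "\<And>\<tau>. \<tau> \<in> ptrees \<Longrightarrow> f \<tau> \<ge> 0"
    and "\<tau> \<in> ptrees" "\<sigma> \<in> ptrees" "\<tau> \<subseteq> \<sigma>"
  shows "f \<sigma> \<le> f \<tau>"
  using assms(3-5)
proof (induction rule: ptrees_between_induct)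
  case (step \<rho> v)
  then show ?case
    using harmonic_ge_child[of f \<rho> v] assms(1,2) insert_ptrees by fastforce
qed simp

text \<open>Harmonicity iterated \<open>n\<close> times: the mass of \<open>\<tau>\<close> spreads
  over the trees with \<open>n\<close> more vertices, once per path. The induction peels off the
  first step and exchanges the sums.\<close>

lemma has_sum_num_paths:
  assumes harm: "\<And>\<tau>. \<tau> \<in> ptrees \<Longrightarrow> harmonic_at f \<tau>" and nn: "\<And>\<tau>. \<tau> \<in> ptrees \<Longrightarrow> f \<tau> \<ge> 0"
    and "\<tau> \<in> ptrees"
  shows "((\<lambda>\<sigma>. real (num_paths \<tau> \<sigma>) * f \<sigma>) has_sum f \<tau>) (trees_of_size (card \<tau> + n))"
  using assms(3)
proof (induction n arbitrary: \<tau>)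
  case 0
  have "num_paths \<tau> \<sigma> = 0" if "\<sigma> \<in> trees_of_size (card \<tau>) - {\<tau>}" for \<sigma>
  proof (rule num_paths_eq_0, rule notI)
    assume "\<tau> \<subseteq> \<sigma>"
    then show False
      using that card_subset_eq[of \<sigma> \<tau>] ptrees_finite by (auto simp: trees_of_size_eq)
  qed
  then have "((\<lambda>\<sigma>. real (num_paths \<tau> \<sigma>) * f \<sigma>) has_sum f \<tau>) (trees_of_size (card \<tau>)) \<longleftrightarrow>
     ((\<lambda>\<sigma>. real (num_paths \<tau> \<sigma>) * f \<sigma>) has_sum f \<tau>) {\<tau>}"
    using 0 by (intro has_sum_cong_neutral) (auto simp: trees_of_size_eq)
  moreover have "((\<lambda>\<sigma>. real (num_paths \<tau> \<sigma>) * f \<sigma>) has_sum f \<tau>) {\<tau>}"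
    using 0 by (intro has_sum_finiteI) (auto simp: num_paths_refl)
  ultimately show ?case by simp
next
  case (Suc n)
  show ?case
  proof (rule has_sum_nonneg_swap)
    show "((\<lambda>v. f (insert v \<tau>)) has_sum f \<tau>) (addable \<tau>)"
      using harm[OF Suc.prems] by (simp add: harmonic_at_def)
    show "((\<lambda>\<sigma>. real (num_paths (insert v \<tau>) \<sigma>) * f \<sigma>) has_sum f (insert v \<tau>))
        (trees_of_size (card \<tau> + Suc n))" if "v \<in> addable \<tau>" for v
      using Suc.IH[OF insert_ptrees[OF Suc.prems that]] addable_notin[OF that]
        ptrees_finite[OF Suc.prems] by simp
    show "((\<lambda>v. real (num_paths (insert v \<tau>) \<sigma>) * f \<sigma>) has_sum real (num_paths \<tau> \<sigma>) * f \<sigma>)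
        (addable \<tau>)" if "\<sigma> \<in> trees_of_size (card \<tau> + Suc n)" for \<sigma>
    proof (rule has_sum_finite_neutralI)
      have \<sigma>: "\<sigma> \<in> ptrees" "\<sigma> \<noteq> \<tau>" using that by (auto simp: trees_of_size_eq)
      show "finite (addable \<tau> \<inter> \<sigma>)" using ptrees_finite[OF \<sigma>(1)] by simp
      show "real (num_paths \<tau> \<sigma>) * f \<sigma> =
          (\<Sum>v\<in>addable \<tau> \<inter> \<sigma>. real (num_paths (insert v \<tau>) \<sigma>) * f \<sigma>)"
        using num_paths_rec[OF Suc.prems \<sigma>(1)] \<sigma>(2) by (simp add: sum_distrib_right)
      show "real (num_paths (insert v \<tau>) \<sigma>) * f \<sigma> = 0" if "v \<in> addable \<tau> - addable \<tau> \<inter> \<sigma>" for v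
        using that num_paths_eq_0[of "insert v \<tau>" \<sigma>] by simp
    qed simp
  qed (use nn in \<open>auto simp: trees_of_size_eq\<close>)
qed

section \<open>Branch operators\<close>

definition below :: "indiv \<Rightarrow> tree \<Rightarrow> indiv set" where
  "below v \<tau> = {w \<in> addable \<tau>. prefix v w}"

text \<open>Where a harmonic \<open>f\<close> is positive,
  \<open>descend v f \<tau> / f \<tau>\<close> is the chance that the chain with weights
  \<open>f\<close> next grows in the branch of \<open>v\<close>: at \<open>v\<close> itself while
  \<open>v\<close> is addable, anywhere in its subtree afterwards. \<open>infsum\<close> is 0 on
  families that are not summable, so values are obtained through
  \<open>has_sum_descend\<close>.\<close>

definition descend :: "indiv \<Rightarrow> (tree \<Rightarrow> real) \<Rightarrow> tree \<Rightarrow> real" where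
  "descend v f \<tau> = (\<Sum>\<^sub>\<infinity>w\<in>below v \<tau>. f (insert w \<tau>))"

text \<open>The cone of functions on which \<^const>\<open>descend\<close> is a positive operator when
  \<open>v\<close> is a child of \<open>i\<close>.\<close>

definition harm :: "indiv \<Rightarrow> (tree \<Rightarrow> real) \<Rightarrow> bool" where
  "harm i f \<longleftrightarrow> (\<forall>\<tau>\<in>ptrees. i \<in> \<tau> \<longrightarrow> f \<tau> \<ge> 0 \<and> harmonic_at f \<tau>)"

lemma harmD:
  "harm i f \<Longrightarrow> \<tau> \<in> ptrees \<Longrightarrow> i \<in> \<tau> \<Longrightarrow> f \<tau> \<ge> 0"
  "harm i f \<Longrightarrow> \<tau> \<in> ptrees \<Longrightarrow> i \<in> \<tau> \<Longrightarrow> harmonic_at f \<tau>"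
  by (auto simp: harm_def)

lemma nnhf_harm: "\<phi> \<in> nnhf \<Longrightarrow> harm i \<phi>"
  using nnhf_nonneg nnhf_harmonic by (auto simp: harm_def)

lemma below_addable: "w \<in> below v \<tau> \<Longrightarrow> w \<in> addable \<tau>"
  by (simp add: below_def)

lemma has_sum_descend:
  assumes "harm i f" "\<tau> \<in> ptrees" "i \<in> \<tau>"
  shows "((\<lambda>w. f (insert w \<tau>)) has_sum descend v f \<tau>) (below v \<tau>)"
proof -
  have "(\<lambda>w. f (insert w \<tau>)) summable_on addable \<tau>"
    using harmD(2)[OF assms] by (auto simp: harmonic_at_def intro: has_sum_imp_summable)
  then have "(\<lambda>w. f (insert w \<tau>)) summable_on below v \<tau>"
    by (rule summable_on_subset) (auto simp: below_def)
  then show ?thesis by (simp add: descend_def)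
qed

lemma descend_nonneg:
  assumes "harm i f" "\<tau> \<in> ptrees" "i \<in> \<tau>"
  shows "descend v f \<tau> \<ge> 0"
  using has_sum_descend[OF assms]
  by (rule has_sum_nonneg) (use assms insert_ptrees below_addable in \<open>auto intro!: harmD\<close>)

lemma descend_le:
  assumes "harm i f" "\<tau> \<in> ptrees" "i \<in> \<tau>"
  shows "descend v f \<tau> \<le> f \<tau>"
proof (rule has_sum_mono2[OF has_sum_descend[OF assms]])
  show "((\<lambda>w. f (insert w \<tau>)) has_sum f \<tau>) (addable \<tau>)"
    using harmD(2)[OF assms] by (simp add: harmonic_at_def)
qed (use assms insert_ptrees in \<open>auto simp: below_def intro!: harmD\<close>)

lemma harm_insert_nonneg:
  "harm i f \<Longrightarrow> \<tau> \<in> ptrees \<Longrightarrow> i \<in> \<tau> \<Longrightarrow> w \<in> addable \<tau> \<Longrightarrow> f (insert w \<tau>) \<ge> 0"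
  using insert_ptrees by (auto intro!: harmD)

text \<open>Two insertions commute unless the second vertex is a child of the first, in which case one
  of them is below \<open>v\<close> iff the other is, because \<open>i\<close> is already present.\<close>

lemma harm_descend:
  assumes "harm i f"
  shows "harm i (descend (i @ [j]) f)"
  unfolding harm_def
proof (intro ballI impI conjI)
  fix \<tau> assume \<tau>: "\<tau> \<in> ptrees" "i \<in> \<tau>"
  let ?v = "i @ [j]"
  show "descend ?v f \<tau> \<ge> 0" by (rule descend_nonneg[OF assms \<tau>])
  let ?S1 = "Sigma (addable \<tau>) (\<lambda>w. below ?v (insert w \<tau>))"
  let ?S2 = "Sigma (below ?v \<tau>) (\<lambda>u. addable (insert u \<tau>))"
  \<comment> \<open>The order is swapped when the second vertex was already addable in
    \<open>\<tau>\<close>; otherwise it is a child of the first and the pair is kept.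
    \<open>?g\<close> is its own inverse and maps each of the two index sets onto the other.\<close>
  let ?g = "\<lambda>(x, y). if y \<in> addable \<tau> then (y, x) else (x, y)"
  have ins: "insert w \<tau> \<in> ptrees" "i \<in> insert w \<tau>" if "w \<in> addable \<tau>" for w
    using insert_ptrees that \<tau> by auto
  have "((\<lambda>(u, w). f (insert w (insert u \<tau>))) has_sum descend ?v f \<tau>) ?S2"
  proof (rule has_sum_nonneg_Sigma)
    show "((\<lambda>w. f (insert w \<tau>)) has_sum descend ?v f \<tau>) (below ?v \<tau>)"
      by (rule has_sum_descend[OF assms \<tau>])
    show "((\<lambda>w. f (insert w (insert u \<tau>))) has_sum f (insert u \<tau>)) (addable (insert u \<tau>))"
      if "u \<in> below ?v \<tau>" for u
      using harmD(2)[OF assms ins] below_addable[OF that] by (simp add: harmonic_at_def)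
    show "f (insert w (insert u \<tau>)) \<ge> 0" if "u \<in> below ?v \<tau>" "w \<in> addable (insert u \<tau>)" for u w
      using harm_insert_nonneg[OF assms ins] below_addable[OF that(1)] that(2) by blast
  qed
  moreover have "((\<lambda>(u, w). f (insert w (insert u \<tau>))) has_sum descend ?v f \<tau>) ?S2 \<longleftrightarrow>
     ((\<lambda>(w, u). f (insert u (insert w \<tau>))) has_sum descend ?v f \<tau>) ?S1"
  proof (rule has_sum_reindex_bij_witness[where i = ?g and j = ?g])
    have a: "?g p \<in> ?S1 \<and> ?g (?g p) = p \<and>
        (case ?g p of (w, u) \<Rightarrow> f (insert u (insert w \<tau>))) = (case p of (u, w) \<Rightarrow> f (insert w (insert u \<tau>)))"
      if "p \<in> ?S2" for p
    proof -
      obtain u w where p: "p = (u, w)" by force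
      have u: "u \<in> addable \<tau>" "prefix ?v u" and w: "w \<in> addable (insert u \<tau>)"
        using that p by (auto simp: below_def)
      show ?thesis
      proof (cases "w \<in> addable \<tau>")
        case True
        have "u \<noteq> w" using w addable_notin by blast
        then show ?thesis
          using True u p \<tau> by (auto simp: below_def addable_insert insert_commute)
      next
        case False
        then have "\<exists>k. w = u @ [k]" using w u \<tau> by (auto simp: addable_insert)
        then show ?thesis using False u w p by (auto simp: below_def)
      qed
    qed
    have b: "?g p \<in> ?S2 \<and> ?g (?g p) = p" if "p \<in> ?S1" for p
    proof -
      obtain w u where p: "p = (w, u)" by force
      have w: "w \<in> addable \<tau>" and u: "u \<in> addable (insert w \<tau>)" "prefix ?v u"
        using that p by (auto simp: below_def)
      show ?thesis
      proof (cases "u \<in> addable \<tau>")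
        case True
        have "u \<noteq> w" using u addable_notin by blast
        then show ?thesis
          using True u w p \<tau> by (auto simp: below_def addable_insert)
      next
        case False
        then obtain k where k: "u = w @ [k]" using w u \<tau> by (auto simp: addable_insert)
        moreover have "w \<notin> \<tau>" using w addable_notin by blast
        ultimately have "prefix ?v w" using u(2) \<tau>(2) by auto
        then show ?thesis using False u w p by (auto simp: below_def)
      qed
    qed
    show "?g p \<in> ?S1" if "p \<in> ?S2" for p using a[OF that] by (rule conjunct1)
    show "?g (?g p) = p" if "p \<in> ?S2" for p using a[OF that] by blast
    show "(case ?g p of (w, u) \<Rightarrow> f (insert u (insert w \<tau>))) =
        (case p of (u, w) \<Rightarrow> f (insert w (insert u \<tau>)))" if "p \<in> ?S2" for p using a[OF that] by blast
    show "?g p \<in> ?S2" if "p \<in> ?S1" for p using b[OF that] by (rule conjunct1)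
    show "?g (?g p) = p" if "p \<in> ?S1" for p using b[OF that] by blast
  qed simp
  ultimately have "((\<lambda>(w, u). f (insert u (insert w \<tau>))) has_sum descend ?v f \<tau>) ?S1" by blast
  then show "harmonic_at (descend ?v f) \<tau>"
    unfolding harmonic_at_def
    by (rule has_sum_SigmaD) (use has_sum_descend[OF assms ins] in simp)
qed

lemma descend_eqI:
  assumes "((\<lambda>w. f (insert w \<tau>)) has_sum c) (below v \<tau>)"
  shows "descend v f \<tau> = c"
  using assms by (simp add: descend_def infsumI)

text \<open>An addable \<open>v\<close> is the only open position of its branch, which lets the
  operator speak about a single insertion.\<close>

lemma descend_addable:
  assumes "\<tau> \<in> ptrees" "v \<in> addable \<tau>"
  shows "descend v f \<tau> = f (insert v \<tau>)"
proof -
  have "below v \<tau> = {v}"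
    using assms addable_prefix_unique[OF assms] by (auto simp: below_def)
  then show ?thesis by (simp add: descend_def)
qed

lemma harm_add: "harm i f \<Longrightarrow> harm i g \<Longrightarrow> harm i (\<lambda>\<tau>. f \<tau> + g \<tau>)"
  by (auto simp: harm_def harmonic_at_def intro: has_sum_add)

lemma harm_scale: "harm i f \<Longrightarrow> c \<ge> 0 \<Longrightarrow> harm i (\<lambda>\<tau>. c * f \<tau>)"
  by (auto simp: harm_def harmonic_at_def intro: has_sum_cmult_right)

lemma harm_diff:
  assumes "harm i f" "harm i g" "\<And>\<tau>. \<tau> \<in> ptrees \<Longrightarrow> i \<in> \<tau> \<Longrightarrow> g \<tau> \<le> f \<tau>"
  shows "harm i (\<lambda>\<tau>. f \<tau> - g \<tau>)"
  using assms by (auto simp: harm_def harmonic_at_def intro: has_sum_diff)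

lemma descend_add:
  assumes "harm i f" "harm i g" "\<tau> \<in> ptrees" "i \<in> \<tau>"
  shows "descend v (\<lambda>\<tau>. f \<tau> + g \<tau>) \<tau> = descend v f \<tau> + descend v g \<tau>"
  by (intro descend_eqI has_sum_add has_sum_descend[OF assms(1,3,4)] has_sum_descend[OF assms(2,3,4)])

lemma descend_scale:
  assumes "harm i f" "\<tau> \<in> ptrees" "i \<in> \<tau>"
  shows "descend v (\<lambda>\<tau>. c * f \<tau>) \<tau> = c * descend v f \<tau>"
  by (intro descend_eqI has_sum_cmult_right has_sum_descend[OF assms])

lemma descend_mono:
  assumes "harm i f" "harm i g" "\<tau> \<in> ptrees" "i \<in> \<tau>"
    and "\<And>\<tau>. \<tau> \<in> ptrees \<Longrightarrow> i \<in> \<tau> \<Longrightarrow> f \<tau> \<le> g \<tau>"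
  shows "descend v f \<tau> \<le> descend v g \<tau>"
  by (rule has_sum_mono[OF has_sum_descend[OF assms(1,3,4)] has_sum_descend[OF assms(2,3,4)]])
     (use assms insert_ptrees below_addable in auto)

lemma descend_cong:
  assumes "\<tau> \<in> ptrees" "i \<in> \<tau>" "\<And>\<tau>. \<tau> \<in> ptrees \<Longrightarrow> i \<in> \<tau> \<Longrightarrow> f \<tau> = g \<tau>"
  shows "descend v f \<tau> = descend v g \<tau>"
  unfolding descend_def
  by (intro infsum_cong) (use assms insert_ptrees below_addable in auto)

section \<open>Labels\<close>

text \<open>For \<open>i\<close> in \<open>indivs\<close> this is the smallest prefix tree
  containing \<open>i\<close>, hence the smallest one into which a child of \<open>i\<close> can be
  inserted. Passing from a spine to the next isolates a single label.\<close>

definition spine :: "indiv \<Rightarrow> tree" where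
  "spine i = {k. prefix k i}"

lemma spine_Nil: "spine [] = root_tree"
  by (auto simp: spine_def root_tree_def)

lemma spine_snoc: "spine (i @ [j]) = insert (i @ [j]) (spine i)"
  by (auto simp: spine_def)

lemma spine_ptrees: "i \<in> indivs \<Longrightarrow> spine i \<in> ptrees"
proof -
  assume i: "i \<in> indivs"
  have "finite (spine i)"
    by (rule finite_subset[of _ "set (prefixes i)"]) (auto simp: spine_def)
  moreover have "spine i \<subseteq> indivs" using i by (auto simp: spine_def prefix_def)
  ultimately show ?thesis by (auto simp: ptrees_iff spine_def dest: append_prefixD)
qed

lemma snoc_addable_spine: "j \<ge> 1 \<Longrightarrow> i @ [j] \<in> addable (spine i)"
  by (auto simp: spine_def dest: prefix_length_le)

lemma spine_subset: "\<tau> \<in> ptrees \<Longrightarrow> i \<in> \<tau> \<Longrightarrow> spine i \<subseteq> \<tau>"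
  using ptrees_prefix' by (auto simp: spine_def)

lemma label_fun_root: "label_fun \<alpha> root_tree = \<alpha> []"
  by (simp add: label_fun_def root_tree_def[symmetric]) (simp add: root_tree_def)

lemma label_fun_insert:
  assumes "\<tau> \<in> ptrees" "v \<in> addable \<tau>"
  shows "label_fun \<alpha> (insert v \<tau>) = \<alpha> v * label_fun \<alpha> \<tau>"
  using assms insert_ptrees addable_notin ptrees_finite by (simp add: label_fun_def)

lemma label_fun_spine_snoc:
  assumes "i \<in> indivs" "j \<ge> 1"
  shows "label_fun \<alpha> (spine (i @ [j])) = \<alpha> (i @ [j]) * label_fun \<alpha> (spine i)"
  unfolding spine_snoc by (rule label_fun_insert[OF spine_ptrees[OF assms(1)] snoc_addable_spine[OF assms(2)]])

lemma label_fun_nonneg: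
  assumes "\<alpha> \<in> indivs \<rightarrow> {0..1}" "\<tau> \<in> ptrees"
  shows "label_fun \<alpha> \<tau> \<ge> 0"
  using assms ptrees_indivs[OF assms(2)] by (auto simp: label_fun_def intro!: prod_nonneg)

lemma labelsD:
  assumes "\<alpha> \<in> labels"
  shows labels_extensional: "\<alpha> \<in> extensional indivs"
    and labels_range: "\<alpha> \<in> indivs \<rightarrow> {0..1}"
    and labels_Nil: "\<alpha> [] = 1"
    and labels_has_sum: "i \<in> indivs \<Longrightarrow> ((\<lambda>n. \<alpha> (i @ [n])) has_sum \<alpha> i) {1..}"
  using assms by (auto simp: labels_def PiE_def)

lemma has_sum_children:
  "((\<lambda>n. \<alpha> (i @ [n])) has_sum c) {1..} \<longleftrightarrow> (\<alpha> has_sum c) ((\<lambda>n. i @ [n]) ` {1..})"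
  by (simp add: has_sum_reindex inj_on_def o_def)

lemma labels_mono:
  assumes "\<alpha> \<in> labels" "i \<in> indivs" "j \<ge> 1"
  shows "\<alpha> (i @ [j]) \<le> \<alpha> i"
proof (rule has_sum_mono2[OF _ labels_has_sum[OF assms(1,2)]])
  show "((\<lambda>n. \<alpha> (i @ [n])) has_sum \<alpha> (i @ [j])) {j}" by (rule has_sum_finiteI) auto
  show "\<alpha> (i @ [n]) \<ge> 0" if "n \<in> {1..} - {j}" for n
    using labels_range[OF assms(1)] assms(2) that by (auto simp: Pi_def)
qed (use assms in auto)

text \<open>The next vertex is inserted below \<open>v\<close> with probability \<open>\<alpha> v\<close>, whether or not \<open>v\<close> itself
  has already been inserted.\<close>

lemma labels_has_sum_below:
  assumes \<alpha>: "\<alpha> \<in> labels" and "\<tau> \<in> ptrees" "v \<in> indivs" "v = [] \<or> butlast v \<in> \<tau>"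
  shows "(\<alpha> has_sum \<alpha> v) (below v \<tau>)"
  using assms(2-4)
proof (induction arbitrary: v rule: ptrees_induct)
  case root
  show ?case
  proof (cases "v = []")
    case True
    then show ?thesis
      using labels_has_sum[OF \<alpha>, of "[]"] has_sum_children[of \<alpha> "[]"] labels_Nil[OF \<alpha>]
      by (simp add: below_def addable_root)
  next
    case False
    then have "v = [last v]" "last v \<ge> 1"
      using root append_butlast_last_id[of v] by (auto simp: root_tree_def indivs_def dest: last_in_set)
    then obtain k where v: "v = [k]" "k \<ge> 1" by blast
    then have "below v root_tree = {v}" by (auto simp: below_def addable_root)
    then show ?thesis by (intro has_sum_finiteI) auto
  qed
next
  case (insert \<tau> w)
  have w_notin: "w \<notin> \<tau>" using insert.hyps addable_notin by blast
  show ?case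
  \<comment> \<open>If \<open>w\<close> is the parent of \<open>v\<close>, the condition on
    \<open>v\<close> fails for \<open>\<tau>\<close> and the induction hypothesis does not apply;
    but then \<open>v\<close> has just become addable and is alone in its branch.\<close>
  proof (cases "v \<noteq> [] \<and> butlast v = w")
    case True
    then have v: "v = w @ [last v]" by auto
    have "last v \<ge> 1" using insert.prems(1) by (subst (asm) v) simp
    then have "v \<in> below v (insert w \<tau>)"
      using v insert.hyps by (auto simp: below_def addable_insert)
    moreover have "x = v" if "x \<in> below v (insert w \<tau>)" for x
    proof -
      have x: "x \<in> addable (insert w \<tau>)" "prefix v x" using that by (auto simp: below_def)
      have "v \<in> addable (insert w \<tau>)" using calculation below_addable by blast
      then show ?thesis
        using x addable_prefix_unique[OF insert_ptrees[OF insert.hyps(1,2)]] by blast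
    qed
    ultimately have "below v (insert w \<tau>) = {v}" by blast
    then show ?thesis by (intro has_sum_finiteI) auto
  next
    case False
    then have v: "v = [] \<or> butlast v \<in> \<tau>" using insert.prems by auto
    have IH: "(\<alpha> has_sum \<alpha> v) (below v \<tau>)" using insert.IH[OF insert.prems(1) v] .
    show ?thesis
    proof (cases "prefix v w")
      case True
      \<comment> \<open>The term \<open>\<alpha> w\<close> leaves the sum, and the labels of the
        children of \<open>w\<close>, which add up to \<open>\<alpha> w\<close>, enter it.\<close>
      have eq: "below v (insert w \<tau>) = (below v \<tau> - {w}) \<union> (\<lambda>j. w @ [j]) ` {1..}"
        using True insert.hyps by (auto simp: below_def addable_insert)
      have "(\<alpha> has_sum (\<alpha> v - \<alpha> w)) (below v \<tau> - {w})"
        using True insert.hyps by (intro has_sum_Diff[OF IH] has_sum_finiteI) (auto simp: below_def)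
      moreover have "(\<alpha> has_sum \<alpha> w) ((\<lambda>j. w @ [j]) ` {1..})"
        using labels_has_sum[OF \<alpha> addable_indivs[OF insert.hyps]] has_sum_children by blast
      ultimately have "(\<alpha> has_sum (\<alpha> v - \<alpha> w + \<alpha> w)) (below v (insert w \<tau>))"
        unfolding eq using insert.hyps child_notin_addable[OF insert.hyps(1) w_notin]
        by (intro has_sum_Un_disjoint) (auto simp: below_def)
      then show ?thesis by simp
    next
      case np: False
      have "v \<noteq> w @ [j]" for j using v w_notin by auto
      then have "below v (insert w \<tau>) = below v \<tau>"
        using np insert.hyps by (auto simp: below_def addable_insert)
      then show ?thesis using IH by simp
    qed
  qed
qed

lemma label_fun_has_sum_below:
  assumes "\<alpha> \<in> labels" "\<tau> \<in> ptrees" "v \<in> indivs" "v = [] \<or> butlast v \<in> \<tau>"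
  shows "((\<lambda>w. label_fun \<alpha> (insert w \<tau>)) has_sum \<alpha> v * label_fun \<alpha> \<tau>) (below v \<tau>)"
proof -
  have "((\<lambda>w. \<alpha> w * label_fun \<alpha> \<tau>) has_sum \<alpha> v * label_fun \<alpha> \<tau>) (below v \<tau>)"
    by (intro has_sum_cmult_left labels_has_sum_below assms)
  then show ?thesis
    using assms(2) below_addable by (simp add: label_fun_insert cong: has_sum_cong)
qed

text \<open>Harmonicity is the branch sum at \<open>v = []\<close>, whose branch is the whole tree
  and whose label is 1.\<close>

lemma label_fun_nnhf:
  assumes "\<alpha> \<in> labels"
  shows "label_fun \<alpha> \<in> nnhf"
  unfolding nnhf_iff
proof (intro conjI ballI)
  show "label_fun \<alpha> \<in> ptrees \<rightarrow>\<^sub>E {0..}"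
    using label_fun_nonneg[OF labels_range[OF assms]] by (auto simp: label_fun_def)
  show "label_fun \<alpha> root_tree = 1" using labels_Nil[OF assms] by (simp add: label_fun_root)
  show "harmonic_at (label_fun \<alpha>) \<tau>" if "\<tau> \<in> ptrees" for \<tau>
  proof -
    have "below [] \<tau> = addable \<tau>" by (auto simp: below_def)
    then show ?thesis
      using label_fun_has_sum_below[OF assms that, of "[]"] labels_Nil[OF assms]
      by (simp add: harmonic_at_def)
  qed
qed

lemma descend_label_fun:
  assumes "\<alpha> \<in> labels" "\<tau> \<in> ptrees" "i \<in> \<tau>" "j \<ge> 1"
  shows "descend (i @ [j]) (label_fun \<alpha>) \<tau> = \<alpha> (i @ [j]) * label_fun \<alpha> \<tau>"
  using assms ptrees_indivs[OF assms(2)]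
  by (intro descend_eqI label_fun_has_sum_below) auto

text \<open>Harmonicity along \<open>spine i\<close> and along \<open>spine (butlast i)\<close> differ by the equation at \<open>i\<close>.\<close>

lemma labels_of_harmonic:
  assumes ran: "\<alpha> \<in> indivs \<rightarrow>\<^sub>E {0..1}" and nil: "\<alpha> [] = 1"
    and zero: "\<And>i j. i \<in> indivs \<Longrightarrow> j \<ge> 1 \<Longrightarrow> \<alpha> i = 0 \<Longrightarrow> \<alpha> (i @ [j]) = 0"
    and harm: "label_fun \<alpha> \<in> nnhf"
  shows "\<alpha> \<in> labels"
proof -
  \<comment> \<open>Where the weight of a spine vanishes, harmonicity says nothing about labels
    further out; \<open>zero\<close> settles them. A nonzero label thus sits on a spine whose weight
    can be divided out.\<close>
  have pos: "\<alpha> i = 0" if "i \<in> indivs" "label_fun \<alpha> (spine i) = 0" for i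
    using that
  proof (induction i rule: rev_induct)
    case Nil
    then show ?case using nil by (simp add: spine_Nil label_fun_root)
  next
    case (snoc j i)
    then show ?case using zero[of i j] by (auto simp: label_fun_spine_snoc)
  qed
  have one: "(\<alpha> has_sum 1) (addable \<tau>)" if \<tau>: "\<tau> \<in> ptrees" "label_fun \<alpha> \<tau> \<noteq> 0" for \<tau>
  proof -
    have "((\<lambda>v. \<alpha> v * label_fun \<alpha> \<tau>) has_sum label_fun \<alpha> \<tau>) (addable \<tau>)"
      using nnhf_harmonic[OF harm \<tau>(1)] \<tau>(1)
      by (simp add: harmonic_at_def label_fun_insert cong: has_sum_cong)
    then show ?thesis
      using \<tau>(2) by (simp add: has_sum_cmult_left_iff)
  qed
  have "((\<lambda>n. \<alpha> (i @ [n])) has_sum \<alpha> i) {1..}" if i: "i \<in> indivs" for i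
  proof (cases "\<alpha> i = 0")
    case True
    then show ?thesis unfolding True using zero[OF i _ True] by (intro has_sum_0) auto
  next
    case False
    then have nz: "label_fun \<alpha> (spine i) \<noteq> 0" using pos i by blast
    show ?thesis
    proof (cases i rule: rev_cases)
      case Nil
      then show ?thesis
        using one[OF root_in_ptrees] nil has_sum_children[of \<alpha> "[]"]
        by (simp add: label_fun_root addable_root)
    next
      case (snoc k j)
      have k: "k \<in> indivs" "j \<ge> 1" using i snoc by auto
      have *: "spine i = insert i (spine k)" "spine k \<in> ptrees" "i \<in> addable (spine k)"
        using snoc spine_snoc spine_ptrees[OF k(1)] snoc_addable_spine[OF k(2)] by auto
      let ?C = "(\<lambda>n. i @ [n]) ` {1..}"
      have add: "addable (spine i) = (addable (spine k) - {i}) \<union> ?C"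
        unfolding *(1) by (rule addable_insert[OF *(2,3)])
      have "?C \<inter> addable (spine k) = {}"
        using child_notin_addable[OF *(2) addable_notin[OF *(3)]] by auto
      then have "?C = addable (spine i) - (addable (spine k) - {i})" unfolding add by auto
      moreover have "(\<alpha> has_sum (1 - \<alpha> i)) (addable (spine k) - {i})"
        using nz *(3) snoc k
        by (intro has_sum_Diff one *(2) has_sum_finiteI) (auto simp: label_fun_spine_snoc)
      then have "(\<alpha> has_sum (1 - (1 - \<alpha> i))) (addable (spine i) - (addable (spine k) - {i}))"
        using add by (intro has_sum_Diff[OF one[OF spine_ptrees[OF i] nz]]) auto
      ultimately show ?thesis unfolding has_sum_children by simp
    qed
  qed
  then show ?thesis using ran nil by (simp add: labels_def)
qed

text \<open>A label is the quotient of the values at two successive spines. Where the denominator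
  vanishes, both labels are 0, because labels decrease with depth.\<close>

lemma inj_on_label_fun: "inj_on label_fun labels"
proof (rule inj_onI)
  fix \<alpha> \<beta> assume \<alpha>: "\<alpha> \<in> labels" and \<beta>: "\<beta> \<in> labels" and eq: "label_fun \<alpha> = label_fun \<beta>"
  have zero: "\<gamma> i = 0" if "\<gamma> \<in> labels" "i \<in> indivs" "label_fun \<gamma> (spine i) = 0" for \<gamma> i
    using that(2,3)
  proof (induction i rule: rev_induct)
    case Nil
    then show ?case using labels_Nil[OF that(1)] by (simp add: spine_Nil label_fun_root)
  next
    case (snoc j i)
    then show ?case
      using labels_mono[OF that(1), of i j] labels_range[OF that(1)]
      by (auto simp: label_fun_spine_snoc Pi_def intro: antisym)
  qed
  have "\<alpha> i = \<beta> i" if "i \<in> indivs" for i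
  proof (cases i rule: rev_cases)
    case Nil
    then show ?thesis using labels_Nil[OF \<alpha>] labels_Nil[OF \<beta>] by simp
  next
    case (snoc k j)
    have k: "k \<in> indivs" "j \<ge> 1" using that snoc by auto
    show ?thesis
    proof (cases "label_fun \<alpha> (spine k) = 0")
      case True
      then have "label_fun \<alpha> (spine i) = 0" "label_fun \<beta> (spine i) = 0"
        using eq snoc k by (auto simp: label_fun_spine_snoc)
      then show ?thesis using zero[OF \<alpha> that] zero[OF \<beta> that] by simp
    next
      case False
      have "\<alpha> i * label_fun \<alpha> (spine k) = \<beta> i * label_fun \<alpha> (spine k)"
        using label_fun_spine_snoc[OF k] eq snoc by metis
      then show ?thesis using False by (metis mult_right_cancel)
    qed
  qed
  then show "\<alpha> = \<beta>"
    using labels_extensional \<alpha> \<beta> by (intro extensionalityI[of _ indivs]) auto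
qed

section \<open>Extremal harmonic functions\<close>

lemma harmonic_zero:
  assumes "\<And>\<tau>. \<tau> \<in> ptrees \<Longrightarrow> harmonic_at f \<tau>" "\<And>\<tau>. \<tau> \<in> ptrees \<Longrightarrow> f \<tau> \<ge> 0"
    and "f root_tree = 0" "\<tau> \<in> ptrees"
  shows "f \<tau> = 0"
  using harmonic_antimono[of f root_tree \<tau>] assms root_subset by fastforce

text \<open>With \<open>c\<close> the value of \<open>f\<close> at the root, \<open>\<phi>\<close>
  is a mixture of \<open>f / c\<close> and \<open>(\<phi> - f) / (1 - c)\<close>, and extremality
  identifies the two. If \<open>c\<close> is 0 or 1, then \<open>f\<close> or
  \<open>\<phi> - f\<close> vanishes at the root and hence everywhere.\<close>

lemma extremal_dominated:
  assumes ex: "\<phi> \<in> extremal_nnhf"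
    and harm: "\<And>\<tau>. \<tau> \<in> ptrees \<Longrightarrow> harmonic_at f \<tau>"
    and nn: "\<And>\<tau>. \<tau> \<in> ptrees \<Longrightarrow> f \<tau> \<ge> 0" and le: "\<And>\<tau>. \<tau> \<in> ptrees \<Longrightarrow> f \<tau> \<le> \<phi> \<tau>"
    and \<tau>: "\<tau> \<in> ptrees"
  shows "f \<tau> = f root_tree * \<phi> \<tau>"
proof -
  have \<phi>: "\<phi> \<in> nnhf" using ex by (simp add: extremal_nnhf_def)
  define c where "c = f root_tree"
  have c: "0 \<le> c" "c \<le> 1"
    using nn[OF root_in_ptrees] le[OF root_in_ptrees] nnhf_root[OF \<phi>] by (auto simp: c_def)
  have harm': "harmonic_at (\<lambda>\<tau>. \<phi> \<tau> - f \<tau>) \<sigma>" if "\<sigma> \<in> ptrees" for \<sigma>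
    using nnhf_harmonic[OF \<phi> that] harm[OF that] unfolding harmonic_at_def by (rule has_sum_diff)
  consider "c = 0" | "c = 1" | "0 < c" "c < 1" using c by linarith
  then show ?thesis
  proof cases
    case 1
    then show ?thesis using harmonic_zero[OF harm nn _ \<tau>] by (simp add: c_def)
  next
    case 2
    have "\<phi> \<tau> - f \<tau> = 0"
      by (rule harmonic_zero[OF harm' _ _ \<tau>]) (use 2 le nnhf_root[OF \<phi>] in \<open>auto simp: c_def\<close>)
    then show ?thesis using 2 by (simp add: c_def)
  next
    case 3
    define f1 where "f1 = (\<lambda>\<tau>\<in>ptrees. (1 / c) * f \<tau>)"
    define f2 where "f2 = (\<lambda>\<tau>\<in>ptrees. (1 / (1 - c)) * (\<phi> \<tau> - f \<tau>))"
    have scale: "harmonic_at (\<lambda>\<tau>\<in>ptrees. k * g \<tau>) \<sigma>" if "harmonic_at g \<sigma>" "\<sigma> \<in> ptrees" for k g \<sigma>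
    proof -
      have "((\<lambda>v. k * g (insert v \<sigma>)) has_sum k * g \<sigma>) (addable \<sigma>)"
        using that(1) unfolding harmonic_at_def by (rule has_sum_cmult_right)
      then show ?thesis
        unfolding harmonic_at_def using that(2) insert_ptrees[OF that(2)]
        by (subst has_sum_cong[where g = "\<lambda>v. k * g (insert v \<sigma>)"]) auto
    qed
    have "f1 \<in> nnhf"
      using 3 nn scale[OF harm, of _ "1 / c"] nn[OF root_in_ptrees] unfolding nnhf_iff f1_def
      by (auto simp: c_def[symmetric])
    moreover have "f2 \<in> nnhf"
      using 3 le scale[OF harm', of _ "1 / (1 - c)"] nnhf_root[OF \<phi>] unfolding nnhf_iff f2_def
      by (auto simp: c_def[symmetric])
    moreover have "\<phi> \<sigma> = c * f1 \<sigma> + (1 - c) * f2 \<sigma>" if "\<sigma> \<in> ptrees" for \<sigma>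
      using 3 that by (simp add: f1_def f2_def)
    ultimately have "f1 = f2" using ex 3 unfolding extremal_nnhf_def by blast
    then have "f1 \<tau> = f2 \<tau>" by simp
    then show ?thesis using 3 \<tau> by (simp add: f1_def f2_def c_def[symmetric] field_simps)
  qed
qed

text \<open>The components of a mixture with weight \<open>t\<close> are dominated by
  \<open>\<phi>\<close> with constants \<open>1 / t\<close> and \<open>1 / (1 - t)\<close>, so
  rigidity under domination gives extremality.\<close>

lemma extremal_nnhf_not_mono:
  assumes "\<phi> \<in> nnhf"
    and "\<And>\<psi> C. \<psi> \<in> nnhf \<Longrightarrow> C > 0 \<Longrightarrow> (\<And>\<tau>. \<tau> \<in> ptrees \<Longrightarrow> \<psi> \<tau> \<le> C * \<phi> \<tau>) \<Longrightarrow> \<psi> = \<phi>"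
  shows "\<phi> \<in> extremal_nnhf"
  unfolding extremal_nnhf_def
proof (intro CollectI conjI ballI allI impI assms(1))
  fix \<phi>1 \<phi>2 and t :: real
  assume h: "\<phi>1 \<in> nnhf" "\<phi>2 \<in> nnhf"
    "0 < t \<and> t < 1 \<and> (\<forall>\<tau>\<in>ptrees. \<phi> \<tau> = t * \<phi>1 \<tau> + (1 - t) * \<phi>2 \<tau>)"
  have "\<phi>1 \<tau> \<le> 1 / t * \<phi> \<tau>" "\<phi>2 \<tau> \<le> 1 / (1 - t) * \<phi> \<tau>" if "\<tau> \<in> ptrees" for \<tau>
  proof -
    have "\<phi> \<tau> = t * \<phi>1 \<tau> + (1 - t) * \<phi>2 \<tau>" using h(3) that by blast
    moreover have "t * \<phi>1 \<tau> \<ge> 0" "(1 - t) * \<phi>2 \<tau> \<ge> 0"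
      using h(3) nnhf_nonneg[OF h(1) that] nnhf_nonneg[OF h(2) that] by auto
    ultimately have "t * \<phi>1 \<tau> \<le> \<phi> \<tau>" "(1 - t) * \<phi>2 \<tau> \<le> \<phi> \<tau>" by linarith+
    then show "\<phi>1 \<tau> \<le> 1 / t * \<phi> \<tau>" "\<phi>2 \<tau> \<le> 1 / (1 - t) * \<phi> \<tau>"
      using h(3) by (auto simp: pos_le_divide_eq mult.commute)
  qed
  note le = this
  have "\<phi>1 = \<phi>" using h(3) by (intro assms(2)[OF h(1) _ le(1)]) simp
  moreover have "\<phi>2 = \<phi>" using h(3) by (intro assms(2)[OF h(2) _ le(2)]) simp
  ultimately show "\<phi>1 = \<phi>2" by simp
qed

text \<open>A function that is harmonic once \<open>i\<close> is present extends to a harmonic function: extend it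
  by \<open>0\<close>, which makes it subharmonic, and iterate the averaging operator.\<close>

lemma harmonic_extension:
  assumes \<phi>: "\<phi> \<in> nnhf" and g: "harm i g"
    and le: "\<And>\<tau>. \<tau> \<in> ptrees \<Longrightarrow> i \<in> \<tau> \<Longrightarrow> g \<tau> \<le> \<phi> \<tau>"
  obtains f where "\<And>\<tau>. \<tau> \<in> ptrees \<Longrightarrow> harmonic_at f \<tau>" "\<And>\<tau>. \<tau> \<in> ptrees \<Longrightarrow> f \<tau> \<ge> 0"
    "\<And>\<tau>. \<tau> \<in> ptrees \<Longrightarrow> f \<tau> \<le> \<phi> \<tau>" "\<And>\<tau>. \<tau> \<in> ptrees \<Longrightarrow> i \<in> \<tau> \<Longrightarrow> f \<tau> = g \<tau>"
proof -
  \<comment> \<open>Averaging in \<open>ennreal\<close> is defined for every function and obeys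
    monotone convergence.\<close>
  define P :: "(tree \<Rightarrow> ennreal) \<Rightarrow> tree \<Rightarrow> ennreal" where
    "P h \<tau> = (\<integral>\<^sup>+v. h (insert v \<tau>) \<partial>count_space (addable \<tau>))" for h \<tau>
  define h0 where "h0 \<tau> = (if i \<in> \<tau> then ennreal (g \<tau>) else 0)" for \<tau>
  define h where "h n = (P ^^ n) h0" for n
  have h_Suc: "h (Suc n) = P (h n)" for n by (simp add: h_def)
  have P_mono: "P f \<tau> \<le> P f' \<tau>"
    if "\<And>\<tau>. \<tau> \<in> ptrees \<Longrightarrow> f \<tau> \<le> f' \<tau>" "\<tau> \<in> ptrees" for f f' \<tau>
    unfolding P_def using that insert_ptrees by (intro nn_integral_mono) auto
  have Pg: "P (\<lambda>\<tau>. ennreal (f \<tau>)) \<tau> = ennreal (f \<tau>)"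
    if "harm k f" "\<tau> \<in> ptrees" "k \<in> \<tau>" for f k \<tau>
    using that harm_insert_nonneg[OF that] harmD[OF that]
      has_sum_iff_nn_integral[of "addable \<tau>" "\<lambda>v. f (insert v \<tau>)" "f \<tau>"]
    by (simp add: P_def harmonic_at_def)
  \<comment> \<open>All successors of a tree containing \<open>i\<close> contain \<open>i\<close>,
    so the iteration never changes the values there and its limit extends \<open>g\<close>.\<close>
  have h_eq: "h n \<tau> = ennreal (g \<tau>)" if "\<tau> \<in> ptrees" "i \<in> \<tau>" for n \<tau>
    using that
  proof (induction n arbitrary: \<tau>)
    case 0
    then show ?case by (simp add: h_def h0_def)
  next
    case (Suc n)
    have "h (Suc n) \<tau> = P (\<lambda>\<tau>. ennreal (g \<tau>)) \<tau>"
      unfolding h_Suc P_def using Suc insert_ptrees by (intro nn_integral_cong) auto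
    then show ?case using Pg[OF g Suc.prems] by simp
  qed
  have h_le: "h n \<tau> \<le> ennreal (\<phi> \<tau>)" if "\<tau> \<in> ptrees" for n \<tau>
    using that
  proof (induction n arbitrary: \<tau>)
    case 0
    then show ?case using le by (auto simp: h_def h0_def intro: ennreal_leI)
  next
    case (Suc n)
    have "h (Suc n) \<tau> \<le> P (\<lambda>\<tau>. ennreal (\<phi> \<tau>)) \<tau>"
      unfolding h_Suc using Suc by (intro P_mono) auto
    then show ?case using Pg[OF nnhf_harm[OF \<phi>] Suc.prems, of "[]"] ptrees_Nil[OF Suc.prems] by simp
  qed
  have h_inc: "h n \<tau> \<le> h (Suc n) \<tau>" if "\<tau> \<in> ptrees" for n \<tau>
    using that
  proof (induction n arbitrary: \<tau>)
    case 0
    show ?case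
    proof (cases "i \<in> \<tau>")
      case True
      then show ?thesis using h_eq[OF 0] by simp
    qed (simp add: h_def h0_def)
  next
    case (Suc n)
    then show ?case unfolding h_Suc by (intro P_mono) (auto simp: h_Suc)
  qed
  \<comment> \<open>Monotone convergence makes the supremum a fixed point of \<open>P\<close>, and
    domination by \<open>\<phi>\<close> keeps it finite.\<close>
  define H where "H \<tau> = (SUP n. h n \<tau>)" for \<tau>
  have PH: "P H \<tau> = H \<tau>" if \<tau>: "\<tau> \<in> ptrees" for \<tau>
  proof -
    have "P H \<tau> = (SUP n. P (h n) \<tau>)"
      unfolding P_def H_def
      by (rule nn_integral_monotone_convergence_SUP_AE)
         (use h_inc insert_ptrees[OF \<tau>] in \<open>auto simp: AE_count_space\<close>)
    also have "\<dots> = (SUP n. h (Suc n) \<tau>)" by (simp add: h_Suc)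
    also have "\<dots> = H \<tau>"
      unfolding H_def
    proof (rule antisym)
      show "(SUP n. h n \<tau>) \<le> (SUP n. h (Suc n) \<tau>)" using h_inc[OF \<tau>] by (intro SUP_mono) auto
      show "(SUP n. h (Suc n) \<tau>) \<le> (SUP n. h n \<tau>)" by (intro SUP_mono) auto
    qed
    finally show ?thesis .
  qed
  have H_le: "H \<tau> \<le> ennreal (\<phi> \<tau>)" if "\<tau> \<in> ptrees" for \<tau>
    unfolding H_def using h_le[OF that] by (intro SUP_least)
  then have H_fin: "ennreal (enn2real (H \<tau>)) = H \<tau>" if "\<tau> \<in> ptrees" for \<tau>
    using that by (metis ennreal_enn2real ennreal_less_top order_le_less_trans)
  show ?thesis
  proof
    fix \<tau> assume \<tau>: "\<tau> \<in> ptrees"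
    have "(\<integral>\<^sup>+v. ennreal (enn2real (H (insert v \<tau>))) \<partial>count_space (addable \<tau>)) = P H \<tau>"
      unfolding P_def using insert_ptrees[OF \<tau>] H_fin by (intro nn_integral_cong) auto
    also have "\<dots> = ennreal (enn2real (H \<tau>))" using PH[OF \<tau>] H_fin[OF \<tau>] by simp
    finally show "harmonic_at (\<lambda>\<tau>. enn2real (H \<tau>)) \<tau>"
      unfolding harmonic_at_def by (subst has_sum_iff_nn_integral) auto
    show "enn2real (H \<tau>) \<ge> 0" by simp
    show "enn2real (H \<tau>) \<le> \<phi> \<tau>"
      using H_le[OF \<tau>] nnhf_nonneg[OF \<phi> \<tau>] by (intro enn2real_leI)
    show "enn2real (H \<tau>) = g \<tau>" if "i \<in> \<tau>"
      using h_eq[OF \<tau> that] harmD(1)[OF g \<tau> that] by (simp add: H_def)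
  qed
qed

text \<open>The constant is the root value of the harmonic extension of
  \<open>descend (i @ [j]) \<phi>\<close>. This extension is dominated by \<open>\<phi>\<close>,
  hence proportional to it, and where \<open>i @ [j]\<close> is addable it equals the value after
  that insertion.\<close>

lemma extremal_insert:
  assumes ex: "\<phi> \<in> extremal_nnhf" and "j \<ge> 1"
  obtains c where "0 \<le> c" "c \<le> 1"
    "\<And>\<tau>. \<tau> \<in> ptrees \<Longrightarrow> i @ [j] \<in> addable \<tau> \<Longrightarrow> \<phi> (insert (i @ [j]) \<tau>) = c * \<phi> \<tau>"
proof -
  have \<phi>: "\<phi> \<in> nnhf" using ex by (simp add: extremal_nnhf_def)
  note hm = nnhf_harm[OF \<phi>, of i]
  obtain f where f: "\<And>\<tau>. \<tau> \<in> ptrees \<Longrightarrow> harmonic_at f \<tau>" "\<And>\<tau>. \<tau> \<in> ptrees \<Longrightarrow> f \<tau> \<ge> 0"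
    "\<And>\<tau>. \<tau> \<in> ptrees \<Longrightarrow> f \<tau> \<le> \<phi> \<tau>"
    "\<And>\<tau>. \<tau> \<in> ptrees \<Longrightarrow> i \<in> \<tau> \<Longrightarrow> f \<tau> = descend (i @ [j]) \<phi> \<tau>"
    using harmonic_extension[OF \<phi> harm_descend[OF hm] descend_le[OF hm]] by metis
  show ?thesis
  proof
    show "0 \<le> f root_tree" "f root_tree \<le> 1"
      using f(2,3)[OF root_in_ptrees] nnhf_root[OF \<phi>] by auto
    fix \<tau> assume \<tau>: "\<tau> \<in> ptrees" and a: "i @ [j] \<in> addable \<tau>"
    have "\<phi> (insert (i @ [j]) \<tau>) = f \<tau>"
      using f(4)[OF \<tau>] a descend_addable[OF \<tau> a] by simp
    also have "\<dots> = f root_tree * \<phi> \<tau>" by (rule extremal_dominated[OF ex f(1-3) \<tau>])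
    finally show "\<phi> (insert (i @ [j]) \<tau>) = f root_tree * \<phi> \<tau>" .
  qed
qed

lemma extremal_is_label_fun:
  assumes ex: "\<phi> \<in> extremal_nnhf"
  shows "\<exists>\<alpha>\<in>labels. \<phi> = label_fun \<alpha>"
proof -
  have \<phi>: "\<phi> \<in> nnhf" using ex by (simp add: extremal_nnhf_def)
  \<comment> \<open>The proportionality constants, read off on the smallest trees that show them.
    Division by 0 yields 0, so labels vanish beyond a spine of weight 0, as
    \<open>labels_of_harmonic\<close> demands.\<close>
  define \<alpha> where "\<alpha> = (\<lambda>i\<in>indivs. if i = [] then 1 else \<phi> (spine i) / \<phi> (spine (butlast i)))"
  have le: "\<phi> \<sigma> \<le> \<phi> \<tau>" if "\<tau> \<in> ptrees" "\<sigma> \<in> ptrees" "\<tau> \<subseteq> \<sigma>" for \<tau> \<sigma>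
    using nnhf_harmonic[OF \<phi>] nnhf_nonneg[OF \<phi>] that by (rule harmonic_antimono)
  have \<alpha>_snoc: "\<alpha> (i @ [j]) = \<phi> (spine (i @ [j])) / \<phi> (spine i)" if "i \<in> indivs" "j \<ge> 1" for i j
    using that by (simp add: \<alpha>_def)
  have mult: "\<phi> (insert v \<tau>) = \<alpha> v * \<phi> \<tau>" if \<tau>: "\<tau> \<in> ptrees" and v: "v \<in> addable \<tau>" for \<tau> v
  proof -
    obtain i j where ij: "v = i @ [j]" "i \<in> \<tau>" "j \<ge> 1" using v by (auto simp: addable_def)
    have i: "i \<in> indivs" using ij ptrees_indivs[OF \<tau>] by blast
    obtain c where c: "\<And>\<tau>. \<tau> \<in> ptrees \<Longrightarrow> v \<in> addable \<tau> \<Longrightarrow> \<phi> (insert v \<tau>) = c * \<phi> \<tau>"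
      using extremal_insert[OF ex ij(3)] ij(1) by metis
    show ?thesis
    proof (cases "\<phi> \<tau> = 0")
      case True
      then show ?thesis using c[OF \<tau> v] by simp
    next
      case False
      \<comment> \<open>Harmonic functions decrease as trees grow, so positivity at
        \<open>\<tau>\<close> passes to the spine, where \<open>c\<close> can be compared with
        \<open>\<alpha> v\<close>.\<close>
      have "\<phi> \<tau> \<le> \<phi> (spine i)" by (intro le spine_ptrees i \<tau> spine_subset ij)
      then have "\<phi> (spine i) \<noteq> 0" using False nnhf_nonneg[OF \<phi> \<tau>] by linarith
      moreover have "\<phi> (spine v) = c * \<phi> (spine i)"
        using c[OF spine_ptrees[OF i]] snoc_addable_spine[OF ij(3)] ij(1) by (simp add: spine_snoc)
      ultimately have "\<alpha> v = c" using \<alpha>_snoc[OF i ij(3)] ij(1) by simp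
      then show ?thesis using c[OF \<tau> v] by simp
    qed
  qed
  have eq: "\<phi> \<tau> = label_fun \<alpha> \<tau>" if "\<tau> \<in> ptrees" for \<tau>
    using that
  proof (induction rule: ptrees_induct)
    case root
    then show ?case using nnhf_root[OF \<phi>] by (simp add: label_fun_root \<alpha>_def)
  next
    case (insert \<tau> v)
    then show ?case using mult by (simp add: label_fun_insert)
  qed
  then have eq': "\<phi> = label_fun \<alpha>"
    using nnhf_extensional[OF \<phi>] by (intro extensionalityI[of _ ptrees]) (auto simp: label_fun_def)
  have "\<alpha> \<in> labels"
  proof (rule labels_of_harmonic)
    have "\<alpha> i \<in> {0..1}" if i: "i \<in> indivs" for i
    proof (cases i rule: rev_cases)
      case (snoc k j)
      then have k: "k \<in> indivs" "j \<ge> 1" using i by auto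
      have "\<phi> (spine i) \<le> \<phi> (spine k)"
        using le[OF spine_ptrees[OF k(1)] spine_ptrees[OF i]] snoc by (auto simp: spine_snoc)
      then show ?thesis
        using \<alpha>_snoc[OF k] snoc nnhf_nonneg[OF \<phi> spine_ptrees[OF i]] nnhf_nonneg[OF \<phi> spine_ptrees[OF k(1)]]
        by (auto simp: divide_le_eq_1)
    qed (simp add: \<alpha>_def)
    then show "\<alpha> \<in> indivs \<rightarrow>\<^sub>E {0..1}" by (auto simp: \<alpha>_def)
    show "\<alpha> [] = 1" by (simp add: \<alpha>_def)
    show "label_fun \<alpha> \<in> nnhf" using eq' \<phi> by simp
    fix i and j :: nat assume i: "i \<in> indivs" and j: "j \<ge> 1" and z: "\<alpha> i = 0"
    have "\<phi> (spine i) = 0"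
    proof (cases i rule: rev_cases)
      case (snoc k l)
      then have "label_fun \<alpha> (spine i) = 0"
        using i z by (auto simp: label_fun_spine_snoc)
      then show ?thesis using eq' by simp
    qed (use z in \<open>simp add: \<alpha>_def\<close>)
    then show "\<alpha> (i @ [j]) = 0" using \<alpha>_snoc[OF i j] by simp
  qed
  then show ?thesis using eq' by blast
qed

text \<open>Choquet--Deny: if \<open>D = descend v f / a - f\<close> had a positive supremum \<open>M\<close> relative to \<open>\<phi>\<close>,
  then iterating \<^term>\<open>descend v\<close> would increase \<open>f\<close> by almost \<open>M * \<phi>\<close> at each step, near a
  point where \<open>D\<close> almost attains \<open>M * \<phi>\<close>.\<close>

lemma descend_eigen_le:
  fixes v i j
  defines "v \<equiv> i @ [j]"
  assumes \<phi>: "harm i \<phi>" and eig: "\<And>\<tau>. \<tau> \<in> ptrees \<Longrightarrow> i \<in> \<tau> \<Longrightarrow> descend v \<phi> \<tau> = a * \<phi> \<tau>"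
    and a: "0 < a" and f: "harm i f" and le: "\<And>\<tau>. \<tau> \<in> ptrees \<Longrightarrow> i \<in> \<tau> \<Longrightarrow> f \<tau> \<le> C * \<phi> \<tau>"
    and \<tau>0: "\<tau>0 \<in> ptrees" "i \<in> \<tau>0"
  shows "descend v f \<tau>0 \<le> a * f \<tau>0"
proof (rule ccontr)
  assume neg: "\<not> ?thesis"
  \<comment> \<open>Normalised so that \<open>U\<close> fixes \<open>\<phi>\<close>.\<close>
  define U where "U h = (\<lambda>\<tau>. (1 / a) * descend v h \<tau>)" for h
  have harm_U: "harm i (U h)" if "harm i h" for h
    unfolding U_def v_def using a by (intro harm_scale harm_descend that) auto
  have U_le: "U h \<tau> \<le> h \<tau> / a" if "harm i h" "\<tau> \<in> ptrees" "i \<in> \<tau>" for h \<tau>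
    using descend_le[OF that, of v] a by (simp add: U_def divide_right_mono)
  define D where "D \<tau> = U f \<tau> - f \<tau>" for \<tau>
  define V where "V = {\<tau> \<in> ptrees. i \<in> \<tau> \<and> \<phi> \<tau> > 0}"
  define M where "M = (SUP \<tau>\<in>V. D \<tau> / \<phi> \<tau>)"
  have D_zero: "D \<tau> = 0" if "\<tau> \<in> ptrees" "i \<in> \<tau>" "\<tau> \<notin> V" for \<tau>
  proof -
    have "\<phi> \<tau> = 0" using that harmD(1)[OF \<phi>] by (force simp: V_def)
    then have "f \<tau> = 0" using le[OF that(1,2)] harmD(1)[OF f that(1,2)] by simp
    moreover have "U f \<tau> \<ge> 0" using harmD(1)[OF harm_U[OF f] that(1,2)] .
    ultimately show ?thesis using U_le[OF f that(1,2)] by (simp add: D_def)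
  qed
  have D0: "D \<tau>0 > 0" using neg a by (simp add: D_def U_def field_simps)
  then have V0: "\<tau>0 \<in> V" using D_zero \<tau>0 by force
  have bdd: "bdd_above ((\<lambda>\<tau>. D \<tau> / \<phi> \<tau>) ` V)"
  proof (rule bdd_aboveI2)
    fix \<tau> assume \<tau>: "\<tau> \<in> V"
    then have "D \<tau> \<le> f \<tau> / a" using U_le[OF f, of \<tau>] harmD(1)[OF f, of \<tau>] by (simp add: D_def V_def)
    also have "\<dots> \<le> C * \<phi> \<tau> / a" using le[of \<tau>] \<tau> a by (intro divide_right_mono) (auto simp: V_def)
    finally show "D \<tau> / \<phi> \<tau> \<le> C / a" using \<tau> by (simp add: V_def field_simps)
  qed
  have "0 < D \<tau>0 / \<phi> \<tau>0" using D0 V0 by (simp add: V_def)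
  also have "\<dots> \<le> M" unfolding M_def by (rule cSUP_upper[OF V0 bdd])
  finally have M: "M > 0" .
  have D_le: "D \<tau> \<le> M * \<phi> \<tau>" if "\<tau> \<in> ptrees" "i \<in> \<tau>" for \<tau>
  proof (cases "\<tau> \<in> V")
    case True
    then have "D \<tau> / \<phi> \<tau> \<le> M" unfolding M_def by (intro cSUP_upper bdd)
    then show ?thesis using True by (simp add: V_def field_simps)
  next
    case False
    then show ?thesis using D_zero[OF that] M harmD(1)[OF \<phi> that] by simp
  qed
  \<comment> \<open>The defect \<open>M * \<phi> - D\<close>: nonnegative by the choice of
    \<open>M\<close>, and small compared with \<open>\<phi>\<close> where \<open>D / \<phi>\<close>
    is close to its supremum.\<close>
  define g where "g \<tau> = M * \<phi> \<tau> + f \<tau> - U f \<tau>" for \<tau>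
  have g: "harm i g"
    unfolding g_def
    by (intro harm_diff harm_add harm_scale \<phi> f harm_U) (use M D_le in \<open>auto simp: D_def diff_le_eq\<close>)
  define F where "F k = (U ^^ k) f" for k
  define G where "G k = (U ^^ k) g" for k
  have F_Suc: "F (Suc k) = U (F k)" and G_Suc: "G (Suc k) = U (G k)" for k
    by (simp_all add: F_def G_def)
  have harm_F: "harm i (F k)" and harm_G: "harm i (G k)" for k
    by (induction k) (use f g harm_U in \<open>auto simp: F_def G_def\<close>)
  have U\<phi>: "U \<phi> \<tau> = \<phi> \<tau>" if "\<tau> \<in> ptrees" "i \<in> \<tau>" for \<tau>
    using eig[OF that] a by (simp add: U_def)
  have F_le: "F k \<tau> \<le> C * \<phi> \<tau>" if "\<tau> \<in> ptrees" "i \<in> \<tau>" for k \<tau>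
    using that
  proof (induction k arbitrary: \<tau>)
    case 0
    then show ?case using le by (simp add: F_def)
  next
    case (Suc k)
    have "C * \<phi> \<tau> \<ge> 0" if "\<tau> \<in> ptrees" "i \<in> \<tau>" for \<tau>
      using harmD(1)[OF f that] le[OF that] by linarith
    then have "harm i (\<lambda>\<tau>. C * \<phi> \<tau>)"
      using harmD(2)[OF \<phi>] by (auto simp: harm_def harmonic_at_def intro: has_sum_cmult_right)
    then have "descend v (F k) \<tau> \<le> descend v (\<lambda>\<tau>. C * \<phi> \<tau>) \<tau>"
      using Suc by (intro descend_mono[OF harm_F]) auto
    also have "\<dots> = a * (C * \<phi> \<tau>)" using descend_scale[OF \<phi> Suc.prems] eig[OF Suc.prems] by simp
    finally show ?case using a by (simp add: F_Suc U_def field_simps)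
  qed
  \<comment> \<open>\<open>U\<close> multiplies a function by at most \<open>1 / a\<close>, so a
    defect that is small enough at one tree stays small there during any fixed number of
    iterations.\<close>
  have G_le: "G k \<tau> \<le> g \<tau> / a ^ k" if "\<tau> \<in> ptrees" "i \<in> \<tau>" for k \<tau>
  proof (induction k)
    case (Suc k)
    have "G (Suc k) \<tau> \<le> G k \<tau> / a" unfolding G_Suc by (rule U_le[OF harm_G that])
    also have "\<dots> \<le> g \<tau> / a ^ k / a" using Suc a by (intro divide_right_mono) auto
    finally show ?case by (simp add: mult.commute)
  qed (simp add: G_def)
  have FG: "F (Suc k) \<tau> + G k \<tau> = M * \<phi> \<tau> + F k \<tau>" if "\<tau> \<in> ptrees" "i \<in> \<tau>" for k \<tau>
    using that
  proof (induction k arbitrary: \<tau>)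
    case 0
    then show ?case by (simp add: F_def G_def g_def)
  next
    case (Suc k)
    have "descend v (\<lambda>\<tau>. F (Suc k) \<tau> + G k \<tau>) \<tau> = descend v (\<lambda>\<tau>. M * \<phi> \<tau> + F k \<tau>) \<tau>"
      using Suc by (intro descend_cong) auto
    then have "descend v (F (Suc k)) \<tau> + descend v (G k) \<tau> = M * descend v \<phi> \<tau> + descend v (F k) \<tau>"
      using M descend_add[OF harm_F harm_G Suc.prems] descend_scale[OF \<phi> Suc.prems]
        descend_add[OF harm_scale[OF \<phi>] harm_F Suc.prems] by simp
    then have "U (F (Suc k)) \<tau> + U (G k) \<tau> = M * U \<phi> \<tau> + U (F k) \<tau>"
      unfolding U_def by (simp add: add_divide_distrib[symmetric])
    then show ?case using U\<phi>[OF Suc.prems] by (simp add: F_Suc G_Suc)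
  qed
  \<comment> \<open>The identities \<open>FG\<close> telescope over \<open>K\<close> steps, while
    \<open>F K\<close> never exceeds \<open>C * \<phi>\<close>.\<close>
  have sum: "K * (M * \<phi> \<tau>) \<le> C * \<phi> \<tau> + (\<Sum>k<K. 1 / a ^ k) * g \<tau>"
    if \<tau>: "\<tau> \<in> ptrees" "i \<in> \<tau>" for K \<tau>
  proof -
    have "real K * (M * \<phi> \<tau>) + f \<tau> = F K \<tau> + (\<Sum>k<K. G k \<tau>)"
    proof (induction K)
      case (Suc K)
      then show ?case using FG[OF \<tau>, of K] by (simp add: distrib_right)
    qed (simp add: F_def)
    moreover have "(\<Sum>k<K. G k \<tau>) \<le> (\<Sum>k<K. 1 / a ^ k) * g \<tau>"
      unfolding sum_distrib_right using G_le[OF \<tau>] by (intro sum_mono) auto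
    ultimately show ?thesis using F_le[OF \<tau>, of K] harmD(1)[OF f \<tau>] by linarith
  qed
  \<comment> \<open>First \<open>K\<close> is chosen so that the gain \<open>K * M\<close> beats
    \<open>C\<close> by more than 1; then \<open>\<tau>\<close>, depending on \<open>K\<close>
    through \<open>S\<close>, so that the accumulated defect costs at most
    \<open>\<phi> \<tau>\<close>.\<close>
  obtain K :: nat where K: "K * M > C + 1"
    using M by (metis ex_less_of_nat_mult)
  define S where "S = (\<Sum>k<K. 1 / a ^ k)"
  have S: "S \<ge> 0" using a by (auto simp: S_def intro: sum_nonneg)
  have "M - 1 / (S + 1) < M" using S by simp
  then obtain \<tau> where \<tau>: "\<tau> \<in> V" "M - 1 / (S + 1) < D \<tau> / \<phi> \<tau>"
    unfolding M_def using less_cSUP_iff[OF _ bdd] V0 by blast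
  then have \<tau>': "\<tau> \<in> ptrees" "i \<in> \<tau>" "\<phi> \<tau> > 0" by (auto simp: V_def)
  have "(M - 1 / (S + 1)) * \<phi> \<tau> < D \<tau>"
    using \<tau>(2) \<tau>'(3) by (simp add: pos_less_divide_eq)
  then have "g \<tau> \<le> \<phi> \<tau> / (S + 1)" by (simp add: g_def D_def algebra_simps)
  then have "S * g \<tau> \<le> S * (\<phi> \<tau> / (S + 1))" using S by (rule mult_left_mono)
  also have "\<dots> \<le> \<phi> \<tau>" using S \<tau>'(3) by (simp add: field_simps)
  finally have "K * M * \<phi> \<tau> \<le> (C + 1) * \<phi> \<tau>"
    using sum[OF \<tau>'(1,2), of K] unfolding S_def[symmetric] by (simp add: algebra_simps)
  then show False using K \<tau>'(3) by simp
qed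

text \<open>The inequality is applied to \<open>f\<close> and to \<open>C * \<phi> - f\<close>,
  which satisfies the same hypotheses.\<close>

lemma descend_eigen:
  assumes \<phi>: "harm i \<phi>" and eig: "\<And>\<tau>. \<tau> \<in> ptrees \<Longrightarrow> i \<in> \<tau> \<Longrightarrow> descend (i @ [j]) \<phi> \<tau> = a * \<phi> \<tau>"
    and a: "0 < a" and f: "harm i f" and le: "\<And>\<tau>. \<tau> \<in> ptrees \<Longrightarrow> i \<in> \<tau> \<Longrightarrow> f \<tau> \<le> C * \<phi> \<tau>"
    and C: "C \<ge> 0" and \<tau>: "\<tau> \<in> ptrees" "i \<in> \<tau>"
  shows "descend (i @ [j]) f \<tau> = a * f \<tau>"
proof (rule antisym)
  show "descend (i @ [j]) f \<tau> \<le> a * f \<tau>"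
    by (rule descend_eigen_le[OF \<phi> eig a f le \<tau>])
  let ?h = "\<lambda>\<tau>. C * \<phi> \<tau> - f \<tau>"
  have h: "harm i ?h" using le by (intro harm_diff harm_scale \<phi> f C) auto
  have "descend (i @ [j]) ?h \<tau> \<le> a * ?h \<tau>"
    by (rule descend_eigen_le[OF \<phi> eig a h _ \<tau>, of C]) (use harmD(1)[OF f] in auto)
  moreover have "descend (i @ [j]) ?h \<tau> = C * descend (i @ [j]) \<phi> \<tau> - descend (i @ [j]) f \<tau>"
    by (intro descend_eqI has_sum_diff has_sum_cmult_right has_sum_descend[OF \<phi> \<tau>] has_sum_descend[OF f \<tau>])
  ultimately show "a * f \<tau> \<le> descend (i @ [j]) f \<tau>"
    using eig[OF \<tau>] by (simp add: algebra_simps)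
qed

text \<open>A dominated \<open>\<psi>\<close> obeys the same growth rule: for
  \<open>\<alpha> v > 0\<close> by \<open>descend_eigen\<close>, whose proof divides by the
  eigenvalue, and for \<open>\<alpha> v = 0\<close> because domination forces the value 0.\<close>

lemma label_fun_extremal:
  assumes \<alpha>: "\<alpha> \<in> labels"
  shows "label_fun \<alpha> \<in> extremal_nnhf"
proof (rule extremal_nnhf_not_mono[OF label_fun_nnhf[OF \<alpha>]])
  fix \<psi> C assume \<psi>: "\<psi> \<in> nnhf" and C: "C > 0"
    and le: "\<And>\<tau>. \<tau> \<in> ptrees \<Longrightarrow> \<psi> \<tau> \<le> C * label_fun \<alpha> \<tau>"
  have "\<psi> \<tau> = label_fun \<alpha> \<tau>" if "\<tau> \<in> ptrees" for \<tau>
    using that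
  proof (induction rule: ptrees_induct)
    case root
    then show ?case using nnhf_root[OF \<psi>] nnhf_root[OF label_fun_nnhf[OF \<alpha>]] by simp
  next
    case (insert \<tau> v)
    obtain i j where ij: "v = i @ [j]" "i \<in> \<tau>" "j \<ge> 1" using insert.hyps by (auto simp: addable_def)
    have v: "v \<in> indivs" using addable_indivs[OF insert.hyps] .
    show ?case
    proof (cases "\<alpha> v = 0")
      case True
      then show ?thesis
        using le[OF insert_ptrees[OF insert.hyps]] nnhf_nonneg[OF \<psi> insert_ptrees[OF insert.hyps]] insert.hyps
        by (simp add: label_fun_insert)
    next
      case False
      then have "\<alpha> v > 0" using labels_range[OF \<alpha>] v by (force simp: Pi_def)
      then have "descend v \<psi> \<tau> = \<alpha> v * \<psi> \<tau>"
        unfolding ij(1)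
        by (intro descend_eigen[OF nnhf_harm[OF label_fun_nnhf[OF \<alpha>]] _ _ nnhf_harm[OF \<psi>] le])
           (use descend_label_fun[OF \<alpha>] ij insert.hyps C in auto)
      then show ?thesis
        using descend_addable[OF insert.hyps] insert by (simp add: label_fun_insert)
    qed
  qed
  then show "\<psi> = label_fun \<alpha>"
    using nnhf_extensional[OF \<psi>] by (intro extensionalityI[of _ ptrees]) (auto simp: label_fun_def)
qed

lemma bij_betw_label_fun: "bij_betw label_fun labels extremal_nnhf"
  unfolding bij_betw_def
  using inj_on_label_fun label_fun_extremal extremal_is_label_fun by fast

text \<open>The level sum of a harmonic function from the root, with path numbers given by the hook
  formula. Trees of size \<open>n\<close> are \<open>n - 1\<close> insertions away from the
  root.\<close>

lemma label_fun_has_sum_one: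
  assumes "\<alpha> \<in> labels" "n \<ge> 1"
  shows "((\<lambda>\<sigma>. fact n / (\<Prod>i\<in>\<sigma>. real (card (subtree \<sigma> i))) * (\<Prod>i\<in>\<sigma>. \<alpha> i)) has_sum 1)
    (trees_of_size n)"
proof -
  note \<phi> = label_fun_nnhf[OF assms(1)]
  have "((\<lambda>\<sigma>. real (num_paths root_tree \<sigma>) * label_fun \<alpha> \<sigma>) has_sum 1) (trees_of_size n)"
    using has_sum_num_paths[OF nnhf_harmonic[OF \<phi>] nnhf_nonneg[OF \<phi>] root_in_ptrees, of "n - 1"]
      nnhf_root[OF \<phi>] assms(2) by (simp add: root_tree_def)
  then show ?thesis
    by (rule has_sum_cong[THEN iffD1, rotated])
       (auto simp: trees_of_size_eq num_paths_root label_fun_def)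
qed

section \<open>Asymptotics of the Martin kernel\<close>

text \<open>Normalised by the size, not by the level as in the theorem, so that the root share is
  exactly 1; \<open>path_ratio_tendsto_iff\<close> compares the two.\<close>

definition share :: "tree \<Rightarrow> indiv \<Rightarrow> real" where
  "share \<sigma> i = real (card (subtree \<sigma> i)) / real (card \<sigma>)"

lemma card_subtree_le:
  assumes "\<sigma> \<in> ptrees" "prefix i k"
  shows "card (subtree \<sigma> k) \<le> card (subtree \<sigma> i)"
  unfolding card_subtree[OF assms(1)]
  using assms ptrees_finite by (intro card_mono) (auto intro: prefix_order.trans)

lemma share_nonneg: "share \<sigma> i \<ge> 0"
  by (simp add: share_def)

lemma share_mono:
  assumes "\<sigma> \<in> ptrees" "prefix i k"
  shows "share \<sigma> k \<le> share \<sigma> i"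
  using card_subtree_le[OF assms] by (simp add: share_def divide_right_mono)

lemma share_Nil: "\<sigma> \<in> ptrees \<Longrightarrow> share \<sigma> [] = 1"
  using ptrees_card_pos[of \<sigma>] by (simp add: share_def card_subtree_Nil)

lemma share_le_1: "\<sigma> \<in> ptrees \<Longrightarrow> share \<sigma> i \<le> 1"
  using share_mono[of \<sigma> "[]" i] share_Nil[of \<sigma>] by simp

text \<open>For \<open>k \<le> m\<close> this is \<open>m ^ k\<close> over the falling factorial
  \<open>m (m - 1) ... (m - k + 1)\<close>, the discrepancy between the kernel and the product of
  shares.\<close>

definition kernel_factor :: "nat \<Rightarrow> nat \<Rightarrow> real" where
  "kernel_factor k m = fact (m - k) * real m ^ k / fact m"

text \<open>Raising \<open>k\<close> by one multiplies the factor by \<open>m / (m - k)\<close>,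
  which tends to 1.\<close>

lemma kernel_factor_tendsto: "kernel_factor k \<longlonglongrightarrow> 1"
proof (induction k)
  case 0
  then show ?case by (simp add: kernel_factor_def)
next
  case (Suc k)
  have "(\<lambda>m. 1 + real k * inverse (real m)) \<longlonglongrightarrow> 1 + real k * 0"
    by (intro tendsto_intros lim_inverse_n)
  moreover have "eventually (\<lambda>m. 1 + real k * inverse (real m) = real (m + k) / (real (m + k) - real k)) sequentially"
    using eventually_gt_at_top[of 0] by eventually_elim (simp add: field_simps)
  ultimately have "(\<lambda>m. real (m + k) / (real (m + k) - real k)) \<longlonglongrightarrow> 1"
    by (simp add: filterlim_cong)
  then have "(\<lambda>m. real m / (real m - real k)) \<longlonglongrightarrow> 1" by (rule LIMSEQ_offset)
  then have lim: "(\<lambda>m. kernel_factor k m * (real m / (real m - real k))) \<longlonglongrightarrow> 1 * 1"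
    by (intro tendsto_mult Suc)
  have "eventually (\<lambda>m. kernel_factor (Suc k) m = kernel_factor k m * (real m / (real m - real k))) sequentially"
    using eventually_gt_at_top[of k]
  proof eventually_elim
    case (elim m)
    then have *: "fact (m - k) = (real m - real k) * fact (m - Suc k)"
      by (subst fact_reduce) (auto simp: of_nat_diff)
    have "real m - real k \<noteq> 0" using elim by simp
    then show ?case unfolding kernel_factor_def * by (simp add: field_simps)
  qed
  then show ?case using lim by (simp add: filterlim_cong)
qed

lemma martin_kernel_share:
  assumes "\<tau> \<in> ptrees" "\<sigma> \<in> ptrees"
  shows "martin_kernel \<tau> \<sigma> = kernel_factor (card \<tau>) (card \<sigma>) * (\<Prod>i\<in>\<tau>. share \<sigma> i)"
  using ptrees_card_pos[OF assms(2)]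
  by (simp add: martin_kernel_eq[OF assms] kernel_factor_def share_def prod_dividef)

lemma martin_kernel_tendsto:
  assumes "\<And>n. \<sigma> n \<in> ptrees" "filterlim (\<lambda>n. card (\<sigma> n)) at_top sequentially" "\<tau> \<in> ptrees"
    and "\<And>i. i \<in> \<tau> \<Longrightarrow> (\<lambda>n. share (\<sigma> n) i) \<longlonglongrightarrow> \<alpha> i"
  shows "(\<lambda>n. martin_kernel \<tau> (\<sigma> n)) \<longlonglongrightarrow> (\<Prod>i\<in>\<tau>. \<alpha> i)"
proof -
  have "(\<lambda>n. kernel_factor (card \<tau>) (card (\<sigma> n)) * (\<Prod>i\<in>\<tau>. share (\<sigma> n) i)) \<longlonglongrightarrow> 1 * (\<Prod>i\<in>\<tau>. \<alpha> i)"
    by (intro tendsto_mult tendsto_prod assms filterlim_compose[OF kernel_factor_tendsto assms(2)])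
  then show ?thesis using assms by (simp add: martin_kernel_share)
qed

text \<open>The kernel at \<open>spine i\<close> controls the product of the shares along the spine,
  and the last factor is recovered by division. If the product over the proper prefixes tends to 0,
  some prefix has share tending to 0 and dominates the share of \<open>i\<close>.\<close>

lemma share_convergent:
  assumes \<sigma>: "\<And>n. \<sigma> n \<in> ptrees" and lim: "filterlim (\<lambda>n. card (\<sigma> n)) at_top sequentially"
    and K: "\<And>\<tau>. \<tau> \<in> ptrees \<Longrightarrow> convergent (\<lambda>n. martin_kernel \<tau> (\<sigma> n))"
    and "i \<in> indivs"
  shows "convergent (\<lambda>n. share (\<sigma> n) i)"
  using assms(4)
proof (induction i rule: length_induct)
  case (1 i)
  have prod_conv: "convergent (\<lambda>n. \<Prod>k\<in>spine i. share (\<sigma> n) k)" if i: "i \<in> indivs" for i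
  proof -
    let ?q = "\<lambda>n. kernel_factor (card (spine i)) (card (\<sigma> n))"
    have q: "?q \<longlonglongrightarrow> 1" by (rule filterlim_compose[OF kernel_factor_tendsto lim])
    obtain L where L: "(\<lambda>n. martin_kernel (spine i) (\<sigma> n)) \<longlonglongrightarrow> L"
      using K[OF spine_ptrees[OF i]] by (auto simp: convergent_def)
    have "eventually (\<lambda>n. ?q n \<noteq> 0) sequentially"
      using q by (rule tendsto_imp_eventually_ne) simp
    then have "eventually (\<lambda>n. martin_kernel (spine i) (\<sigma> n) / ?q n = (\<Prod>k\<in>spine i. share (\<sigma> n) k)) sequentially"
      by eventually_elim (simp add: martin_kernel_share[OF spine_ptrees[OF i] \<sigma>])
    moreover have "(\<lambda>n. martin_kernel (spine i) (\<sigma> n) / ?q n) \<longlonglongrightarrow> L / 1"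
      by (intro tendsto_divide L q) simp
    ultimately have "(\<lambda>n. \<Prod>k\<in>spine i. share (\<sigma> n) k) \<longlonglongrightarrow> L / 1"
      by (rule Lim_transform_eventually[rotated])
    then show ?thesis by (auto simp: convergent_def)
  qed
  show ?case
  proof (cases i rule: rev_cases)
    case Nil
    then show ?thesis using \<sigma> by (simp add: share_Nil convergent_const)
  next
    case (snoc k j)
    have k: "k \<in> indivs" "j \<ge> 1" using snoc 1(2) by auto
    have fin: "finite (spine k)" using spine_ptrees[OF k(1)] ptrees_finite by blast
    have "\<exists>L. (\<lambda>n. share (\<sigma> n) l) \<longlonglongrightarrow> L" if "l \<in> spine k" for l
    proof -
      have "length l < length i" using that snoc prefix_length_le by (fastforce simp: spine_def)
      moreover have "l \<in> indivs" using that ptrees_indivs[OF spine_ptrees[OF k(1)]] by blast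
      ultimately show ?thesis using 1(1) by (simp add: convergent_def)
    qed
    then obtain a where a: "\<And>l. l \<in> spine k \<Longrightarrow> (\<lambda>n. share (\<sigma> n) l) \<longlonglongrightarrow> a l" by metis
    show ?thesis
    proof (cases "(\<Prod>l\<in>spine k. a l) = 0")
      case True
      then obtain l where l: "l \<in> spine k" "a l = 0" using fin by auto
      then have li: "prefix l i" using snoc by (auto simp: spine_def)
      have "(\<lambda>n. share (\<sigma> n) i) \<longlonglongrightarrow> 0"
      proof (rule tendsto_sandwich[of "\<lambda>_. 0" _ sequentially "\<lambda>n. share (\<sigma> n) l"])
        show "eventually (\<lambda>n. share (\<sigma> n) i \<le> share (\<sigma> n) l) sequentially"
          using share_mono[OF \<sigma> li] by simp
        show "(\<lambda>n. share (\<sigma> n) l) \<longlonglongrightarrow> 0" using a[OF l(1)] l(2) by simp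
      qed (auto simp: share_nonneg)
      then show ?thesis by (auto simp: convergent_def)
    next
      case False
      obtain L where L: "(\<lambda>n. \<Prod>l\<in>spine i. share (\<sigma> n) l) \<longlonglongrightarrow> L"
        using prod_conv[OF 1(2)] by (auto simp: convergent_def)
      have P: "(\<lambda>n. \<Prod>l\<in>spine k. share (\<sigma> n) l) \<longlonglongrightarrow> (\<Prod>l\<in>spine k. a l)"
        by (intro tendsto_prod a)
      have "(\<Prod>l\<in>spine i. share (\<sigma> n) l) = share (\<sigma> n) i * (\<Prod>l\<in>spine k. share (\<sigma> n) l)" for n
        using fin snoc addable_notin[OF snoc_addable_spine[OF k(2), of k]] by (simp add: spine_snoc)
      then have "eventually (\<lambda>n. (\<Prod>l\<in>spine i. share (\<sigma> n) l) / (\<Prod>l\<in>spine k. share (\<sigma> n) l) = share (\<sigma> n) i)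
          sequentially"
        using tendsto_imp_eventually_ne[OF P False] by (auto elim: eventually_mono)
      moreover have "(\<lambda>n. (\<Prod>l\<in>spine i. share (\<sigma> n) l) / (\<Prod>l\<in>spine k. share (\<sigma> n) l))
          \<longlonglongrightarrow> L / (\<Prod>l\<in>spine k. a l)"
        by (intro tendsto_divide L P False)
      ultimately have "(\<lambda>n. share (\<sigma> n) i) \<longlonglongrightarrow> L / (\<Prod>l\<in>spine k. a l)"
        by (rule Lim_transform_eventually[rotated])
      then show ?thesis by (auto simp: convergent_def)
    qed
  qed
qed

section \<open>Trees with prescribed shares\<close>

lemma labels_child_sum_le:
  assumes "\<alpha> \<in> labels" "k \<in> indivs" "finite J" "J \<subseteq> {1..}"
  shows "(\<Sum>j\<in>J. \<alpha> (k @ [j])) \<le> \<alpha> k"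
proof (rule has_sum_mono2[OF _ labels_has_sum[OF assms(1,2)]])
  show "((\<lambda>n. \<alpha> (k @ [n])) has_sum (\<Sum>j\<in>J. \<alpha> (k @ [j]))) J"
    by (rule has_sum_finiteI) (use assms in auto)
  show "\<alpha> (k @ [n]) \<ge> 0" if "n \<in> {1..} - J" for n
    using labels_range[OF assms(1)] assms(2) that by (auto simp: Pi_def)
qed (use assms in auto)

text \<open>Below each \<open>k \<in> F\<close> attach, under a child with a letter \<open>M\<close> not used in \<open>F\<close>, a chain whose
  length is proportional to the part of \<open>\<alpha> k\<close> not accounted for by the children of \<open>k\<close> in \<open>F\<close>.\<close>

lemma approximate_labels:
  assumes \<alpha>: "\<alpha> \<in> labels" and F: "F \<in> ptrees" and e: "e > 0"
  shows "\<exists>\<sigma>\<in>ptrees. card \<sigma> \<ge> m \<and> (\<forall>i\<in>F. \<bar>share \<sigma> i - \<alpha> i\<bar> < e)"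
proof -
  note finF = ptrees_finite[OF F]
  have "finite (insert 0 (\<Union>i\<in>F. set i))" using finF by simp
  then obtain M where M: "M \<notin> insert 0 (\<Union>i\<in>F. set i)" using ex_new_if_finite infinite_UNIV_nat by blast
  then have M0: "M \<ge> 1" and MF: "\<And>i. i \<in> F \<Longrightarrow> M \<notin> set i" by auto
  define R where "R k = \<alpha> k - (\<Sum>j | k @ [j] \<in> F. \<alpha> (k @ [j]))" for k
  have finJ: "finite {j. k @ [j] \<in> F}" for k
    by (rule finite_subset[of _ "last ` F"]) (use finF in \<open>auto intro: rev_image_eqI\<close>)
  have R0: "R k \<ge> 0" if "k \<in> F" for k
  proof -
    have "{j. k @ [j] \<in> F} \<subseteq> {1..}" using ptrees_indivs[OF F] by auto
    then show ?thesis
      using labels_child_sum_le[OF \<alpha> _ finJ, of k k] that ptrees_indivs[OF F] by (auto simp: R_def)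
  qed
  \<comment> \<open>The sum telescopes: every proper descendant of \<open>i\<close> in
    \<open>F\<close> is subtracted once, as a child of its parent.\<close>
  have R_sum: "(\<Sum>k | k \<in> F \<and> prefix i k. R k) = \<alpha> i" if i: "i \<in> F" for i
  proof -
    let ?A = "{k \<in> F. prefix i k}"
    have "?A - {i} = (\<Union>k\<in>?A. (\<lambda>j. k @ [j]) ` {j. k @ [j] \<in> F})"
    proof (intro equalityI subsetI)
      fix x assume x: "x \<in> ?A - {i}"
      then have "x \<noteq> []" by auto
      then obtain k j where kj: "x = k @ [j]" using rev_exhaust by blast
      with x have "k \<in> ?A" using ptrees_prefix[OF F] by auto
      then show "x \<in> (\<Union>k\<in>?A. (\<lambda>j. k @ [j]) ` {j. k @ [j] \<in> F})" using x kj by auto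
    qed (auto dest: prefix_length_le)
    then have "(\<Sum>k\<in>?A - {i}. \<alpha> k) = (\<Sum>k\<in>?A. \<Sum>x\<in>(\<lambda>j. k @ [j]) ` {j. k @ [j] \<in> F}. \<alpha> x)"
      using finF finJ by (simp only:) (intro sum.UNION_disjoint; auto)
    also have "\<dots> = (\<Sum>k\<in>?A. \<Sum>j | k @ [j] \<in> F. \<alpha> (k @ [j]))"
      by (intro sum.cong refl) (simp add: sum.reindex inj_on_def)
    finally have "(\<Sum>k\<in>?A. R k) = (\<Sum>k\<in>?A. \<alpha> k) - (\<Sum>k\<in>?A - {i}. \<alpha> k)"
      by (simp add: R_def sum_subtractf)
    also have "\<dots> = \<alpha> i" using i finF by (subst sum.remove[of ?A i]) auto
    finally show ?thesis .
  qed
  \<comment> \<open>Rounding costs at most one vertex per element of \<open>F\<close>;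
    \<open>N\<close> makes \<open>card F\<close> smaller than \<open>e * N\<close>.\<close>
  obtain N :: nat where N: "N \<ge> m" "N > card F / e" "N > 0"
  proof -
    obtain N0 :: nat where "N0 > card F / e" using reals_Archimedean2 by blast
    then have "real (N0 + m + 1) > card F / e" by simp
    then show ?thesis using that[of "N0 + m + 1"] by simp
  qed
  define n where "n k = nat \<lfloor>N * R k\<rfloor>" for k
  define chain where "chain k = (\<lambda>t. k @ [M] @ replicate t 1) ` {..<n k}" for k
  define \<sigma> where "\<sigma> = F \<union> (\<Union>k\<in>F. chain k)"
  have \<sigma>: "\<sigma> \<in> ptrees"
    unfolding ptrees_iff
  proof (intro conjI allI impI)
    show "finite \<sigma>" using finF by (simp add: \<sigma>_def chain_def)
    show "[] \<in> \<sigma>" using ptrees_Nil[OF F] by (simp add: \<sigma>_def)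
    have "M # replicate t (Suc 0) \<in> indivs" for t using M0 by (auto simp: indivs_def lists_eq_set)
    then show "\<sigma> \<subseteq> indivs" using ptrees_indivs[OF F] by (auto simp: \<sigma>_def chain_def)
    fix i j assume "i @ j \<in> \<sigma>"
    then consider "i @ j \<in> F" | k t where "k \<in> F" "t < n k" "i @ j = k @ [M] @ replicate t 1"
      by (auto simp: \<sigma>_def chain_def)
    then show "i \<in> \<sigma>"
    proof cases
      case 1
      then show ?thesis using ptrees_prefix[OF F] by (auto simp: \<sigma>_def)
    next
      case 2
      then have "prefix i k \<or> (\<exists>us. i = k @ us \<and> prefix us ([M] @ replicate t 1))"
        by (metis prefixI prefix_append)
      then show ?thesis
      proof
        assume "prefix i k"
        then show ?thesis using ptrees_prefix'[OF F] 2(1) by (auto simp: \<sigma>_def)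
      next
        assume "\<exists>us. i = k @ us \<and> prefix us ([M] @ replicate t 1)"
        then obtain us where us: "i = k @ us" "prefix us ([M] @ replicate t 1)" by blast
        show ?thesis
        proof (cases us)
          case Nil
          then show ?thesis using us 2(1) by (simp add: \<sigma>_def)
        next
          case (Cons a as)
          then have a: "a = M" "prefix as (replicate t 1)" using us(2) by auto
          then obtain bs where "replicate t 1 = as @ bs" by (auto simp: prefix_def)
          then have as: "as = replicate (length as) 1" "length as \<le> t"
            by (metis append_eq_append_conv_if length_replicate replicate_length_same in_set_replicate Un_iff set_append)
              (metis \<open>replicate t 1 = as @ bs\<close> le_add1 length_append length_replicate)
          then have "i \<in> chain k" using us(1) Cons a 2(2) by (auto simp: chain_def intro!: image_eqI[of _ _ "length as"])
          then show ?thesis using 2(1) by (auto simp: \<sigma>_def)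
        qed
      qed
    qed
  qed
  have count: "card (subtree \<sigma> i) = (\<Sum>k | k \<in> F \<and> prefix i k. 1 + n k)" if i: "i \<in> F" for i
  proof -
    let ?A = "{k \<in> F. prefix i k}"
    have pre: "prefix i k" if "prefix i (k @ [M] @ us)" for k us
    proof -
      have "prefix i k \<or> (\<exists>vs. i = k @ vs \<and> prefix vs ([M] @ us))" using that prefix_append by blast
      then show ?thesis
      proof
        assume "\<exists>vs. i = k @ vs \<and> prefix vs ([M] @ us)"
        then obtain vs where "i = k @ vs" "prefix vs ([M] @ us)" by blast
        moreover have "M \<notin> set vs" using MF[OF i] calculation(1) by simp
        ultimately show ?thesis by (cases vs) auto
      qed
    qed
    \<comment> \<open>The first occurrence of \<open>M\<close> marks where a word leaves
      \<open>F\<close>, so chains at different vertices are disjoint.\<close>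
    have eqk: "k = k' \<and> us = us'" if "k @ [M] @ us = k' @ [M] @ us'" "k \<in> F" "k' \<in> F" for k k' us us'
    proof -
      have "takeWhile (\<lambda>x. x \<noteq> M) (k @ [M] @ us) = k" if "k \<in> F" for k us
        using MF[OF that] by (subst takeWhile_append2) auto
      then show ?thesis using that by (metis append_same_eq same_append_eq)
    qed
    have pre_chain: "prefix i x \<longleftrightarrow> prefix i k" if c: "x \<in> chain k" for x k
    proof -
      obtain us where "x = k @ [M] @ us" using c unfolding chain_def by blast
      then show ?thesis using pre[of k us] by (auto intro: prefix_prefix)
    qed
    have "{x \<in> \<sigma>. prefix i x} = ?A \<union> (\<Union>k\<in>?A. chain k)"
      unfolding \<sigma>_def using pre_chain by blast
    moreover have "?A \<inter> (\<Union>k\<in>?A. chain k) = {}"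
    proof -
      have "M \<in> set x" if "x \<in> chain k" for x k using that by (auto simp: chain_def)
      then show ?thesis using MF by blast
    qed
    ultimately have "card {x \<in> \<sigma>. prefix i x} = card ?A + card (\<Union>k\<in>?A. chain k)"
      using finF by (simp add: card_Un_disjoint chain_def)
    also have "card (\<Union>k\<in>?A. chain k) = (\<Sum>k\<in>?A. card (chain k))"
    proof (rule card_UN_disjoint)
      show "\<forall>k\<in>?A. \<forall>k'\<in>?A. k \<noteq> k' \<longrightarrow> chain k \<inter> chain k' = {}"
      proof (intro ballI impI)
        fix k k' assume k: "k \<in> ?A" "k' \<in> ?A" "k \<noteq> k'"
        show "chain k \<inter> chain k' = {}"
        proof (rule ccontr)
          assume "chain k \<inter> chain k' \<noteq> {}"
          then obtain us us' where "k @ [M] @ us = k' @ [M] @ us'" unfolding chain_def by blast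
          then show False using eqk k by blast
        qed
      qed
    qed (use finF in \<open>auto simp: chain_def\<close>)
    also have "\<dots> = (\<Sum>k\<in>?A. n k)"
      by (intro sum.cong refl) (auto simp: chain_def card_image inj_on_def)
    finally have "card {x \<in> \<sigma>. prefix i x} = (\<Sum>k\<in>?A. 1) + (\<Sum>k\<in>?A. n k)" by simp
    then show ?thesis unfolding card_subtree[OF \<sigma>] sum.distrib .
  qed
  \<comment> \<open>Each \<open>k\<close> contributes itself and \<open>n k\<close> chain vertices;
    as \<open>n k\<close> is rounded down, this exceeds \<open>N * R k\<close> by an amount between
    0 and 1.\<close>
  have bound: "0 \<le> card (subtree \<sigma> i) - N * \<alpha> i" "card (subtree \<sigma> i) - N * \<alpha> i \<le> card F"
    if i: "i \<in> F" for i
  proof -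
    let ?A = "{k \<in> F. prefix i k}"
    have eq: "card (subtree \<sigma> i) - N * \<alpha> i = (\<Sum>k\<in>?A. 1 + real (n k) - N * R k)"
      by (simp add: count[OF i] R_sum[OF i, symmetric] sum_subtractf sum_distrib_left)
    have n: "0 \<le> 1 + real (n k) - N * R k" "1 + real (n k) - N * R k \<le> 1" if "k \<in> ?A" for k
    proof -
      have "N * R k \<ge> 0" using R0 that by simp
      then have "real (n k) = of_int \<lfloor>N * R k\<rfloor>" by (simp add: n_def)
      then show "0 \<le> 1 + real (n k) - N * R k" "1 + real (n k) - N * R k \<le> 1" by linarith+
    qed
    show "0 \<le> card (subtree \<sigma> i) - N * \<alpha> i" unfolding eq using n by (intro sum_nonneg) auto
    have "(\<Sum>k\<in>?A. 1 + real (n k) - N * R k) \<le> (\<Sum>k\<in>?A. 1)" using n by (intro sum_mono) auto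
    also have "\<dots> \<le> card F" using finF by (simp add: card_mono)
    finally show "card (subtree \<sigma> i) - N * \<alpha> i \<le> card F" unfolding eq .
  qed
  have root: "0 \<le> real (card \<sigma>) - N" "real (card \<sigma>) - N \<le> card F"
    using bound[OF ptrees_Nil[OF F]] labels_Nil[OF \<alpha>] by (auto simp: card_subtree_Nil[OF \<sigma>])
  have "\<bar>share \<sigma> i - \<alpha> i\<bar> < e" if i: "i \<in> F" for i
  proof -
    have \<alpha>i: "0 \<le> \<alpha> i" "\<alpha> i \<le> 1" using labels_range[OF \<alpha>] i ptrees_indivs[OF F] by (auto simp: Pi_def)
    have c: "real (card \<sigma>) \<ge> N" "real (card \<sigma>) > 0" using root(1) N(3) by linarith+
    \<comment> \<open>The error is \<open>y - x\<close> with both parts between 0 and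
      \<open>card F\<close>: \<open>y\<close> comes from rounding in the subtree of
      \<open>i\<close>, \<open>x\<close> from rounding in the total size.\<close>
    define x where "x = (real (card \<sigma>) - N) * \<alpha> i"
    define y where "y = card (subtree \<sigma> i) - N * \<alpha> i"
    have "x \<le> (real (card \<sigma>) - N) * 1" unfolding x_def using root \<alpha>i by (intro mult_left_mono) auto
    then have "x \<le> card F" using root(2) by simp
    moreover have "x \<ge> 0" unfolding x_def using root \<alpha>i by simp
    moreover have "0 \<le> y" "y \<le> card F" using bound[OF i] by (simp_all add: y_def)
    ultimately have "\<bar>y - x\<bar> \<le> card F" by linarith
    moreover have "card (subtree \<sigma> i) - card \<sigma> * \<alpha> i = y - x" by (simp add: x_def y_def algebra_simps)
    ultimately have "\<bar>card (subtree \<sigma> i) - card \<sigma> * \<alpha> i\<bar> \<le> card F" by simp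
    also have "\<dots> < e * N" using N e by (simp add: pos_divide_less_eq mult.commute)
    also have "\<dots> \<le> e * card \<sigma>" using c e by (intro mult_left_mono) auto
    finally have "\<bar>card (subtree \<sigma> i) - card \<sigma> * \<alpha> i\<bar> / card \<sigma> < e"
      using c by (simp add: pos_divide_less_eq)
    moreover have "share \<sigma> i - \<alpha> i = (card (subtree \<sigma> i) - card \<sigma> * \<alpha> i) / card \<sigma>"
      using c by (simp add: share_def field_simps)
    ultimately show ?thesis using c by (simp add: abs_divide)
  qed
  moreover have "card \<sigma> \<ge> m" using root(1) N(1) by linarith
  ultimately show ?thesis using \<sigma> by blast
qed

text \<open>A diagonal choice along the finite trees of words with letters and length at most
  \<open>n\<close>, which exhaust all individuals. Successive approximating trees need not be
  nested.\<close>

lemma labels_approximable: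
  assumes "\<alpha> \<in> labels"
  obtains \<sigma> where "\<And>n. \<sigma> n \<in> ptrees" "filterlim (\<lambda>n. card (\<sigma> n)) at_top sequentially"
    "\<And>i. i \<in> indivs \<Longrightarrow> (\<lambda>n. share (\<sigma> n) i) \<longlonglongrightarrow> \<alpha> i"
proof -
  define F where "F n = {i. set i \<subseteq> {1..n} \<and> length i \<le> n}" for n :: nat
  have F: "F n \<in> ptrees" for n
    unfolding ptrees_iff F_def using finite_lists_length_le[of "{1..n}" n]
    by (auto simp: indivs_def)
  have "\<exists>\<sigma>\<in>ptrees. card \<sigma> \<ge> n \<and> (\<forall>i\<in>F n. \<bar>share \<sigma> i - \<alpha> i\<bar> < 1 / real (Suc n))" for n
    by (rule approximate_labels[OF assms F]) simp
  then obtain \<sigma> where \<sigma>: "\<And>n. \<sigma> n \<in> ptrees" "\<And>n. card (\<sigma> n) \<ge> n"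
    "\<And>n i. i \<in> F n \<Longrightarrow> \<bar>share (\<sigma> n) i - \<alpha> i\<bar> < 1 / real (Suc n)" by metis
  show ?thesis
  proof
    show "filterlim (\<lambda>n. card (\<sigma> n)) at_top sequentially"
      by (rule filterlim_at_top_mono[OF filterlim_ident]) (use \<sigma>(2) in auto)
    fix i assume i: "i \<in> indivs"
    let ?N = "max (length i) (Max (insert 0 (set i)))"
    have "i \<in> F n" if "n \<ge> ?N" for n
    proof -
      have "x \<le> n" if "x \<in> set i" for x
        using Max_ge[of "insert 0 (set i)" x] \<open>n \<ge> ?N\<close> that by simp
      then show ?thesis using that i by (auto simp: F_def indivs_def)
    qed
    then have "eventually (\<lambda>n. \<bar>share (\<sigma> n) i - \<alpha> i\<bar> \<le> 1 / real (Suc n)) sequentially"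
      using \<sigma>(3) by (auto simp: eventually_sequentially intro!: exI[of _ ?N] less_imp_le)
    then have "eventually (\<lambda>n. norm (share (\<sigma> n) i - \<alpha> i) \<le> inverse (real (Suc n))) sequentially"
      by (simp add: inverse_eq_divide)
    then have "(\<lambda>n. share (\<sigma> n) i - \<alpha> i) \<longlonglongrightarrow> 0"
      by (rule Lim_null_comparison[OF _ LIMSEQ_inverse_real_of_nat])
    then show "(\<lambda>n. share (\<sigma> n) i) \<longlonglongrightarrow> \<alpha> i" by (simp add: LIM_zero_iff)
  qed (rule \<sigma>(1))
qed

section \<open>The Martin boundary\<close>

locale martin_completion =
  fixes \<epsilon> :: "tree \<Rightarrow> real"
    and X :: "'b set" and D :: "'b \<Rightarrow> 'b \<Rightarrow> real" and emb :: "tree \<Rightarrow> 'b"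
  assumes eps_pos: "\<And>\<tau>. \<tau> \<in> ptrees \<Longrightarrow> \<epsilon> \<tau> > 0"
    and eps_summable: "\<epsilon> summable_on ptrees"
    and completion: "is_completion ptrees (martin_dist \<epsilon>) X D emb"
begin

sublocale Metric_space X D
  using completion by (simp add: is_completion_def)

lemma complete: mcomplete
  and emb_in: "\<sigma> \<in> ptrees \<Longrightarrow> emb \<sigma> \<in> X"
  and D_emb: "\<sigma> \<in> ptrees \<Longrightarrow> \<sigma>' \<in> ptrees \<Longrightarrow> D (emb \<sigma>) (emb \<sigma>') = martin_dist \<epsilon> \<sigma> \<sigma>'"
  and dense: "mtopology closure_of (emb ` ptrees) = X"
  using completion by (auto simp: is_completion_def)

section \<open>The Martin metric compared with kernels and levels\<close>

definition dist_term :: "tree \<Rightarrow> tree \<Rightarrow> tree \<Rightarrow> real" where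
  "dist_term \<sigma> \<sigma>' \<tau> = \<epsilon> \<tau> *
     (\<bar>martin_kernel \<tau> \<sigma> - martin_kernel \<tau> \<sigma>'\<bar>
      + \<bar>of_bool (\<tau> = \<sigma>) - of_bool (\<tau> = \<sigma>')\<bar>
      + \<bar>of_bool (level \<tau> = level \<sigma>) - of_bool (level \<tau> = level \<sigma>')\<bar>)
     / (martin_bound \<tau> + 1)"

lemma martin_dist_eq: "martin_dist \<epsilon> \<sigma> \<sigma>' = infsum (dist_term \<sigma> \<sigma>') ptrees"
  by (simp add: martin_dist_def dist_term_def[abs_def])

lemma martin_bound_nonneg: "martin_bound \<tau> \<ge> 0"
  by (simp add: martin_bound_def)

lemma dist_term_nonneg: "\<tau> \<in> ptrees \<Longrightarrow> dist_term \<sigma> \<sigma>' \<tau> \<ge> 0"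
  using eps_pos[of \<tau>] martin_bound_nonneg[of \<tau>] by (simp add: dist_term_def)

text \<open>The kernel difference is at most \<open>martin_bound \<tau>\<close>, each indicator
  difference at most 1, and \<open>C + 2 \<le> 2 * (C + 1)\<close>.\<close>

lemma dist_term_le:
  assumes "\<tau> \<in> ptrees" "\<sigma> \<in> ptrees" "\<sigma>' \<in> ptrees"
  shows "dist_term \<sigma> \<sigma>' \<tau> \<le> 2 * \<epsilon> \<tau>"
proof -
  let ?C = "martin_bound \<tau>"
  have C: "?C \<ge> 0" by (rule martin_bound_nonneg)
  have "\<bar>martin_kernel \<tau> \<sigma> - martin_kernel \<tau> \<sigma>'\<bar> \<le> ?C"
    using martin_kernel_le[OF assms(1,2)] martin_kernel_le[OF assms(1,3)]
      martin_kernel_nonneg[of \<tau> \<sigma>] martin_kernel_nonneg[of \<tau> \<sigma>'] by linarith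
  then have "\<bar>martin_kernel \<tau> \<sigma> - martin_kernel \<tau> \<sigma>'\<bar>
      + \<bar>of_bool (\<tau> = \<sigma>) - of_bool (\<tau> = \<sigma>')\<bar>
      + \<bar>of_bool (level \<tau> = level \<sigma>) - of_bool (level \<tau> = level \<sigma>')\<bar> \<le> 2 * (?C + 1)"
    using C by auto
  then have "dist_term \<sigma> \<sigma>' \<tau> \<le> \<epsilon> \<tau> * (2 * (?C + 1)) / (?C + 1)"
    unfolding dist_term_def using C eps_pos[OF assms(1)]
    by (intro divide_right_mono mult_left_mono) auto
  also have "\<dots> = 2 * \<epsilon> \<tau>" using C by (simp add: field_simps)
  finally show ?thesis .
qed

lemma dist_term_summable:
  assumes "\<sigma> \<in> ptrees" "\<sigma>' \<in> ptrees"
  shows "dist_term \<sigma> \<sigma>' summable_on ptrees"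
  by (rule summable_on_comparison_test[of "\<lambda>\<tau>. 2 * \<epsilon> \<tau>"])
     (use eps_summable dist_term_le dist_term_nonneg assms in \<open>auto intro: summable_on_cmult_right\<close>)

lemma dist_term_le_dist:
  assumes "\<tau> \<in> ptrees" "\<sigma> \<in> ptrees" "\<sigma>' \<in> ptrees"
  shows "dist_term \<sigma> \<sigma>' \<tau> \<le> martin_dist \<epsilon> \<sigma> \<sigma>'"
  using finite_sum_le_infsum[OF dist_term_summable[OF assms(2,3)], of "{\<tau>}"] assms dist_term_nonneg
  by (simp add: martin_dist_eq)

lemma kernel_diff_le_dist:
  assumes "\<tau> \<in> ptrees" "\<sigma> \<in> ptrees" "\<sigma>' \<in> ptrees"
  shows "\<bar>martin_kernel \<tau> \<sigma> - martin_kernel \<tau> \<sigma>'\<bar> \<le> (martin_bound \<tau> + 1) / \<epsilon> \<tau> * martin_dist \<epsilon> \<sigma> \<sigma>'"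
proof -
  have "\<epsilon> \<tau> * \<bar>martin_kernel \<tau> \<sigma> - martin_kernel \<tau> \<sigma>'\<bar> / (martin_bound \<tau> + 1) \<le> dist_term \<sigma> \<sigma>' \<tau>"
    unfolding dist_term_def using eps_pos[OF assms(1)] martin_bound_nonneg[of \<tau>]
    by (intro divide_right_mono mult_left_mono) auto
  also have "\<dots> \<le> martin_dist \<epsilon> \<sigma> \<sigma>'" by (rule dist_term_le_dist[OF assms])
  finally show ?thesis
    using eps_pos[OF assms(1)] martin_bound_nonneg[of \<tau>] by (simp add: field_simps)
qed

text \<open>Separates the level of \<open>\<tau>\<close> from all others by a gap that depends on
  \<open>\<tau>\<close> only. This keeps limits of growing trees out of the closures of the
  levels.\<close>

lemma level_diff_le_dist:
  assumes "\<tau> \<in> ptrees" "\<sigma> \<in> ptrees" "\<sigma>' \<in> ptrees" "level \<tau> = level \<sigma>" "level \<tau> \<noteq> level \<sigma>'"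
  shows "\<epsilon> \<tau> / (martin_bound \<tau> + 1) \<le> martin_dist \<epsilon> \<sigma> \<sigma>'"
proof -
  have "\<epsilon> \<tau> * 1 / (martin_bound \<tau> + 1) \<le> dist_term \<sigma> \<sigma>' \<tau>"
    unfolding dist_term_def using eps_pos[OF assms(1)] martin_bound_nonneg[of \<tau>] assms(4,5)
    by (intro divide_right_mono mult_left_mono) auto
  also have "\<dots> \<le> martin_dist \<epsilon> \<sigma> \<sigma>'" by (rule dist_term_le_dist[OF assms(1-3)])
  finally show ?thesis by simp
qed

text \<open>Conversely, finitely many kernels control the metric on trees of high level: on
  \<open>F\<close> the indicators vanish and the kernels contribute at most
  \<open>S * d \<le> e / 5\<close>; the tail of \<open>\<epsilon>\<close> outside \<open>F\<close>,
  doubled by \<open>dist_term_le\<close>, adds at most \<open>2 * (e / 5)\<close>.\<close>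

lemma martin_dist_small:
  assumes e: "e > 0"
  obtains F d where "finite F" "F \<subseteq> ptrees" "d > 0"
    "\<And>\<sigma> \<sigma>'. \<sigma> \<in> ptrees \<Longrightarrow> \<sigma>' \<in> ptrees \<Longrightarrow>
       (\<And>\<tau>. \<tau> \<in> F \<Longrightarrow> \<bar>martin_kernel \<tau> \<sigma> - martin_kernel \<tau> \<sigma>'\<bar> < d) \<Longrightarrow>
       (\<And>\<tau>. \<tau> \<in> F \<Longrightarrow> level \<tau> < level \<sigma> \<and> level \<tau> < level \<sigma>') \<Longrightarrow> martin_dist \<epsilon> \<sigma> \<sigma>' < e"
proof -
  obtain F where F: "finite F" "F \<subseteq> ptrees" "dist (sum \<epsilon> F) (infsum \<epsilon> ptrees) \<le> e / 5"
    using infsum_finite_approximation[OF eps_summable, of "e / 5"] e by auto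
  define S where "S = sum \<epsilon> F"
  have S: "S \<ge> 0" unfolding S_def using F(2) eps_pos by (intro sum_nonneg) (auto simp: less_imp_le)
  define d where "d = e / (5 * (S + 1))"
  have d: "d > 0" using e S by (simp add: d_def)
  show ?thesis
  proof (rule that[OF F(1,2) d])
    fix \<sigma> \<sigma>' assume \<sigma>: "\<sigma> \<in> ptrees" "\<sigma>' \<in> ptrees"
      and K: "\<And>\<tau>. \<tau> \<in> F \<Longrightarrow> \<bar>martin_kernel \<tau> \<sigma> - martin_kernel \<tau> \<sigma>'\<bar> < d"
      and L: "\<And>\<tau>. \<tau> \<in> F \<Longrightarrow> level \<tau> < level \<sigma> \<and> level \<tau> < level \<sigma>'"
    have F_le: "dist_term \<sigma> \<sigma>' \<tau> \<le> \<epsilon> \<tau> * d" if "\<tau> \<in> F" for \<tau>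
    proof -
      have \<tau>: "\<tau> \<in> ptrees" "\<tau> \<noteq> \<sigma>" "\<tau> \<noteq> \<sigma>'" "level \<tau> \<noteq> level \<sigma>" "level \<tau> \<noteq> level \<sigma>'"
        using that F(2) L[OF that] by auto
      have "dist_term \<sigma> \<sigma>' \<tau> = \<epsilon> \<tau> * \<bar>martin_kernel \<tau> \<sigma> - martin_kernel \<tau> \<sigma>'\<bar> / (martin_bound \<tau> + 1)"
        using \<tau> by (simp add: dist_term_def)
      also have "\<dots> \<le> \<epsilon> \<tau> * d / (martin_bound \<tau> + 1)"
        using K[OF that] eps_pos[OF \<tau>(1)] martin_bound_nonneg[of \<tau>]
        by (intro divide_right_mono mult_left_mono) auto
      also have "\<dots> \<le> \<epsilon> \<tau> * d / 1"
        using d eps_pos[OF \<tau>(1)] martin_bound_nonneg[of \<tau>] by (intro divide_left_mono) auto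
      finally show ?thesis by simp
    qed
    have h1: "((\<lambda>\<tau>. 2 * \<epsilon> \<tau>) has_sum 2 * (infsum \<epsilon> ptrees - S)) (ptrees - F)"
      unfolding S_def
      by (intro has_sum_cmult_right has_sum_Diff has_sum_infsum has_sum_finiteI[OF F(1)] F(2) eps_summable refl)
    have h2: "(dist_term \<sigma> \<sigma>' has_sum martin_dist \<epsilon> \<sigma> \<sigma>' - sum (dist_term \<sigma> \<sigma>') F) (ptrees - F)"
      unfolding martin_dist_eq
      by (intro has_sum_Diff has_sum_infsum has_sum_finiteI[OF F(1)] F(2) dist_term_summable \<sigma> refl)
    have "martin_dist \<epsilon> \<sigma> \<sigma>' - sum (dist_term \<sigma> \<sigma>') F \<le> 2 * (infsum \<epsilon> ptrees - S)"
      by (rule has_sum_mono[OF h2 h1]) (use dist_term_le \<sigma> in auto)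
    also have "\<dots> \<le> 2 * (e / 5)" using abs_le_D2[OF F(3)[unfolded dist_real_def]] by (simp add: S_def)
    finally have "martin_dist \<epsilon> \<sigma> \<sigma>' \<le> sum (dist_term \<sigma> \<sigma>') F + 2 * (e / 5)" by simp
    also have "sum (dist_term \<sigma> \<sigma>') F \<le> S * d"
      unfolding S_def sum_distrib_right using F_le by (rule sum_mono)
    also have "S * d \<le> e / 5" using S e by (simp add: d_def field_simps)
    finally show "martin_dist \<epsilon> \<sigma> \<sigma>' < e" using e by simp
  qed
qed

lemma converges_iff:
  assumes "\<And>n. \<sigma> n \<in> ptrees"
  shows "converges_to X D emb \<sigma> \<zeta> \<longleftrightarrow> \<zeta> \<in> X \<and> (\<lambda>n. D (emb (\<sigma> n)) \<zeta>) \<longlonglongrightarrow> 0"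
  using assms emb_in by (simp add: converges_to_def limitin_metric_dist_null)

lemma converges_approx:
  assumes "\<zeta> \<in> X"
  obtains \<sigma> where "\<And>n. \<sigma> n \<in> ptrees" "converges_to X D emb \<sigma> \<zeta>"
proof -
  have "\<exists>\<sigma>\<in>ptrees. D (emb \<sigma>) \<zeta> < inverse (real (Suc n))" for n
  proof -
    have "\<zeta> \<in> mtopology closure_of (emb ` ptrees)" using assms dense by simp
    then have "\<forall>r>0. \<exists>y\<in>emb ` ptrees. y \<in> mball \<zeta> r" unfolding metric_closure_of by blast
    then have "\<exists>y\<in>emb ` ptrees. y \<in> mball \<zeta> (inverse (real (Suc n)))"
      using inverse_Suc by blast
    then show ?thesis by (auto simp: commute)
  qed
  then obtain \<sigma> where \<sigma>: "\<And>n. \<sigma> n \<in> ptrees" "\<And>n. D (emb (\<sigma> n)) \<zeta> < inverse (real (Suc n))" by metis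
  have "(\<lambda>n. D (emb (\<sigma> n)) \<zeta>) \<longlonglongrightarrow> 0"
    by (rule Lim_null_comparison[OF _ LIMSEQ_inverse_real_of_nat], rule always_eventually)
       (use \<sigma>(2) in \<open>simp add: less_imp_le del: of_nat_Suc\<close>)
  then show ?thesis using that \<sigma>(1) converges_iff[of \<sigma>] assms by blast
qed

lemma converges_dist:
  assumes "\<And>n. \<sigma> n \<in> ptrees" "\<And>n. \<sigma>' n \<in> ptrees"
    and "converges_to X D emb \<sigma> \<zeta>" "converges_to X D emb \<sigma>' \<zeta>'"
  shows "(\<lambda>n. martin_dist \<epsilon> (\<sigma> n) (\<sigma>' n)) \<longlonglongrightarrow> D \<zeta> \<zeta>'"
proof -
  have c: "\<zeta> \<in> X" "(\<lambda>n. D (emb (\<sigma> n)) \<zeta>) \<longlonglongrightarrow> 0" "\<zeta>' \<in> X" "(\<lambda>n. D (emb (\<sigma>' n)) \<zeta>') \<longlonglongrightarrow> 0"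
    using converges_iff[of \<sigma> \<zeta>] converges_iff[of \<sigma>' \<zeta>'] assms by auto
  have "(\<lambda>n. D (emb (\<sigma> n)) \<zeta> + D (emb (\<sigma>' n)) \<zeta>') \<longlonglongrightarrow> 0 + 0" by (intro tendsto_add c)
  then have lim: "(\<lambda>n. D (emb (\<sigma> n)) \<zeta> + D (emb (\<sigma>' n)) \<zeta>') \<longlonglongrightarrow> 0" by simp
  have diff: "\<bar>martin_dist \<epsilon> (\<sigma> n) (\<sigma>' n) - D \<zeta> \<zeta>'\<bar> \<le> D (emb (\<sigma> n)) \<zeta> + D (emb (\<sigma>' n)) \<zeta>'" for n
  proof -
    note e = emb_in[OF assms(1), of n] emb_in[OF assms(2), of n]
    have "D (emb (\<sigma> n)) (emb (\<sigma>' n)) \<le> D (emb (\<sigma> n)) \<zeta> + D \<zeta> (emb (\<sigma>' n))"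
      "D \<zeta> (emb (\<sigma>' n)) \<le> D \<zeta> \<zeta>' + D \<zeta>' (emb (\<sigma>' n))"
      "D \<zeta> \<zeta>' \<le> D \<zeta> (emb (\<sigma> n)) + D (emb (\<sigma> n)) \<zeta>'"
      "D (emb (\<sigma> n)) \<zeta>' \<le> D (emb (\<sigma> n)) (emb (\<sigma>' n)) + D (emb (\<sigma>' n)) \<zeta>'"
      using e c by (auto intro: triangle)
    then show ?thesis
      using D_emb[OF assms(1,2), of n n] commute[of \<zeta> "emb (\<sigma> n)"] commute[of \<zeta>' "emb (\<sigma>' n)"] by linarith
  qed
  have "(\<lambda>n. martin_dist \<epsilon> (\<sigma> n) (\<sigma>' n) - D \<zeta> \<zeta>') \<longlonglongrightarrow> 0"
    by (rule Lim_null_comparison[OF _ lim]) (simp add: diff)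
  then show ?thesis by (simp add: LIM_zero_iff)
qed

lemma converges_kernel:
  assumes \<sigma>: "\<And>n. \<sigma> n \<in> ptrees" and "converges_to X D emb \<sigma> \<zeta>" "\<tau> \<in> ptrees"
  shows "convergent (\<lambda>n. martin_kernel \<tau> (\<sigma> n))"
proof -
  define c where "c = (martin_bound \<tau> + 1) / \<epsilon> \<tau>"
  have c: "c > 0" using eps_pos[OF assms(3)] martin_bound_nonneg[of \<tau>] by (simp add: c_def)
  have "MCauchy (\<lambda>n. emb (\<sigma> n))"
    using assms(2) emb_in[OF \<sigma>]
    by (intro convergent_imp_MCauchy[of _ \<zeta>]) (auto simp: converges_to_def)
  then have cau: "\<exists>N. \<forall>n n'. N \<le> n \<longrightarrow> N \<le> n' \<longrightarrow> martin_dist \<epsilon> (\<sigma> n) (\<sigma> n') < e" if "e > 0" for e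
    using that D_emb[OF \<sigma> \<sigma>] by (simp add: MCauchy_def)
  have "Cauchy (\<lambda>n. martin_kernel \<tau> (\<sigma> n))"
  proof (rule metric_CauchyI)
    fix e :: real assume "e > 0"
    then obtain N where N: "\<And>n n'. N \<le> n \<Longrightarrow> N \<le> n' \<Longrightarrow> martin_dist \<epsilon> (\<sigma> n) (\<sigma> n') < e / c"
      using cau[of "e / c"] c by auto
    have "dist (martin_kernel \<tau> (\<sigma> n)) (martin_kernel \<tau> (\<sigma> n')) < e" if "n \<ge> N" "n' \<ge> N" for n n'
    proof -
      have "c * martin_dist \<epsilon> (\<sigma> n) (\<sigma> n') < c * (e / c)"
        using N[OF that] c by (intro mult_strict_left_mono)
      then show ?thesis
        using kernel_diff_le_dist[OF assms(3) \<sigma> \<sigma>, of n n'] c unfolding c_def[symmetric] dist_real_def by simp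
    qed
    then show "\<exists>N. \<forall>n\<ge>N. \<forall>n'\<ge>N. dist (martin_kernel \<tau> (\<sigma> n)) (martin_kernel \<tau> (\<sigma> n')) < e" by blast
  qed
  then show ?thesis by (simp add: Cauchy_convergent_iff)
qed

section \<open>Boundary points as limits of growing trees\<close>

lemma card_eq_Suc_level: "\<sigma> \<in> ptrees \<Longrightarrow> card \<sigma> = Suc (level \<sigma>)"
  using ptrees_card_pos[of \<sigma>] by (simp add: level_def)

lemma eventually_level_less:
  assumes "\<And>n. \<sigma> n \<in> ptrees" "filterlim (\<lambda>n. card (\<sigma> n)) at_top sequentially"
  shows "eventually (\<lambda>n. level \<tau> < level (\<sigma> n)) sequentially"
  using eventually_compose_filterlim[OF eventually_gt_at_top[of "Suc (level \<tau>)"] assms(2)]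
  by eventually_elim (use card_eq_Suc_level[OF assms(1)] in simp)

text \<open>A size occurring infinitely often would place \<open>\<zeta>\<close> in the closure of
  that level, so every size occurs only finitely often.\<close>

lemma boundary_card_at_top:
  assumes \<zeta>: "\<zeta> \<in> martin_boundary X D emb" and \<sigma>: "\<And>n. \<sigma> n \<in> ptrees" "converges_to X D emb \<sigma> \<zeta>"
  shows "filterlim (\<lambda>n. card (\<sigma> n)) at_top sequentially"
proof -
  have ne: "eventually (\<lambda>n. card (\<sigma> n) \<noteq> Suc m) sequentially" for m
  proof (rule ccontr)
    assume "\<not> ?thesis"
    then have freq: "\<exists>n\<ge>N. card (\<sigma> n) = Suc m" for N
      by (auto simp: eventually_sequentially)
    have "\<zeta> \<in> mtopology closure_of (emb ` trees_of_size (Suc m))"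
      unfolding metric_closure_of
    proof (intro CollectI conjI allI impI)
      show \<zeta>X: "\<zeta> \<in> X" using \<zeta> by (simp add: martin_boundary_def)
      fix r :: real assume "r > 0"
      have "(\<lambda>n. D (emb (\<sigma> n)) \<zeta>) \<longlonglongrightarrow> 0" using converges_iff[of \<sigma>, OF \<sigma>(1)] \<sigma>(2) by blast
      then have "eventually (\<lambda>n. D (emb (\<sigma> n)) \<zeta> < r) sequentially"
        using \<open>r > 0\<close> by (rule order_tendstoD(2))
      then obtain N where N: "\<And>n. n \<ge> N \<Longrightarrow> D (emb (\<sigma> n)) \<zeta> < r"
        unfolding eventually_sequentially by blast
      obtain n where n: "n \<ge> N" "card (\<sigma> n) = Suc m" using freq by blast
      then have "emb (\<sigma> n) \<in> emb ` trees_of_size (Suc m)" using \<sigma>(1) by (simp add: trees_of_size_eq)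
      moreover have "emb (\<sigma> n) \<in> mball \<zeta> r"
        using N[OF n(1)] \<zeta>X emb_in[OF \<sigma>(1)] by (simp add: commute)
      ultimately show "\<exists>y\<in>emb ` trees_of_size (Suc m). y \<in> mball \<zeta> r" by blast
    qed
    then show False using \<zeta> by (auto simp: martin_boundary_def)
  qed
  show ?thesis
    unfolding filterlim_at_top
  proof
    fix m
    have "eventually (\<lambda>n. \<forall>k\<in>{..<m}. card (\<sigma> n) \<noteq> Suc k) sequentially"
      using ne by (intro eventually_ball_finite) auto
    then show "eventually (\<lambda>n. m \<le> card (\<sigma> n)) sequentially"
    proof eventually_elim
      case (elim n)
      then show ?case using card_eq_Suc_level[OF \<sigma>(1), of n] by (cases "level (\<sigma> n) < m") auto
    qed
  qed
qed

text \<open>Convergent kernels and growing levels make the sequence Cauchy by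
  \<open>martin_dist_small\<close>. The gap of \<open>level_diff_le_dist\<close> keeps the limit out
  of the closure of each level.\<close>

lemma boundary_point_exists:
  assumes \<sigma>: "\<And>n. \<sigma> n \<in> ptrees" and lim: "filterlim (\<lambda>n. card (\<sigma> n)) at_top sequentially"
    and K: "\<And>\<tau>. \<tau> \<in> ptrees \<Longrightarrow> convergent (\<lambda>n. martin_kernel \<tau> (\<sigma> n))"
  obtains \<zeta> where "\<zeta> \<in> martin_boundary X D emb" "converges_to X D emb \<sigma> \<zeta>"
proof -
  note lev = eventually_level_less[of \<sigma>, OF \<sigma> lim]
  have "MCauchy (\<lambda>n. emb (\<sigma> n))"
    unfolding MCauchy_def
  proof (intro conjI allI impI)
    show "range (\<lambda>n. emb (\<sigma> n)) \<subseteq> X" using emb_in \<sigma> by auto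
    fix e :: real assume "e > 0"
    then obtain F d where F: "finite F" "F \<subseteq> ptrees" "d > 0" and
      small: "\<And>\<sigma> \<sigma>'. \<sigma> \<in> ptrees \<Longrightarrow> \<sigma>' \<in> ptrees \<Longrightarrow>
       (\<And>\<tau>. \<tau> \<in> F \<Longrightarrow> \<bar>martin_kernel \<tau> \<sigma> - martin_kernel \<tau> \<sigma>'\<bar> < d) \<Longrightarrow>
       (\<And>\<tau>. \<tau> \<in> F \<Longrightarrow> level \<tau> < level \<sigma> \<and> level \<tau> < level \<sigma>') \<Longrightarrow> martin_dist \<epsilon> \<sigma> \<sigma>' < e"
      using martin_dist_small by metis
    have "\<exists>L. (\<lambda>n. martin_kernel \<tau> (\<sigma> n)) \<longlonglongrightarrow> L" if "\<tau> \<in> F" for \<tau>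
      using K that F(2) by (auto simp: convergent_def)
    then obtain L where L: "\<And>\<tau>. \<tau> \<in> F \<Longrightarrow> (\<lambda>n. martin_kernel \<tau> (\<sigma> n)) \<longlonglongrightarrow> L \<tau>" by metis
    have "eventually (\<lambda>n. \<forall>\<tau>\<in>F. \<bar>martin_kernel \<tau> (\<sigma> n) - L \<tau>\<bar> < d / 2 \<and> level \<tau> < level (\<sigma> n)) sequentially"
    proof (intro eventually_ball_finite F(1) ballI eventually_conj lev)
      fix \<tau> assume "\<tau> \<in> F"
      then show "eventually (\<lambda>n. \<bar>martin_kernel \<tau> (\<sigma> n) - L \<tau>\<bar> < d / 2) sequentially"
        using tendstoD[OF L, of \<tau> "d / 2"] F(3) by (simp add: dist_real_def)
    qed
    then obtain N where N: "\<And>n \<tau>. n \<ge> N \<Longrightarrow> \<tau> \<in> F \<Longrightarrow>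
        \<bar>martin_kernel \<tau> (\<sigma> n) - L \<tau>\<bar> < d / 2 \<and> level \<tau> < level (\<sigma> n)"
      unfolding eventually_sequentially by blast
    have "martin_dist \<epsilon> (\<sigma> n) (\<sigma> n') < e" if n: "N \<le> n" "N \<le> n'" for n n'
    proof (rule small[OF \<sigma> \<sigma>])
      fix \<tau> assume "\<tau> \<in> F"
      then show "\<bar>martin_kernel \<tau> (\<sigma> n) - martin_kernel \<tau> (\<sigma> n')\<bar> < d"
        "level \<tau> < level (\<sigma> n) \<and> level \<tau> < level (\<sigma> n')"
        using N[OF n(1)] N[OF n(2)] by (smt (verit) field_sum_of_halves)+
    qed
    then show "\<exists>N. \<forall>n n'. N \<le> n \<longrightarrow> N \<le> n' \<longrightarrow> D (emb (\<sigma> n)) (emb (\<sigma> n')) < e"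
      using D_emb[OF \<sigma> \<sigma>] by auto
  qed
  then obtain \<zeta> where \<zeta>: "converges_to X D emb \<sigma> \<zeta>"
    using complete by (auto simp: mcomplete_def converges_to_def)
  then have \<zeta>X: "\<zeta> \<in> X" "(\<lambda>n. D (emb (\<sigma> n)) \<zeta>) \<longlonglongrightarrow> 0" using converges_iff[of \<sigma>, OF \<sigma>] by auto
  have "\<zeta> \<notin> mtopology closure_of (emb ` trees_of_size (Suc m))" for m
  proof
    assume "\<zeta> \<in> mtopology closure_of (emb ` trees_of_size (Suc m))"
    then have clo: "\<exists>\<tau>\<in>trees_of_size (Suc m). D (emb \<tau>) \<zeta> < r" if "r > 0" for r
      unfolding metric_closure_of using that by (auto simp: commute)
    obtain \<tau> where \<tau>: "\<tau> \<in> ptrees" "card \<tau> = Suc m"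
      using clo[of 1] by (auto simp: trees_of_size_eq)
    define r where "r = \<epsilon> \<tau> / (martin_bound \<tau> + 1)"
    have r: "r > 0" using eps_pos[OF \<tau>(1)] martin_bound_nonneg[of \<tau>] by (simp add: r_def)
    obtain \<sigma>' where \<sigma>': "\<sigma>' \<in> ptrees" "card \<sigma>' = Suc m" "D (emb \<sigma>') \<zeta> < r / 2"
      using clo[of "r / 2"] r by (auto simp: trees_of_size_eq)
    have "eventually (\<lambda>n. D (emb (\<sigma> n)) \<zeta> < r / 2 \<and> level \<tau> < level (\<sigma> n)) sequentially"
      using r by (intro eventually_conj lev order_tendstoD(2)[OF \<zeta>X(2)]) auto
    then obtain n where n: "D (emb (\<sigma> n)) \<zeta> < r / 2" "level \<tau> < level (\<sigma> n)"
      unfolding eventually_sequentially by blast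
    have "r \<le> martin_dist \<epsilon> \<sigma>' (\<sigma> n)"
      unfolding r_def using \<tau> \<sigma>' n by (intro level_diff_le_dist \<sigma>) (auto simp: level_def)
    also have "\<dots> = D (emb \<sigma>') (emb (\<sigma> n))" using D_emb \<sigma>'(1) \<sigma> by simp
    also have "\<dots> \<le> D (emb \<sigma>') \<zeta> + D \<zeta> (emb (\<sigma> n))"
      using emb_in \<sigma>'(1) \<sigma> \<zeta>X by (intro triangle) auto
    also have "\<dots> < r" using \<sigma>'(3) n(1) by (simp add: commute)
    finally show False by simp
  qed
  then have "\<zeta> \<in> martin_boundary X D emb" using \<zeta>X by (auto simp: martin_boundary_def)
  then show ?thesis using that \<zeta> by blast
qed

text \<open>Quantifying over all approximating sequences makes the label depend on the point
  alone.\<close>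

definition is_label :: "'b \<Rightarrow> (indiv \<Rightarrow> real) \<Rightarrow> bool" where
  "is_label \<zeta> \<alpha> \<longleftrightarrow> \<alpha> \<in> indivs \<rightarrow>\<^sub>E {0..1} \<and>
     (\<forall>\<sigma>. (\<forall>n. \<sigma> n \<in> ptrees) \<and> converges_to X D emb \<sigma> \<zeta> \<longrightarrow>
       (\<forall>i\<in>indivs. (\<lambda>n. share (\<sigma> n) i) \<longlonglongrightarrow> \<alpha> i))"

lemma boundary_in_X: "\<zeta> \<in> martin_boundary X D emb \<Longrightarrow> \<zeta> \<in> X"
  by (simp add: martin_boundary_def)

lemma boundary_share_convergent:
  assumes "\<zeta> \<in> martin_boundary X D emb" "\<And>n. \<sigma> n \<in> ptrees" "converges_to X D emb \<sigma> \<zeta>" "i \<in> indivs"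
  shows "convergent (\<lambda>n. share (\<sigma> n) i)"
  by (rule share_convergent[OF assms(2) boundary_card_at_top[OF assms(1-3)] _ assms(4)])
     (use converges_kernel[OF assms(2,3)] in blast)

text \<open>Interleaving two sequences with the same limit shows that their shares have the same limit.\<close>

lemma is_label_exists:
  assumes \<zeta>: "\<zeta> \<in> martin_boundary X D emb"
  shows "\<exists>\<alpha>. is_label \<zeta> \<alpha>"
proof -
  obtain \<sigma> where \<sigma>: "\<And>n. \<sigma> n \<in> ptrees" "converges_to X D emb \<sigma> \<zeta>"
    using converges_approx[OF boundary_in_X[OF \<zeta>]] by blast
  have "\<exists>a. (\<lambda>n. share (\<sigma> n) i) \<longlonglongrightarrow> a" if "i \<in> indivs" for i
    using boundary_share_convergent[of \<zeta> \<sigma>, OF \<zeta> \<sigma> that] by (simp add: convergent_def)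
  then obtain a where a: "\<And>i. i \<in> indivs \<Longrightarrow> (\<lambda>n. share (\<sigma> n) i) \<longlonglongrightarrow> a i" by metis
  define \<alpha> where "\<alpha> = restrict a indivs"
  have "0 \<le> a i" "a i \<le> 1" if "i \<in> indivs" for i
    using LIMSEQ_le_const[OF a[OF that]] LIMSEQ_le_const2[OF a[OF that]] share_nonneg share_le_1 \<sigma>(1)
    by blast+
  then have "\<alpha> \<in> indivs \<rightarrow>\<^sub>E {0..1}" by (auto simp: \<alpha>_def)
  moreover have "(\<lambda>n. share (\<sigma>' n) i) \<longlonglongrightarrow> \<alpha> i"
    if \<sigma>': "\<And>n. \<sigma>' n \<in> ptrees" "converges_to X D emb \<sigma>' \<zeta>" and i: "i \<in> indivs" for \<sigma>' i
  proof -
    define \<rho> where "\<rho> n = (if even n then \<sigma> (n div 2) else \<sigma>' (n div 2))" for n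
    have \<rho>: "\<rho> n \<in> ptrees" for n using \<sigma> \<sigma>' by (simp add: \<rho>_def)
    have "(\<lambda>n. D (emb (\<rho> n)) \<zeta>) \<longlonglongrightarrow> 0"
    proof (rule limseq_even_odd)
      show "(\<lambda>n. D (emb (\<rho> (2 * n))) \<zeta>) \<longlonglongrightarrow> 0" "(\<lambda>n. D (emb (\<rho> (2 * n + 1))) \<zeta>) \<longlonglongrightarrow> 0"
        using \<sigma> \<sigma>' converges_iff by (auto simp: \<rho>_def)
    qed
    then have "converges_to X D emb \<rho> \<zeta>" using converges_iff[of \<rho>] \<rho> boundary_in_X[OF \<zeta>] by blast
    then obtain L where L: "(\<lambda>n. share (\<rho> n) i) \<longlonglongrightarrow> L"
      using boundary_share_convergent[of \<zeta> \<rho>, OF \<zeta> \<rho> _ i] by (auto simp: convergent_def)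
    have "(\<lambda>n. share (\<rho> (2 * n)) i) \<longlonglongrightarrow> L"
      by (rule filterlim_compose[OF L]) (auto intro!: filterlim_subseq simp: strict_mono_def)
    then have "L = a i" using a[OF i] by (simp add: \<rho>_def LIMSEQ_unique)
    moreover have "(\<lambda>n. share (\<rho> (2 * n + 1)) i) \<longlonglongrightarrow> L"
      by (rule filterlim_compose[OF L]) (auto intro!: filterlim_subseq simp: strict_mono_def)
    ultimately show ?thesis using i by (simp add: \<rho>_def \<alpha>_def)
  qed
  ultimately show ?thesis unfolding is_label_def by blast
qed

definition label_of :: "'b \<Rightarrow> indiv \<Rightarrow> real" where
  "label_of \<zeta> = (SOME \<alpha>. is_label \<zeta> \<alpha>)"

lemma is_label_label_of: "\<zeta> \<in> martin_boundary X D emb \<Longrightarrow> is_label \<zeta> (label_of \<zeta>)"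
  unfolding label_of_def by (rule someI_ex[OF is_label_exists])

lemma label_of_range: "\<zeta> \<in> martin_boundary X D emb \<Longrightarrow> label_of \<zeta> \<in> indivs \<rightarrow>\<^sub>E {0..1}"
  using is_label_label_of by (simp add: is_label_def)

lemma label_of_tendsto:
  assumes "\<zeta> \<in> martin_boundary X D emb" "\<And>n. \<sigma> n \<in> ptrees" "converges_to X D emb \<sigma> \<zeta>" "i \<in> indivs"
  shows "(\<lambda>n. share (\<sigma> n) i) \<longlonglongrightarrow> label_of \<zeta> i"
  using is_label_label_of[OF assms(1)] assms(2-4) by (auto simp: is_label_def)

lemma boundary_kernel_tendsto:
  assumes "\<zeta> \<in> martin_boundary X D emb" "\<And>n. \<sigma> n \<in> ptrees" "converges_to X D emb \<sigma> \<zeta>" "\<tau> \<in> ptrees"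
  shows "(\<lambda>n. martin_kernel \<tau> (\<sigma> n)) \<longlonglongrightarrow> label_fun (label_of \<zeta>) \<tau>"
  using martin_kernel_tendsto[of \<sigma> \<tau> "label_of \<zeta>", OF assms(2) boundary_card_at_top[OF assms(1-3)] assms(4)]
    label_of_tendsto[OF assms(1-3)] ptrees_indivs[OF assms(4)] assms(4)
  by (auto simp: label_fun_def)

lemma boundary_fun_eq:
  assumes \<zeta>: "\<zeta> \<in> martin_boundary X D emb"
  shows "boundary_fun X D emb \<zeta> = label_fun (label_of \<zeta>)"
proof -
  obtain \<sigma> where \<sigma>: "\<And>n. \<sigma> n \<in> ptrees" "converges_to X D emb \<sigma> \<zeta>"
    using converges_approx[OF boundary_in_X[OF \<zeta>]] by blast
  have "(THE c. \<forall>\<sigma>. (\<forall>n. \<sigma> n \<in> ptrees) \<and> converges_to X D emb \<sigma> \<zeta> \<longrightarrow>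
       (\<lambda>n. martin_kernel \<tau> (\<sigma> n)) \<longlonglongrightarrow> c) = label_fun (label_of \<zeta>) \<tau>" if \<tau>: "\<tau> \<in> ptrees" for \<tau>
  proof (rule the_equality)
    show "\<forall>\<sigma>. (\<forall>n. \<sigma> n \<in> ptrees) \<and> converges_to X D emb \<sigma> \<zeta> \<longrightarrow>
       (\<lambda>n. martin_kernel \<tau> (\<sigma> n)) \<longlonglongrightarrow> label_fun (label_of \<zeta>) \<tau>"
      using boundary_kernel_tendsto[OF \<zeta> _ _ \<tau>] by blast
    fix c assume "\<forall>\<sigma>. (\<forall>n. \<sigma> n \<in> ptrees) \<and> converges_to X D emb \<sigma> \<zeta> \<longrightarrow>
       (\<lambda>n. martin_kernel \<tau> (\<sigma> n)) \<longlonglongrightarrow> c"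
    then show "c = label_fun (label_of \<zeta>) \<tau>"
      using \<sigma> boundary_kernel_tendsto[OF \<zeta> \<sigma> \<tau>] LIMSEQ_unique by blast
  qed
  then show ?thesis by (auto simp: boundary_fun_def label_fun_def fun_eq_iff)
qed

text \<open>Equal labels give equal limits of all kernels, and by \<open>martin_dist_small\<close>
  the approximating sequences then come arbitrarily close. This covers also the points at which mass
  has escaped.\<close>

lemma inj_on_label_of: "inj_on label_of (martin_boundary X D emb)"
proof (rule inj_onI)
  fix \<zeta> \<zeta>' assume \<zeta>: "\<zeta> \<in> martin_boundary X D emb" "\<zeta>' \<in> martin_boundary X D emb"
    and eq: "label_of \<zeta> = label_of \<zeta>'"
  obtain \<sigma> where \<sigma>: "\<And>n. \<sigma> n \<in> ptrees" "converges_to X D emb \<sigma> \<zeta>"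
    using converges_approx[OF boundary_in_X[OF \<zeta>(1)]] by blast
  obtain \<sigma>' where \<sigma>': "\<And>n. \<sigma>' n \<in> ptrees" "converges_to X D emb \<sigma>' \<zeta>'"
    using converges_approx[OF boundary_in_X[OF \<zeta>(2)]] by blast
  have lim: "(\<lambda>n. martin_dist \<epsilon> (\<sigma> n) (\<sigma>' n)) \<longlonglongrightarrow> D \<zeta> \<zeta>'"
    by (rule converges_dist[OF \<sigma>(1) \<sigma>'(1) \<sigma>(2) \<sigma>'(2)])
  have "D \<zeta> \<zeta>' \<le> e" if e: "e > 0" for e
  proof -
    obtain F d where F: "finite F" "F \<subseteq> ptrees" "d > 0" and
      small: "\<And>\<sigma> \<sigma>'. \<sigma> \<in> ptrees \<Longrightarrow> \<sigma>' \<in> ptrees \<Longrightarrow>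
       (\<And>\<tau>. \<tau> \<in> F \<Longrightarrow> \<bar>martin_kernel \<tau> \<sigma> - martin_kernel \<tau> \<sigma>'\<bar> < d) \<Longrightarrow>
       (\<And>\<tau>. \<tau> \<in> F \<Longrightarrow> level \<tau> < level \<sigma> \<and> level \<tau> < level \<sigma>') \<Longrightarrow> martin_dist \<epsilon> \<sigma> \<sigma>' < e"
      using martin_dist_small[OF e] by metis
    have "eventually (\<lambda>n. \<forall>\<tau>\<in>F. \<bar>martin_kernel \<tau> (\<sigma> n) - martin_kernel \<tau> (\<sigma>' n)\<bar> < d \<and>
        level \<tau> < level (\<sigma> n) \<and> level \<tau> < level (\<sigma>' n)) sequentially"
    proof (intro eventually_ball_finite F(1) ballI eventually_conj)
      fix \<tau> assume \<tau>: "\<tau> \<in> F"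
      have "(\<lambda>n. martin_kernel \<tau> (\<sigma> n) - martin_kernel \<tau> (\<sigma>' n)) \<longlonglongrightarrow>
          label_fun (label_of \<zeta>) \<tau> - label_fun (label_of \<zeta>') \<tau>"
        using \<tau> F(2) by (intro tendsto_diff boundary_kernel_tendsto \<zeta> \<sigma> \<sigma>') auto
      then have "(\<lambda>n. martin_kernel \<tau> (\<sigma> n) - martin_kernel \<tau> (\<sigma>' n)) \<longlonglongrightarrow> 0" using eq by simp
      then show "eventually (\<lambda>n. \<bar>martin_kernel \<tau> (\<sigma> n) - martin_kernel \<tau> (\<sigma>' n)\<bar> < d) sequentially"
        using F(3) by (auto dest!: tendstoD[of _ _ _ d] simp: dist_real_def)
    qed (intro eventually_level_less boundary_card_at_top[OF \<zeta>(1) \<sigma>] boundary_card_at_top[OF \<zeta>(2) \<sigma>'] \<sigma> \<sigma>')+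
    then have "eventually (\<lambda>n. martin_dist \<epsilon> (\<sigma> n) (\<sigma>' n) \<le> e) sequentially"
      by eventually_elim (rule less_imp_le, rule small, use \<sigma> \<sigma>' in auto)
    then show ?thesis by (rule tendsto_upperbound[OF lim]) simp
  qed
  then have "D \<zeta> \<zeta>' \<le> 0" by (rule field_le_epsilon[of _ 0, simplified])
  then show "\<zeta> = \<zeta>'"
    using nonneg[of \<zeta> \<zeta>'] zero boundary_in_X \<zeta> by (metis order_antisym)
qed

text \<open>Shares decrease with depth, and so do their limits. This supplies the condition on
  vanishing labels in \<open>labels_of_harmonic\<close>.\<close>

lemma label_of_zero:
  assumes \<zeta>: "\<zeta> \<in> martin_boundary X D emb" and i: "i \<in> indivs" "j \<ge> 1" "label_of \<zeta> i = 0"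
  shows "label_of \<zeta> (i @ [j]) = 0"
proof -
  obtain \<sigma> where \<sigma>: "\<And>n. \<sigma> n \<in> ptrees" "converges_to X D emb \<sigma> \<zeta>"
    using converges_approx[OF boundary_in_X[OF \<zeta>]] by blast
  have ij: "i @ [j] \<in> indivs" using i by simp
  have "label_of \<zeta> (i @ [j]) \<le> label_of \<zeta> i"
    by (rule LIMSEQ_le[OF label_of_tendsto[OF \<zeta> \<sigma> ij] label_of_tendsto[OF \<zeta> \<sigma> i(1)]])
       (use share_mono[OF \<sigma>(1)] in auto)
  moreover have "label_of \<zeta> (i @ [j]) \<ge> 0" using label_of_range[OF \<zeta>] ij by (auto simp: PiE_def Pi_def)
  ultimately show ?thesis using i(3) by simp
qed

lemma label_of_Nil:
  assumes \<zeta>: "\<zeta> \<in> martin_boundary X D emb"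
  shows "label_of \<zeta> [] = 1"
proof -
  obtain \<sigma> where \<sigma>: "\<And>n. \<sigma> n \<in> ptrees" "converges_to X D emb \<sigma> \<zeta>"
    using converges_approx[OF boundary_in_X[OF \<zeta>]] by blast
  have "(\<lambda>n. share (\<sigma> n) []) \<longlonglongrightarrow> label_of \<zeta> []" by (rule label_of_tendsto[OF \<zeta> \<sigma>]) simp
  then show ?thesis using \<sigma>(1) by (simp add: share_Nil LIMSEQ_const_iff)
qed

text \<open>Harmonicity of the kernel function becomes the sum rule for labels by
  \<open>labels_of_harmonic\<close>; conversely the trees of \<open>labels_approximable\<close>
  converge to a boundary point with the prescribed labels.\<close>

lemma bij_betw_label_of: "bij_betw label_of (harmonic_boundary X D emb) labels"
  unfolding bij_betw_def
proof (intro conjI equalityI subsetI)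
  have sub: "harmonic_boundary X D emb \<subseteq> martin_boundary X D emb" by (auto simp: harmonic_boundary_def)
  show "inj_on label_of (harmonic_boundary X D emb)" by (rule inj_on_subset[OF inj_on_label_of sub])
  show "\<alpha> \<in> labels" if "\<alpha> \<in> label_of ` harmonic_boundary X D emb" for \<alpha>
  proof -
    obtain \<zeta> where \<zeta>: "\<alpha> = label_of \<zeta>" "\<zeta> \<in> martin_boundary X D emb" "boundary_fun X D emb \<zeta> \<in> nnhf"
      using \<open>\<alpha> \<in> _\<close> by (auto simp: harmonic_boundary_def)
    show ?thesis
      unfolding \<zeta>(1)
      by (rule labels_of_harmonic[OF label_of_range label_of_Nil label_of_zero])
         (use \<zeta> boundary_fun_eq in auto)
  qed
  fix \<alpha> assume \<alpha>: "\<alpha> \<in> labels"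
  obtain \<sigma> where \<sigma>: "\<And>n. \<sigma> n \<in> ptrees" "filterlim (\<lambda>n. card (\<sigma> n)) at_top sequentially"
    "\<And>i. i \<in> indivs \<Longrightarrow> (\<lambda>n. share (\<sigma> n) i) \<longlonglongrightarrow> \<alpha> i"
    using labels_approximable[OF \<alpha>] by blast
  have "convergent (\<lambda>n. martin_kernel \<tau> (\<sigma> n))" if "\<tau> \<in> ptrees" for \<tau>
    using martin_kernel_tendsto[OF \<sigma>(1,2) that] \<sigma>(3) ptrees_indivs[OF that] unfolding convergent_def by blast
  then obtain \<zeta> where \<zeta>: "\<zeta> \<in> martin_boundary X D emb" "converges_to X D emb \<sigma> \<zeta>"
    using boundary_point_exists[OF \<sigma>(1,2)] by blast
  have "label_of \<zeta> = \<alpha>"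
  proof (rule extensionalityI[of _ indivs])
    show "label_of \<zeta> i = \<alpha> i" if "i \<in> indivs" for i
      by (rule LIMSEQ_unique[OF label_of_tendsto[OF \<zeta>(1) \<sigma>(1) \<zeta>(2) that] \<sigma>(3)[OF that]])
  qed (use label_of_range[OF \<zeta>(1)] labels_extensional[OF \<alpha>] in \<open>auto simp: PiE_def\<close>)
  moreover have "\<zeta> \<in> harmonic_boundary X D emb"
    using \<zeta>(1) boundary_fun_eq[OF \<zeta>(1)] calculation label_fun_nnhf[OF \<alpha>] by (simp add: harmonic_boundary_def)
  ultimately show "\<alpha> \<in> label_of ` harmonic_boundary X D emb" by blast
qed

end

section \<open>Regular infinite paths\<close>

lemma infinite_pathsD:
  assumes "\<omega> \<in> infinite_paths"
  shows "\<omega> 0 = root_tree" "tree_edge (\<omega> n) (\<omega> (Suc n))" "\<omega> n \<in> ptrees" "card (\<omega> n) = Suc n"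
proof -
  show *: "\<omega> 0 = root_tree" "tree_edge (\<omega> n) (\<omega> (Suc n))" for n
    using assms by (auto simp: infinite_paths_def)
  show "\<omega> n \<in> ptrees" using *(2) tree_edgeD(1) by blast
  show "card (\<omega> n) = Suc n"
  proof (induction n)
    case (Suc n)
    then show ?case using tree_edgeD(4)[OF *(2), of n] by simp
  qed (use * in \<open>simp add: root_tree_def\<close>)
qed

text \<open>The tree at time \<open>n\<close> has \<open>n + 1\<close> vertices, so the two
  quotients differ by the factor \<open>1 + 1 / n\<close>.\<close>

lemma path_ratio_tendsto_iff:
  assumes "\<omega> \<in> infinite_paths"
  shows "(\<lambda>n. real (card (subtree (\<omega> n) i)) / real n) \<longlonglongrightarrow> a \<longleftrightarrow> (\<lambda>n. share (\<omega> n) i) \<longlonglongrightarrow> a"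
    (is "?f \<longlonglongrightarrow> a \<longleftrightarrow> ?g \<longlonglongrightarrow> a")
proof -
  have inv: "(\<lambda>n. inverse (real n)) \<longlonglongrightarrow> 0" by (rule lim_inverse_n)
  have c: "(\<lambda>n. 1 + inverse (real n)) \<longlonglongrightarrow> 1"
    using tendsto_add[OF tendsto_const[of "1::real"] inv] by simp
  have ev: "eventually (\<lambda>n. ?f n = ?g n * (1 + inverse (real n))) sequentially"
    using eventually_gt_at_top[of 0]
  proof eventually_elim
    case (elim n)
    then have "1 + inverse (real n) = real (Suc n) / real n" by (simp add: field_simps)
    then show ?case
      using infinite_pathsD(4)[OF assms, of n] by (simp add: share_def del: of_nat_Suc)
  qed
  have ev': "eventually (\<lambda>n. ?g n = ?f n / (1 + inverse (real n))) sequentially"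
    using ev by eventually_elim (auto simp: add_nonneg_eq_0_iff)
  show ?thesis
  proof
    assume "?f \<longlonglongrightarrow> a"
    then have "(\<lambda>n. ?f n / (1 + inverse (real n))) \<longlonglongrightarrow> a / 1" by (intro tendsto_divide c) auto
    then show "?g \<longlonglongrightarrow> a" using ev' by (simp add: filterlim_cong)
  next
    assume "?g \<longlonglongrightarrow> a"
    then have "(\<lambda>n. ?g n * (1 + inverse (real n))) \<longlonglongrightarrow> a * 1" by (intro tendsto_mult c)
    then show "?f \<longlonglongrightarrow> a" using ev by (simp add: filterlim_cong)
  qed
qed

lemma (in martin_completion) regular_path_iff:
  assumes \<omega>: "\<omega> \<in> infinite_paths"
  shows "regular_path X D emb \<omega> \<longleftrightarrow> (\<forall>i\<in>indivs. \<exists>a. 0 \<le> a \<and> a \<le> 1 \<and>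
     (\<lambda>n. real (card (subtree (\<omega> n) i)) / real n) \<longlonglongrightarrow> a)" (is "?L \<longleftrightarrow> ?R")
proof
  note pt = infinite_pathsD(3)[OF \<omega>]
  {
    assume ?L
    then obtain \<zeta> where \<zeta>: "\<zeta> \<in> martin_boundary X D emb" "converges_to X D emb \<omega> \<zeta>"
      by (auto simp: regular_path_def)
    show ?R
    proof
      fix i assume i: "i \<in> indivs"
      have "(\<lambda>n. real (card (subtree (\<omega> n) i)) / real n) \<longlonglongrightarrow> label_of \<zeta> i"
        using label_of_tendsto[OF \<zeta>(1) pt \<zeta>(2) i] path_ratio_tendsto_iff[OF \<omega>] by blast
      moreover have "label_of \<zeta> i \<in> {0..1}" using label_of_range[OF \<zeta>(1)] i by (auto simp: PiE_def Pi_def)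
      ultimately show "\<exists>a. 0 \<le> a \<and> a \<le> 1 \<and> (\<lambda>n. real (card (subtree (\<omega> n) i)) / real n) \<longlonglongrightarrow> a" by auto
    qed
  }
  assume ?R
  then obtain a where a: "\<And>i. i \<in> indivs \<Longrightarrow> (\<lambda>n. share (\<omega> n) i) \<longlonglongrightarrow> a i"
    using path_ratio_tendsto_iff[OF \<omega>] by metis
  have lim: "filterlim (\<lambda>n. card (\<omega> n)) at_top sequentially"
    using infinite_pathsD(4)[OF \<omega>] filterlim_Suc by simp
  have "convergent (\<lambda>n. martin_kernel \<tau> (\<omega> n))" if "\<tau> \<in> ptrees" for \<tau>
    using martin_kernel_tendsto[OF pt lim that, of a] a ptrees_indivs[OF that] by (auto simp: convergent_def)
  then show ?L using boundary_point_exists[OF pt lim] unfolding regular_path_def by metis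
qed

section \<open>Path space\<close>

lemma rooted_path_append:
  "s \<noteq> [] \<Longrightarrow> rooted_path (s @ [\<sigma>]) \<longleftrightarrow> rooted_path s \<and> tree_edge (last s) \<sigma>"
  by (auto simp: rooted_path_def finite_path_def successively_append_iff dest: tree_edgeD)

lemma rooted_path_single: "rooted_path [\<tau>] \<longleftrightarrow> \<tau> = root_tree"
  by (auto simp: rooted_path_def finite_path_def)

lemma rooted_path_neq_Nil: "rooted_path s \<Longrightarrow> s \<noteq> []"
  by (simp add: rooted_path_def finite_path_def)

lemma rooted_path_last: "rooted_path s \<Longrightarrow> last s \<in> ptrees"
  by (auto simp: rooted_path_def finite_path_def)

lemma rooted_path_induct [consumes 1, case_names root snoc]:
  assumes "rooted_path s" "P [root_tree]"
    and "\<And>s \<sigma>. rooted_path s \<Longrightarrow> tree_edge (last s) \<sigma> \<Longrightarrow> P s \<Longrightarrow> P (s @ [\<sigma>])"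
  shows "P s"
  using assms(1)
proof (induction s rule: rev_induct)
  case Nil
  then show ?case using rooted_path_neq_Nil by blast
next
  case (snoc \<sigma> s)
  then show ?case
    using assms(2,3) rooted_path_append[of s \<sigma>] rooted_path_single[of \<sigma>] by (cases "s = []") auto
qed

lemma rooted_path_card:
  assumes "rooted_path s" "k < length s"
  shows "card (s ! k) = Suc k"
  using assms
proof (induction arbitrary: k rule: rooted_path_induct)
  case root
  then show ?case by (simp add: root_tree_def)
next
  case (snoc s \<sigma>)
  show ?case
  proof (cases "k < length s")
    case True
    then show ?thesis using snoc by (simp add: nth_append)
  next
    case False
    then have k: "k = length s" using snoc.prems by simp
    have "s \<noteq> []" using snoc.hyps(1) by (rule rooted_path_neq_Nil)
    then have "card (last s) = length s" using snoc.IH[of "length s - 1"] by (simp add: last_conv_nth)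
    then show ?thesis using tree_edgeD(4)[OF snoc.hyps(2)] k by simp
  qed
qed

lemma rooted_path_card_last:
  assumes "rooted_path s"
  shows "card (last s) = length s"
  using rooted_path_card[OF assms, of "length s - 1"] rooted_path_neq_Nil[OF assms]
  by (simp add: last_conv_nth)

lemma rooted_path_exists:
  assumes "\<tau> \<in> ptrees"
  obtains s where "rooted_path s" "last s = \<tau>"
proof -
  have "{s. finite_path s \<and> hd s = root_tree \<and> last s = \<tau>} \<noteq> {}"
    using num_paths_root_pos[OF assms] unfolding num_paths_def by (metis card.empty less_irrefl)
  then show ?thesis using that by (auto simp: rooted_path_def)
qed

lemma countable_rooted_paths: "countable {s. rooted_path s}"
  by (rule countable_subset[OF _ countable_lists[OF countable_ptrees]])
     (auto simp: rooted_path_def finite_path_def)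

text \<open>A block prescribed from time \<open>n\<close> on. It need not begin at the root, as
  events of the future require; \<open>n = 0\<close> gives the cylinders.\<close>

definition seg :: "nat \<Rightarrow> tree list \<Rightarrow> (nat \<Rightarrow> tree) set" where
  "seg n r = {\<omega> \<in> infinite_paths. \<forall>k<length r. \<omega> (n + k) = r ! k}"

lemma cylinder_eq_seg: "cylinder s = seg 0 s"
  by (simp add: cylinder_def seg_def)

lemma seg_subset: "seg n r \<subseteq> infinite_paths"
  by (auto simp: seg_def)

lemma seg_iff: "\<omega> \<in> seg n r \<longleftrightarrow> \<omega> \<in> infinite_paths \<and> map \<omega> [n..<n + length r] = r"
proof -
  have "map \<omega> [n..<n + length r] = r \<longleftrightarrow> (\<forall>k<length r. \<omega> (n + k) = r ! k)"
    by (rule trans[OF list_eq_iff_nth_eq]) simp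
  then show ?thesis by (simp add: seg_def)
qed

lemma seg_Nil: "seg n [] = infinite_paths"
  by (auto simp: seg_def)

text \<open>Two blocks with the same starting time are nested or incompatible, so these sets are
  stable under intersection up to the empty set.\<close>

lemma seg_Int_le:
  assumes "length r \<le> length r'"
  shows "seg n r \<inter> seg n r' = (if take (length r) r' = r then seg n r' else {})"
proof -
  have tk: "take (length r) (map \<omega> [n..<n + length r']) = map \<omega> [n..<n + length r]" for \<omega> :: "nat \<Rightarrow> tree"
    using assms by (simp add: take_map)
  show ?thesis
  proof (cases "take (length r) r' = r")
    case True
    have "seg n r' \<subseteq> seg n r"
    proof
      fix \<omega> assume "\<omega> \<in> seg n r'"
      then have "\<omega> \<in> infinite_paths" "map \<omega> [n..<n + length r'] = r'" by (auto simp: seg_iff)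
      then show "\<omega> \<in> seg n r" using tk[of \<omega>] True by (simp add: seg_iff)
    qed
    then show ?thesis using True by auto
  next
    case False
    have "\<omega> \<notin> seg n r \<inter> seg n r'" for \<omega>
      using tk[of \<omega>] False by (auto simp: seg_iff)
    then show ?thesis using False by auto
  qed
qed

lemma Int_stable_segs:
  "Int_stable (insert {} (seg n ` R))"
proof (rule Int_stableI)
  fix a b assume "a \<in> insert {} (seg n ` R)" "b \<in> insert {} (seg n ` R)"
  then consider "a = {}" | "b = {}" | r r' where "a = seg n r" "b = seg n r'" "r \<in> R" "r' \<in> R" by blast
  then show "a \<inter> b \<in> insert {} (seg n ` R)"
  proof cases
    case 3
    then show ?thesis
      using seg_Int_le[of r r' n] seg_Int_le[of r' r n] linear[of "length r" "length r'"]
      by (auto simp: Int_commute split: if_splits)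
  qed auto
qed

text \<open>The empty set is included for stability under intersection.\<close>

definition cylinders :: "(nat \<Rightarrow> tree) set set" where
  "cylinders = insert {} (cylinder ` {s. rooted_path s})"

lemma cylinders_eq: "cylinders = insert {} (seg 0 ` {s. rooted_path s})"
  by (simp add: cylinders_def cylinder_eq_seg[abs_def])

lemma Int_stable_cylinders: "Int_stable cylinders"
  unfolding cylinders_eq by (rule Int_stable_segs)

lemma cylinder_subset: "cylinder s \<subseteq> infinite_paths"
  by (simp add: cylinder_eq_seg seg_subset)

lemma cylinders_Pow: "cylinders \<subseteq> Pow infinite_paths"
  using cylinder_subset by (auto simp: cylinders_def)

lemma space_path_space: "space path_space = infinite_paths"
  by (simp add: path_space_def space_measure_of_conv)

lemma sets_path_space: "sets path_space = sigma_sets infinite_paths cylinders"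
proof -
  have "sets path_space = sigma_sets infinite_paths (cylinder ` {s. rooted_path s})"
    unfolding path_space_def using cylinder_subset by (intro sets_measure_of) auto
  also have "\<dots> = sigma_sets infinite_paths cylinders"
    by (rule sigma_sets_eqI) (auto simp: cylinders_def intro: sigma_sets.Empty sigma_sets.Basic)
  finally show ?thesis .
qed

lemma cylinder_sets: "rooted_path s \<Longrightarrow> cylinder s \<in> sets path_space"
  unfolding sets_path_space by (auto simp: cylinders_def intro: sigma_sets.Basic)

lemma cylinder_root: "cylinder [root_tree] = infinite_paths"
  by (auto simp: cylinder_def infinite_pathsD)

lemma infinite_path_prefix:
  assumes "\<omega> \<in> infinite_paths"
  shows "rooted_path (map \<omega> [0..<Suc n])" "last (map \<omega> [0..<Suc n]) = \<omega> n"
    "\<omega> \<in> cylinder (map \<omega> [0..<Suc n])"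
proof -
  show "rooted_path (map \<omega> [0..<Suc n])"
  proof (induction n)
    case 0
    then show ?case using infinite_pathsD(1)[OF assms] by (simp add: rooted_path_single)
  next
    case (Suc n)
    have "map \<omega> [0..<Suc (Suc n)] = map \<omega> [0..<Suc n] @ [\<omega> (Suc n)]" by simp
    moreover have "last (map \<omega> [0..<Suc n]) = \<omega> n" by simp
    ultimately show ?case
      using Suc rooted_path_append[of "map \<omega> [0..<Suc n]" "\<omega> (Suc n)"] infinite_pathsD(2)[OF assms, of n]
      by (metis rooted_path_neq_Nil)
  qed
  show "last (map \<omega> [0..<Suc n]) = \<omega> n" by simp
  show "\<omega> \<in> cylinder (map \<omega> [0..<Suc n])"
    unfolding cylinder_def using assms by (simp del: upt_Suc)
qed

lemma cylinder_nonempty_rooted: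
  assumes "\<omega> \<in> cylinder s" "s \<noteq> []"
  shows "rooted_path s" "\<omega> (length s - 1) = last s"
proof -
  have \<omega>: "\<omega> \<in> infinite_paths" "map \<omega> [0..<length s] = s"
    using assms(1) by (auto simp: cylinder_eq_seg seg_iff)
  obtain n where n: "length s = Suc n" using assms(2) by (cases s) auto
  have s: "s = map \<omega> [0..<Suc n]" using \<omega>(2) n by simp
  show "rooted_path s" unfolding s by (rule infinite_path_prefix(1)[OF \<omega>(1)])
  have "last s = \<omega> n" by (subst s) (rule infinite_path_prefix(2)[OF \<omega>(1)])
  then show "\<omega> (length s - 1) = last s" using n by simp
qed

lemma state_set_eq:
  "{\<omega> \<in> infinite_paths. \<omega> k \<in> B} = (\<Union>s\<in>{s. rooted_path s \<and> length s = Suc k \<and> last s \<in> B}. cylinder s)"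
    (is "_ = (\<Union>s\<in>?R. cylinder s)")
proof (intro equalityI subsetI)
  fix \<omega> assume "\<omega> \<in> {\<omega> \<in> infinite_paths. \<omega> k \<in> B}"
  then have \<omega>: "\<omega> \<in> infinite_paths" "\<omega> k \<in> B" by auto
  have "map \<omega> [0..<Suc k] \<in> ?R"
    using infinite_path_prefix[OF \<omega>(1), of k] \<omega>(2) by (simp del: upt_Suc)
  then show "\<omega> \<in> (\<Union>s\<in>?R. cylinder s)" using infinite_path_prefix(3)[OF \<omega>(1), of k] by blast
next
  fix \<omega> assume "\<omega> \<in> (\<Union>s\<in>?R. cylinder s)"
  then obtain s where s: "rooted_path s" "length s = Suc k" "last s \<in> B" "\<omega> \<in> cylinder s" by auto
  then have "\<omega> k = last s" using cylinder_nonempty_rooted(2)[OF s(4) rooted_path_neq_Nil[OF s(1)]] by simp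
  then show "\<omega> \<in> {\<omega> \<in> infinite_paths. \<omega> k \<in> B}" using s cylinder_subset by auto
qed

lemma cylinder_split:
  assumes "rooted_path s"
  shows "cylinder s = (\<Union>\<sigma>\<in>{\<sigma>. tree_edge (last s) \<sigma>}. cylinder (s @ [\<sigma>]))"
proof (intro equalityI subsetI)
  fix \<omega> assume \<omega>: "\<omega> \<in> cylinder s"
  let ?\<sigma> = "\<omega> (length s)"
  have ne: "s \<noteq> []" using assms by (rule rooted_path_neq_Nil)
  have "tree_edge (\<omega> (length s - 1)) (\<omega> (Suc (length s - 1)))"
    using \<omega> cylinder_subset infinite_pathsD(2) by blast
  then have "tree_edge (last s) ?\<sigma>" using cylinder_nonempty_rooted(2)[OF \<omega> ne] ne by simp
  moreover have "\<omega> \<in> cylinder (s @ [?\<sigma>])"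
    using \<omega> by (auto simp: cylinder_def nth_append less_Suc_eq)
  ultimately show "\<omega> \<in> (\<Union>\<sigma>\<in>{\<sigma>. tree_edge (last s) \<sigma>}. cylinder (s @ [\<sigma>]))" by blast
next
  fix \<omega> assume "\<omega> \<in> (\<Union>\<sigma>\<in>{\<sigma>. tree_edge (last s) \<sigma>}. cylinder (s @ [\<sigma>]))"
  then obtain \<sigma> where "\<omega> \<in> cylinder (s @ [\<sigma>])" by blast
  then show "\<omega> \<in> cylinder s" by (auto simp: cylinder_def nth_append less_Suc_eq)
qed

lemma cylinder_disjoint: "disjoint_family_on (\<lambda>\<sigma>. cylinder (s @ [\<sigma>])) S"
proof -
  have "\<omega> (length s) = \<sigma>" if "\<omega> \<in> cylinder (s @ [\<sigma>])" for \<omega> \<sigma>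
    using that by (auto simp: cylinder_def dest!: spec[of _ "length s"])
  then show ?thesis unfolding disjoint_family_on_def by blast
qed

lemma countable_edges: "countable {\<sigma>. tree_edge \<tau> \<sigma>}"
  by (rule countable_subset[OF _ countable_ptrees]) (auto dest: tree_edgeD)

lemma has_sum_measure_UN:
  assumes "finite_measure M" "countable I" "\<And>i. i \<in> I \<Longrightarrow> X i \<in> sets M" "disjoint_family_on X I"
  shows "((\<lambda>i. measure M (X i)) has_sum measure M (\<Union>i\<in>I. X i)) I"
proof -
  interpret finite_measure M by fact
  have "emeasure M (\<Union>i\<in>I. X i) = (\<integral>\<^sup>+i. emeasure M (X i) \<partial>count_space I)"
    by (rule emeasure_UN_countable[OF assms(3,2,4)])
  then show ?thesis
    by (subst has_sum_iff_nn_integral) (simp_all add: emeasure_eq_measure measure_nonneg)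
qed

lemma has_sum_measure_cylinder:
  assumes "finite_measure \<mu>" "sets \<mu> = sets path_space" "rooted_path s" "A \<in> sets \<mu>"
  shows "((\<lambda>\<sigma>. measure \<mu> (cylinder (s @ [\<sigma>]) \<inter> A)) has_sum measure \<mu> (cylinder s \<inter> A))
    {\<sigma>. tree_edge (last s) \<sigma>}"
proof -
  have "rooted_path (s @ [\<sigma>])" if "tree_edge (last s) \<sigma>" for \<sigma>
    using assms(3) that rooted_path_append rooted_path_neq_Nil by blast
  then have "cylinder (s @ [\<sigma>]) \<inter> A \<in> sets \<mu>" if "\<sigma> \<in> {\<sigma>. tree_edge (last s) \<sigma>}" for \<sigma>
    using that assms(2,4) cylinder_sets by auto
  moreover have "disjoint_family_on (\<lambda>\<sigma>. cylinder (s @ [\<sigma>]) \<inter> A) {\<sigma>. tree_edge (last s) \<sigma>}"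
    unfolding disjoint_family_on_def
  proof (intro ballI impI)
    fix \<sigma> \<sigma>' :: tree assume "\<sigma> \<noteq> \<sigma>'"
    then have "cylinder (s @ [\<sigma>]) \<inter> cylinder (s @ [\<sigma>']) = {}"
      using cylinder_disjoint[of s UNIV] by (simp add: disjoint_family_on_def)
    then show "(cylinder (s @ [\<sigma>]) \<inter> A) \<inter> (cylinder (s @ [\<sigma>']) \<inter> A) = {}" by blast
  qed
  ultimately have "((\<lambda>\<sigma>. measure \<mu> (cylinder (s @ [\<sigma>]) \<inter> A)) has_sum
      measure \<mu> (\<Union>\<sigma>\<in>{\<sigma>. tree_edge (last s) \<sigma>}. cylinder (s @ [\<sigma>]) \<inter> A)) {\<sigma>. tree_edge (last s) \<sigma>}"
    by (rule has_sum_measure_UN[OF assms(1) countable_edges])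
  moreover have "(\<Union>\<sigma>\<in>{\<sigma>. tree_edge (last s) \<sigma>}. cylinder (s @ [\<sigma>]) \<inter> A) = cylinder s \<inter> A"
    using cylinder_split[OF assms(3)] by blast
  ultimately show ?thesis by simp
qed

section \<open>Central measures\<close>

lemma sat_centralD:
  assumes "\<mu> \<in> sat_central"
  shows "prob_space \<mu>" "space \<mu> = infinite_paths" "sets \<mu> = sets path_space"
    "rooted_path s \<Longrightarrow> rooted_path t \<Longrightarrow> last s = last t \<Longrightarrow>
       measure \<mu> (cylinder s) = measure \<mu> (cylinder t)"
  using assms unfolding sat_central_def by blast+

lemma nnhf_of_last:
  assumes "\<mu> \<in> sat_central" "rooted_path s"
  shows "nnhf_of \<mu> (last s) = measure \<mu> (cylinder s)"
proof -
  let ?t = "SOME t. rooted_path t \<and> last t = last s"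
  have "rooted_path ?t \<and> last ?t = last s" by (rule someI[of _ s]) (use assms(2) in simp)
  then have "measure \<mu> (cylinder ?t) = measure \<mu> (cylinder s)"
    using sat_centralD(4)[OF assms(1)] assms(2) by blast
  then show ?thesis using rooted_path_last[OF assms(2)] by (simp add: nnhf_of_def)
qed

text \<open>Harmonicity is countable additivity over the next step. With \<open>A\<close> the whole
  space it concerns \<open>nnhf_of \<mu>\<close>, with \<open>A\<close> a tail event the restriction
  of \<open>\<mu>\<close> to it.\<close>

lemma harmonic_at_of_cylinders:
  assumes "\<mu> \<in> sat_central" "A \<in> sets \<mu>"
    and f: "\<And>s. rooted_path s \<Longrightarrow> f (last s) = measure \<mu> (cylinder s \<inter> A)" and \<tau>: "\<tau> \<in> ptrees"
  shows "harmonic_at f \<tau>"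
proof -
  interpret prob_space \<mu> by (rule sat_centralD(1)[OF assms(1)])
  obtain s where s: "rooted_path s" "last s = \<tau>" using rooted_path_exists[OF \<tau>] .
  have "((\<lambda>\<sigma>. measure \<mu> (cylinder (s @ [\<sigma>]) \<inter> A)) has_sum measure \<mu> (cylinder s \<inter> A))
      {\<sigma>. tree_edge (last s) \<sigma>}"
    by (rule has_sum_measure_cylinder[OF finite_measure_axioms sat_centralD(3)[OF assms(1)] s(1) assms(2)])
  moreover have "measure \<mu> (cylinder (s @ [\<sigma>]) \<inter> A) = f \<sigma>" if "\<sigma> \<in> {\<sigma>. tree_edge (last s) \<sigma>}" for \<sigma>
    using f[of "s @ [\<sigma>]"] that s(1) rooted_path_append[of s \<sigma>] rooted_path_neq_Nil by auto
  ultimately have "(f has_sum measure \<mu> (cylinder s \<inter> A)) {\<sigma>. tree_edge (last s) \<sigma>}"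
    by (rule has_sum_cong[THEN iffD1, rotated])
  then have "(f has_sum f \<tau>) {\<sigma>. tree_edge \<tau> \<sigma>}" using f[OF s(1)] s(2) by simp
  then show ?thesis using has_sum_edges[OF \<tau>, of f "f \<tau>"] by (simp add: harmonic_at_def)
qed

lemma nnhf_of_nnhf:
  assumes "\<mu> \<in> sat_central"
  shows "nnhf_of \<mu> \<in> nnhf"
  unfolding nnhf_iff
proof (intro conjI ballI)
  interpret prob_space \<mu> by (rule sat_centralD(1)[OF assms])
  show "nnhf_of \<mu> \<in> ptrees \<rightarrow>\<^sub>E {0..}" by (auto simp: nnhf_of_def measure_nonneg)
  show "nnhf_of \<mu> root_tree = 1"
    using nnhf_of_last[OF assms, of "[root_tree]"] prob_space
    by (simp add: rooted_path_single cylinder_root sat_centralD(2)[OF assms])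
  fix \<tau> assume \<tau>: "\<tau> \<in> ptrees"
  show "harmonic_at (nnhf_of \<mu>) \<tau>"
  proof (rule harmonic_at_of_cylinders[OF assms sets.top _ \<tau>])
    fix s assume s: "rooted_path s"
    have "cylinder s \<inter> space \<mu> = cylinder s" using cylinder_subset sat_centralD(2)[OF assms] by auto
    then show "nnhf_of \<mu> (last s) = measure \<mu> (cylinder s \<inter> space \<mu>)"
      using nnhf_of_last[OF assms s] by simp
  qed
qed

lemma path_measure_eqI:
  assumes "finite_measure \<mu>" "finite_measure \<nu>" "sets \<mu> = sets path_space" "sets \<nu> = sets path_space"
    and "\<And>s. rooted_path s \<Longrightarrow> measure \<mu> (cylinder s) = measure \<nu> (cylinder s)"
  shows "\<mu> = \<nu>"
proof (rule measure_eqI_generator_eq[OF Int_stable_cylinders cylinders_Pow, where A = "\<lambda>_. infinite_paths"])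
  interpret \<mu>: finite_measure \<mu> by fact
  interpret \<nu>: finite_measure \<nu> by fact
  show "emeasure \<mu> X = emeasure \<nu> X" if "X \<in> cylinders" for X
    using that assms(5) by (auto simp: cylinders_def \<mu>.emeasure_eq_measure \<nu>.emeasure_eq_measure)
  show "sets \<mu> = sigma_sets infinite_paths cylinders" "sets \<nu> = sigma_sets infinite_paths cylinders"
    using assms(3,4) sets_path_space by auto
  show "range (\<lambda>_. infinite_paths) \<subseteq> cylinders"
    using cylinder_root rooted_path_single unfolding cylinders_def by blast
  show "emeasure \<mu> infinite_paths \<noteq> \<infinity>" by (simp add: \<mu>.emeasure_eq_measure)
qed auto

lemma inj_on_nnhf_of: "inj_on nnhf_of sat_central"
proof (rule inj_onI)
  fix \<mu> \<nu> assume \<mu>: "\<mu> \<in> sat_central" and \<nu>: "\<nu> \<in> sat_central" and eq: "nnhf_of \<mu> = nnhf_of \<nu>"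
  show "\<mu> = \<nu>"
  proof (rule path_measure_eqI)
    show "finite_measure \<mu>" "finite_measure \<nu>"
      using sat_centralD(1) \<mu> \<nu> prob_space.finite_measure by blast+
    show "measure \<mu> (cylinder s) = measure \<nu> (cylinder s)" if "rooted_path s" for s
      using nnhf_of_last[OF \<mu> that] nnhf_of_last[OF \<nu> that] eq by simp
  qed (use sat_centralD(3) \<mu> \<nu> in auto)
qed

text \<open>A path never visits a tree twice, so the Markov chain can be driven by one independent choice
  of a successor for each tree.\<close>

lemma exists_central_measure:
  assumes \<alpha>: "\<alpha> \<in> labels"
  shows "\<exists>\<mu>\<in>sat_central. nnhf_of \<mu> = label_fun \<alpha>"
proof -
  \<comment> \<open>On an edge \<open>\<sigma> - \<tau>\<close> is a single vertex, so the product
    is just its label.\<close>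
  define q where "q \<tau> \<sigma> = (\<Prod>i\<in>\<sigma> - \<tau>. \<alpha> i)" for \<tau> \<sigma> :: tree
  define E where "E \<tau> = {\<sigma>. tree_edge \<tau> \<sigma>}" for \<tau>
  define M where "M \<tau> = point_measure (E \<tau>) (\<lambda>\<sigma>. ennreal (q \<tau> \<sigma>))" for \<tau>
  have q_insert: "q \<tau> (insert v \<tau>) = \<alpha> v" if "v \<in> addable \<tau>" for \<tau> v
  proof -
    have "insert v \<tau> - \<tau> = {v}" using addable_notin[OF that] by auto
    then show ?thesis by (simp add: q_def)
  qed
  have \<alpha>0: "\<alpha> v \<ge> 0" if "\<tau> \<in> ptrees" "v \<in> addable \<tau>" for \<tau> v
    using labels_range[OF \<alpha>] addable_indivs[OF that] by (auto simp: Pi_def)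
  have q0: "q \<tau> \<sigma> \<ge> 0" if "\<tau> \<in> ptrees" "\<sigma> \<in> E \<tau>" for \<tau> \<sigma>
  proof -
    obtain v where "v \<in> addable \<tau>" "\<sigma> = insert v \<tau>" using \<open>\<sigma> \<in> E \<tau>\<close> by (auto simp: E_def tree_edge_iff)
    then show ?thesis using q_insert \<alpha>0[OF that(1)] by simp
  qed
  have prob: "prob_space (M \<tau>)" if \<tau>: "\<tau> \<in> ptrees" for \<tau>
  proof
    have "below [] \<tau> = addable \<tau>" by (auto simp: below_def)
    then have "(\<alpha> has_sum 1) (addable \<tau>)"
      using labels_has_sum_below[OF \<alpha> \<tau>, of "[]"] labels_Nil[OF \<alpha>] by simp
    then have "((\<lambda>v. q \<tau> (insert v \<tau>)) has_sum 1) (addable \<tau>)" using q_insert by (simp cong: has_sum_cong)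
    then have "(q \<tau> has_sum 1) (E \<tau>)" using has_sum_edges[OF \<tau>, of "q \<tau>" 1] by (simp add: E_def)
    then have "(\<integral>\<^sup>+\<sigma>. ennreal (q \<tau> \<sigma>) \<partial>count_space (E \<tau>)) = 1"
      using q0[OF \<tau>] by (subst (asm) has_sum_iff_nn_integral) auto
    moreover have "emeasure (M \<tau>) (space (M \<tau>)) = (\<integral>\<^sup>+\<sigma>. ennreal (q \<tau> \<sigma>) * indicator (E \<tau>) \<sigma> \<partial>count_space (E \<tau>))"
      by (simp add: M_def point_measure_def emeasure_density)
    moreover have "\<dots> = (\<integral>\<^sup>+\<sigma>. ennreal (q \<tau> \<sigma>) \<partial>count_space (E \<tau>))"
      by (rule nn_integral_cong) simp
    ultimately show "emeasure (M \<tau>) (space (M \<tau>)) = 1" by simp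
  qed
  define P where "P = PiM ptrees M"
  interpret P: prob_space P unfolding P_def by (rule prob_space_PiM[OF prob])
  have step: "x \<tau> \<in> E \<tau>" if "x \<in> space P" "\<tau> \<in> ptrees" for x \<tau>
    using that by (auto simp: P_def space_PiM M_def space_point_measure)
  define orbit where "orbit x n = (x ^^ n) root_tree" for x :: "tree \<Rightarrow> tree" and n
  have orbit_ptrees: "orbit x n \<in> ptrees" if "x \<in> space P" for x n
    by (induction n) (use step[OF that] in \<open>auto simp: orbit_def E_def dest: tree_edgeD\<close>)
  have orbit_0: "orbit x 0 = root_tree" for x by (simp add: orbit_def)
  have orbit_Suc: "orbit x (Suc n) = x (orbit x n)" for x n by (simp add: orbit_def)
  have orbit: "orbit x \<in> infinite_paths" if "x \<in> space P" for x
    unfolding infinite_paths_def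
    using step[OF that orbit_ptrees[OF that]] orbit_0[of x] by (simp add: orbit_Suc E_def)
  \<comment> \<open>The successor of \<open>\<tau>\<close> on \<open>s\<close> is
    \<open>s ! card \<tau>\<close>, because \<open>s ! k\<close> has size \<open>k + 1\<close>. The
    last tree is left out: the cylinder does not prescribe its successor.\<close>
  define S where "S s = {x \<in> space P. \<forall>\<tau>\<in>set (butlast s). x \<tau> \<in> {s ! card \<tau>}}" for s
  have orbit_cyl: "orbit -` cylinder s \<inter> space P = S s" if s: "rooted_path s" for s
  proof -
    have ne: "s \<noteq> []" using s by (rule rooted_path_neq_Nil)
    have s0: "s ! 0 = root_tree" using s by (simp add: rooted_path_def hd_conv_nth ne)
    have card: "card (s ! k) = Suc k" if "k < length s" for k by (rule rooted_path_card[OF s that])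
    have "orbit x \<in> cylinder s \<longleftrightarrow> (\<forall>\<tau>\<in>set (butlast s). x \<tau> = s ! card \<tau>)" if x: "x \<in> space P" for x
    proof
      assume "orbit x \<in> cylinder s"
      then have c: "orbit x k = s ! k" if "k < length s" for k using that by (simp add: cylinder_def)
      show "\<forall>\<tau>\<in>set (butlast s). x \<tau> = s ! card \<tau>"
      proof
        fix \<tau> assume "\<tau> \<in> set (butlast s)"
        then obtain k where k: "k < length s - 1" "\<tau> = s ! k"
          by (auto simp: in_set_conv_nth nth_butlast)
        then have "x \<tau> = orbit x (Suc k)" using c[of k] by (simp add: orbit_Suc)
        then show "x \<tau> = s ! card \<tau>" using c[of "Suc k"] k card[of k] by simp
      qed
    next
      assume a: "\<forall>\<tau>\<in>set (butlast s). x \<tau> = s ! card \<tau>"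
      have "orbit x k = s ! k" if "k < length s" for k
        using that
      proof (induction k)
        case 0
        then show ?case using s0 by (simp add: orbit_def)
      next
        case (Suc k)
        have "s ! k \<in> set (butlast s)"
          using Suc.prems nth_mem[of k "butlast s"] by (simp add: nth_butlast)
        then show ?case using a Suc card[of k] by (simp add: orbit_Suc)
      qed
      then show "orbit x \<in> cylinder s" using orbit[OF x] by (simp add: cylinder_def)
    qed
    then show ?thesis by (auto simp: S_def)
  qed
  have S_emb: "S s = prod_emb ptrees M (set (butlast s)) (Pi\<^sub>E (set (butlast s)) (\<lambda>\<tau>. {s ! card \<tau>}))"
    and S_set: "set (butlast s) \<subseteq> ptrees"
    and S_sets: "\<And>\<tau>. \<tau> \<in> set (butlast s) \<Longrightarrow> {s ! card \<tau>} \<in> sets (M \<tau>)"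
    and S_prod: "(\<Prod>\<tau>\<in>set (butlast s). emeasure (M \<tau>) {s ! card \<tau>}) = ennreal (label_fun \<alpha> (last s))"
    if s: "rooted_path s" for s
  proof -
    show sub: "set (butlast s) \<subseteq> ptrees"
      using s by (auto simp: rooted_path_def finite_path_def dest: in_set_butlastD)
    then show "S s = prod_emb ptrees M (set (butlast s)) (Pi\<^sub>E (set (butlast s)) (\<lambda>\<tau>. {s ! card \<tau>}))"
      unfolding S_def prod_emb_def P_def space_PiM 
      by (intro set_eqI) (simp add: restrict_PiE_iff Pi_iff conj_commute)
    have "(\<forall>\<tau>\<in>set (butlast s). {s ! card \<tau>} \<in> sets (M \<tau>)) \<and>
        (\<Prod>\<tau>\<in>set (butlast s). emeasure (M \<tau>) {s ! card \<tau>}) = ennreal (label_fun \<alpha> (last s))"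
      using s
    proof (induction rule: rooted_path_induct)
      case root
      then show ?case using labels_Nil[OF \<alpha>] by (simp add: label_fun_root)
    next
      case (snoc s \<sigma>)
      have ne: "s \<noteq> []" using snoc.hyps(1) by (rule rooted_path_neq_Nil)
      have last: "last s \<in> ptrees" by (rule rooted_path_last[OF snoc.hyps(1)])
      have card_last: "card (last s) = length s" by (rule rooted_path_card_last[OF snoc.hyps(1)])
      have card_lt: "card \<tau> < length s" if \<tau>: "\<tau> \<in> set (butlast s)" for \<tau>
      proof -
        obtain k where "k < length s - 1" "\<tau> = s ! k" using \<tau> by (auto simp: in_set_conv_nth nth_butlast)
        then show ?thesis using rooted_path_card[OF snoc.hyps(1), of k] by simp
      qed
      have "set (butlast s @ [last s]) = set s" unfolding append_butlast_last_id[OF ne] ..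
      then have set_s: "set s = insert (last s) (set (butlast s))" by auto
      \<comment> \<open>Sizes increase strictly along a path, so the prescribed choices concern
        different coordinates and their probabilities multiply.\<close>
      have notin: "last s \<notin> set (butlast s)" using card_lt[of "last s"] card_last by auto
      have nth: "(s @ [\<sigma>]) ! card \<tau> = s ! card \<tau>" if "\<tau> \<in> set (butlast s)" for \<tau>
        using card_lt[OF that] by (simp add: nth_append)
      have nth_last: "(s @ [\<sigma>]) ! card (last s) = \<sigma>" using card_last by (simp add: nth_append)
      obtain v where v: "v \<in> addable (last s)" "\<sigma> = insert v (last s)"
        using snoc.hyps(2) by (auto simp: tree_edge_iff)
      have \<sigma>E: "\<sigma> \<in> E (last s)" using snoc.hyps(2) by (simp add: E_def)
      have em: "emeasure (M (last s)) {\<sigma>} = ennreal (\<alpha> v)"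
      proof -
        have "emeasure (M (last s)) {\<sigma>} = (\<integral>\<^sup>+x. ennreal (q (last s) x) * indicator {\<sigma>} x \<partial>count_space (E (last s)))"
          unfolding M_def point_measure_def using \<sigma>E by (intro emeasure_density) auto
        also have "\<dots> = (\<integral>\<^sup>+x. ennreal (q (last s) \<sigma>) * indicator {\<sigma>} x \<partial>count_space (E (last s)))"
          by (rule nn_integral_cong) (auto simp: indicator_def)
        also have "\<dots> = ennreal (q (last s) \<sigma>)"
          using \<sigma>E by (simp add: nn_integral_cmult_indicator)
        finally show ?thesis using v q_insert by simp
      qed
      have "(\<Prod>\<tau>\<in>set s. emeasure (M \<tau>) {(s @ [\<sigma>]) ! card \<tau>}) =
          emeasure (M (last s)) {\<sigma>} * (\<Prod>\<tau>\<in>set (butlast s). emeasure (M \<tau>) {s ! card \<tau>})"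
        unfolding set_s using notin nth nth_last by simp
      also have "\<dots> = ennreal (\<alpha> v * label_fun \<alpha> (last s))"
        using em snoc.IH \<alpha>0[OF last v(1)] by (simp add: ennreal_mult')
      also have "\<alpha> v * label_fun \<alpha> (last s) = label_fun \<alpha> \<sigma>" using label_fun_insert[OF last v(1)] v(2) by simp
      finally have "(\<Prod>\<tau>\<in>set s. emeasure (M \<tau>) {(s @ [\<sigma>]) ! card \<tau>}) = ennreal (label_fun \<alpha> \<sigma>)" .
      moreover have "\<forall>\<tau>\<in>set s. {(s @ [\<sigma>]) ! card \<tau>} \<in> sets (M \<tau>)"
        unfolding set_s using snoc.IH nth nth_last \<sigma>E by (auto simp: M_def sets_point_measure)
      ultimately show ?case by simp
    qed
    then show "\<And>\<tau>. \<tau> \<in> set (butlast s) \<Longrightarrow> {s ! card \<tau>} \<in> sets (M \<tau>)"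
      and "(\<Prod>\<tau>\<in>set (butlast s). emeasure (M \<tau>) {s ! card \<tau>}) = ennreal (label_fun \<alpha> (last s))"
      by blast+
  qed
  have meas: "orbit \<in> measurable P path_space"
    unfolding path_space_def
  proof (rule measurable_measure_of)
    show "cylinder ` {s. rooted_path s} \<subseteq> Pow infinite_paths" using cylinder_subset by blast
    show "orbit \<in> space P \<rightarrow> infinite_paths" using orbit by blast
    fix y assume "y \<in> cylinder ` {s. rooted_path s}"
    then obtain s where s: "rooted_path s" "y = cylinder s" by blast
    show "orbit -` y \<inter> space P \<in> sets P"
      unfolding s(2) orbit_cyl[OF s(1)]
      unfolding S_emb[OF s(1)] P_def
      using S_sets[OF s(1)] by (intro sets_PiM_I S_set s(1)) auto
  qed
  define \<mu> where "\<mu> = distr P path_space orbit"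
  have \<mu>_cyl: "measure \<mu> (cylinder s) = label_fun \<alpha> (last s)" if s: "rooted_path s" for s
  proof -
    have "emeasure \<mu> (cylinder s) = emeasure P (S s)"
      unfolding \<mu>_def using emeasure_distr[OF meas cylinder_sets[OF s]] orbit_cyl[OF s] by simp
    also have "\<dots> = ennreal (label_fun \<alpha> (last s))"
      unfolding S_emb[OF s] P_def
      unfolding S_prod[OF s, symmetric]
      by (rule emeasure_PiM_emb[OF prob S_set[OF s] _ S_sets[OF s]]) auto
    finally show ?thesis
      using label_fun_nonneg[OF labels_range[OF \<alpha>] rooted_path_last[OF s]] by (simp add: measure_def)
  qed
  have \<mu>: "\<mu> \<in> sat_central"
    unfolding sat_central_def
    using P.prob_space_distr[OF meas] \<mu>_cyl by (auto simp: \<mu>_def space_path_space)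
  moreover have "nnhf_of \<mu> = label_fun \<alpha>"
  proof (rule extensionalityI[of _ ptrees])
    fix \<tau> assume "\<tau> \<in> ptrees"
    then obtain s where "rooted_path s" "last s = \<tau>" using rooted_path_exists by blast
    then show "nnhf_of \<mu> \<tau> = label_fun \<alpha> \<tau>" using nnhf_of_last[OF \<mu>, of s] \<mu>_cyl[of s] by simp
  qed (auto simp: nnhf_of_def label_fun_def)
  ultimately show ?thesis by blast
qed

section \<open>Ergodicity\<close>

definition state_events :: "nat \<Rightarrow> (nat \<Rightarrow> tree) set set" where
  "state_events k = {{\<omega> \<in> infinite_paths. \<omega> k \<in> B} | B. B \<subseteq> ptrees}"

definition future :: "nat \<Rightarrow> (nat \<Rightarrow> tree) measure" where
  "future n = sigma infinite_paths (\<Union>(state_events ` {n..}))"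

lemma state_events_Pow: "\<Union>(state_events ` K) \<subseteq> Pow infinite_paths"
  by (auto simp: state_events_def)

lemma space_future: "space (future n) = infinite_paths"
  by (simp add: future_def space_measure_of_conv)

lemma sets_future: "sets (future n) = sigma_sets infinite_paths (\<Union>(state_events ` {n..}))"
  unfolding future_def by (rule sets_measure_of[OF state_events_Pow])

lemma tail_events_eq:
  assumes "prob_space \<mu>" "space \<mu> = infinite_paths"
  shows "prob_space.tail_events \<mu> (\<lambda>k. {{\<omega> \<in> space \<mu>. \<omega> k \<in> B} | B. B \<subseteq> ptrees}) = (\<Inter>n. sets (future n))"
proof -
  have eq: "(\<lambda>k. {{\<omega> \<in> space \<mu>. \<omega> k \<in> B} | B. B \<subseteq> ptrees}) = state_events"
    by (simp add: state_events_def[abs_def] assms(2))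
  show ?thesis
    unfolding eq
    unfolding prob_space.tail_events_def[OF assms(1)] sets_future assms(2) ..
qed

text \<open>Events at single times are not stable under intersection, but blocks starting at time
  \<open>n\<close> are; an induction over the future needs such a generator.\<close>

lemma state_event_segs:
  assumes "n \<le> k" "B \<subseteq> ptrees"
  shows "{\<omega> \<in> infinite_paths. \<omega> k \<in> B} \<in> sigma_sets infinite_paths (insert {} (range (seg n)))"
proof -
  define R where "R = {r \<in> lists ptrees. length r = Suc (k - n) \<and> last r \<in> B}"
  have "countable R"
    by (rule countable_subset[OF _ countable_lists[OF countable_ptrees]]) (auto simp: R_def)
  moreover have "{\<omega> \<in> infinite_paths. \<omega> k \<in> B} = \<Union>(seg n ` R)"
  proof (intro equalityI subsetI)
    fix \<omega> assume "\<omega> \<in> {\<omega> \<in> infinite_paths. \<omega> k \<in> B}"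
    then have \<omega>: "\<omega> \<in> infinite_paths" "\<omega> k \<in> B" by auto
    let ?r = "map \<omega> [n..<Suc k]"
    have "set ?r \<subseteq> ptrees" using infinite_pathsD(3)[OF \<omega>(1)] by auto
    moreover have "last ?r = \<omega> k" using assms(1) by simp
    moreover have "length ?r = Suc (k - n)" using assms(1) by simp
    ultimately have "?r \<in> R" using \<omega>(2) by (auto simp: R_def simp del: upt_Suc)
    moreover have "\<omega> \<in> seg n ?r" using \<omega>(1) assms(1) by (simp add: seg_iff del: upt_Suc)
    ultimately show "\<omega> \<in> \<Union>(seg n ` R)" by blast
  next
    fix \<omega> assume "\<omega> \<in> \<Union>(seg n ` R)"
    then obtain r where r: "length r = Suc (k - n)" "last r \<in> B" "\<omega> \<in> seg n r" by (auto simp: R_def)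
    have "k - n < length r" using r(1) by simp
    then have "\<omega> (n + (k - n)) = r ! (k - n)" using r(3) unfolding seg_def by blast
    then have "\<omega> k = r ! (k - n)" using assms(1) by simp
    also have "\<dots> = last r" using r(1) by (cases "r = []") (auto simp: last_conv_nth)
    finally show "\<omega> \<in> {\<omega> \<in> infinite_paths. \<omega> k \<in> B}" using r seg_subset by auto
  qed
  ultimately show ?thesis
    by (auto intro!: sigma_sets_UNION intro: sigma_sets.Basic)
qed

lemma future_segs:
  assumes "A \<in> sets (future n)"
  shows "A \<in> sigma_sets infinite_paths (insert {} (range (seg n)))"
proof -
  have "\<Union>(state_events ` {n..}) \<subseteq> sigma_sets infinite_paths (insert {} (range (seg n)))"
    using state_event_segs by (auto simp: state_events_def)
  then show ?thesis
    using assms sigma_sets_mono unfolding sets_future by blast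
qed

text \<open>The block starts at the time of the last tree of \<open>s\<close>, so the two overlap in
  one entry; hence \<open>tl r\<close>.\<close>

lemma cylinder_Int_seg:
  assumes "rooted_path s"
  shows "cylinder s \<inter> seg (length s - 1) r =
    (if r = [] then cylinder s else if hd r = last s then cylinder (s @ tl r) else {})"
proof -
  have ne: "s \<noteq> []" using assms by (rule rooted_path_neq_Nil)
  consider "r = []" | a r' where "r = a # r'" "a = last s" | a r' where "r = a # r'" "a \<noteq> last s"
    by (cases r) auto
  then show ?thesis
  proof cases
    case 1
    then show ?thesis using cylinder_subset by (auto simp: seg_Nil)
  next
    case 2
    have "\<omega> \<in> cylinder s \<inter> seg (length s - 1) r \<longleftrightarrow> \<omega> \<in> cylinder (s @ r')" for \<omega>
    proof
      assume \<omega>: "\<omega> \<in> cylinder s \<inter> seg (length s - 1) r"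
      show "\<omega> \<in> cylinder (s @ r')"
        unfolding cylinder_def
      proof (intro CollectI conjI allI impI)
        show "\<omega> \<in> infinite_paths" using \<omega> cylinder_subset by blast
        fix k assume k: "k < length (s @ r')"
        show "\<omega> k = (s @ r') ! k"
        proof (cases "k < length s")
          case True
          then show ?thesis using \<omega> by (simp add: cylinder_def nth_append)
        next
          case False
          then obtain l where kl: "k = length s + l" by (metis le_iff_add not_less)
          have l: "Suc l < length r" using k kl 2 by simp
          have e: "length s - 1 + Suc l = k" using ne kl by (cases s) auto
          have "\<omega> (length s - 1 + Suc l) = r ! Suc l" using \<omega> l unfolding seg_def by blast
          then have "\<omega> k = r ! Suc l" unfolding e .
          then show ?thesis using kl 2 by simp
        qed
      qed
    next
      assume \<omega>: "\<omega> \<in> cylinder (s @ r')"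
      then have \<omega>k: "\<omega> k = (s @ r') ! k" if "k < length s + length r'" for k
        using that by (simp add: cylinder_def)
      have \<omega>s: "\<omega> k = s ! k" if "k < length s" for k using \<omega>k[of k] that by (simp add: nth_append)
      have "\<omega> (length s - 1 + k) = r ! k" if "k < length r" for k
      proof (cases k)
        case 0
        then show ?thesis using \<omega>s[of "length s - 1"] ne 2 by (simp add: last_conv_nth)
      next
        case (Suc l)
        have e: "length s - 1 + k = length s + l" using Suc ne by (cases s) auto
        show ?thesis unfolding e using \<omega>k[of "length s + l"] Suc that 2 by simp
      qed
      then show "\<omega> \<in> cylinder s \<inter> seg (length s - 1) r"
        using \<omega> \<omega>s cylinder_subset by (auto simp: cylinder_def seg_def)
    qed
    then show ?thesis using 2 by auto
  next
    case 3
    have "False" if "\<omega> \<in> cylinder s" "\<omega> \<in> seg (length s - 1) r" for \<omega>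
    proof -
      have "\<omega> (length s - 1) = last s" by (rule cylinder_nonempty_rooted(2)[OF that(1) ne])
      moreover have "\<omega> (length s - 1 + 0) = r ! 0" using that(2) 3(1) unfolding seg_def by blast
      ultimately show ?thesis using 3 by simp
    qed
    then show ?thesis using 3 by auto
  qed
qed

lemma rooted_path_append_cong:
  assumes "rooted_path s" "rooted_path t" "last s = last t"
  shows "rooted_path (s @ r) \<longleftrightarrow> rooted_path (t @ r)" "last (s @ r) = last (t @ r)"
proof -
  have "s \<noteq> []" "t \<noteq> []" using assms rooted_path_neq_Nil by auto
  then show "rooted_path (s @ r) \<longleftrightarrow> rooted_path (t @ r)" "last (s @ r) = last (t @ r)"
    using assms by (auto simp: rooted_path_def finite_path_def successively_append_iff last_append)
qed

lemma future_sets_path_space: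
  assumes "A \<in> sets (future n)"
  shows "A \<in> sets path_space"
proof -
  have "state_events k \<subseteq> sets path_space" for k
  proof
    fix A assume "A \<in> state_events k"
    then obtain B where B: "B \<subseteq> ptrees" "A = {\<omega> \<in> infinite_paths. \<omega> k \<in> B}" by (auto simp: state_events_def)
    define R where "R = {s. rooted_path s \<and> length s = Suc k \<and> last s \<in> B}"
    have "A = \<Union>(cylinder ` R)" unfolding B(2) R_def by (rule state_set_eq)
    moreover have "countable R"
      by (rule countable_subset[OF _ countable_rooted_paths]) (auto simp: R_def)
    ultimately show "A \<in> sets path_space"
      by (auto simp: R_def intro!: sets.countable_UN'' cylinder_sets)
  qed
  then have "\<Union>(state_events ` {n..}) \<subseteq> sets path_space" by blast
  then have "sigma_sets (space path_space) (\<Union>(state_events ` {n..})) \<subseteq> sets path_space"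
    by (rule sets.sigma_sets_subset)
  then show ?thesis using assms by (auto simp: sets_future space_path_space)
qed

text \<open>A central measure forgets how a tree was reached: for a block event both intersections
  are cylinders prolonged by the same trees, hence of equal measure, and the equality survives
  complements and disjoint unions.\<close>

lemma measure_cylinder_future:
  assumes \<mu>: "\<mu> \<in> sat_central" and s: "rooted_path s" and t: "rooted_path t" and eq: "last s = last t"
    and A: "A \<in> sets (future (length s - 1))"
  shows "measure \<mu> (cylinder s \<inter> A) = measure \<mu> (cylinder t \<inter> A)"
proof -
  interpret prob_space \<mu> by (rule sat_centralD(1)[OF \<mu>])
  let ?n = "length s - 1"
  have pow: "insert {} (range (seg ?n)) \<subseteq> Pow infinite_paths" using seg_subset by blast
  have len: "length t = length s"
    using rooted_path_card_last[OF s] rooted_path_card_last[OF t] eq by simp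
  have cyl: "cylinder s \<in> sets \<mu>" "cylinder t \<in> sets \<mu>"
    using cylinder_sets s t sat_centralD(3)[OF \<mu>] by auto
  have cyl_meas: "cylinder u \<in> sets \<mu>" if "u \<noteq> []" for u
  proof (cases "rooted_path u")
    case True
    then show ?thesis using cylinder_sets sat_centralD(3)[OF \<mu>] by simp
  next
    case False
    then have "cylinder u = {}" using cylinder_nonempty_rooted(1) that by blast
    then show ?thesis by simp
  qed
  have "(cylinder s \<inter> A \<in> sets \<mu> \<and> cylinder t \<inter> A \<in> sets \<mu>) \<and>
      measure \<mu> (cylinder s \<inter> A) = measure \<mu> (cylinder t \<inter> A)"
    using Int_stable_segs[of ?n UNIV] pow future_segs[OF A]
  proof (induction rule: sigma_sets_induct_disjoint)
    case (basic A)
    show ?case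
    proof (cases "A = {}")
      case False
      then obtain r where r: "A = seg ?n r" using basic by blast
      have 1: "cylinder s \<inter> A =
          (if r = [] then cylinder s else if hd r = last s then cylinder (s @ tl r) else {})"
        using cylinder_Int_seg[OF s, of r] r by simp
      have 2: "cylinder t \<inter> A =
          (if r = [] then cylinder t else if hd r = last s then cylinder (t @ tl r) else {})"
        using cylinder_Int_seg[OF t, of r] r len eq by simp
      have ne: "s @ tl r \<noteq> []" "t @ tl r \<noteq> []" using s t rooted_path_neq_Nil by auto
      have "measure \<mu> (cylinder (s @ tl r)) = measure \<mu> (cylinder (t @ tl r))"
      proof (cases "rooted_path (s @ tl r)")
        case True
        then show ?thesis
          using rooted_path_append_cong[OF s t eq, of "tl r"] by (intro sat_centralD(4)[OF \<mu>]) auto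
      next
        case False
        then have "cylinder (s @ tl r) = {}" "cylinder (t @ tl r) = {}"
          using rooted_path_append_cong(1)[OF s t eq, of "tl r"] cylinder_nonempty_rooted(1) ne by blast+
        then show ?thesis by simp
      qed
      then show ?thesis
        unfolding 1 2 using cyl cyl_meas ne sat_centralD(4)[OF \<mu> s t eq] by simp
    qed simp
  next
    case empty
    then show ?case by simp
  next
    case (compl A)
    have d: "cylinder u \<inter> (infinite_paths - A) = cylinder u - cylinder u \<inter> A" for u
      using cylinder_subset[of u] by blast
    show ?case
      unfolding d using compl cyl sat_centralD(4)[OF \<mu> s t eq]
      by (auto simp: finite_measure_Diff)
  next
    case (union A)
    have "(\<lambda>i. measure \<mu> (cylinder u \<inter> A i)) sums measure \<mu> (\<Union>i. cylinder u \<inter> A i)"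
      if "\<And>i. cylinder u \<inter> A i \<in> sets \<mu>" for u
    proof (rule finite_measure_UNION)
      show "disjoint_family (\<lambda>i. cylinder u \<inter> A i)"
        using union.hyps(1) unfolding disjoint_family_on_def by blast
    qed (use that in auto)
    note sums = this
    have "(\<lambda>i. measure \<mu> (cylinder s \<inter> A i)) sums measure \<mu> (\<Union>i. cylinder s \<inter> A i)"
      "(\<lambda>i. measure \<mu> (cylinder t \<inter> A i)) sums measure \<mu> (\<Union>i. cylinder t \<inter> A i)"
      using sums union.IH by blast+
    then have "measure \<mu> (\<Union>i. cylinder s \<inter> A i) = measure \<mu> (\<Union>i. cylinder t \<inter> A i)"
      using union.IH sums_unique2 by simp
    moreover have "(\<Union>i. cylinder u \<inter> A i) \<in> sets \<mu>" if "\<And>i. cylinder u \<inter> A i \<in> sets \<mu>" for u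
      using that by (intro sets.countable_UN) auto
    moreover have U: "cylinder u \<inter> (\<Union>i. A i) = (\<Union>i. cylinder u \<inter> A i)" for u by blast
    ultimately show ?case unfolding U using union.IH by blast
  qed
  then show ?thesis by blast
qed

text \<open>For a tail event \<open>A\<close> the mass of a cylinder inside \<open>A\<close> is a
  harmonic function of its last tree, dominated by \<open>nnhf_of \<mu>\<close> and so proportional
  to it. Thus \<open>A\<close> is independent of all cylinders, hence of all events, in particular
  of itself.\<close>

lemma extremal_imp_ergodic:
  assumes \<mu>: "\<mu> \<in> sat_central" and ex: "nnhf_of \<mu> \<in> extremal_nnhf"
  shows "\<mu> \<in> ergodic_central"
proof -
  interpret prob_space \<mu> by (rule sat_centralD(1)[OF \<mu>])
  note sets = sat_centralD(3)[OF \<mu>] and space = sat_centralD(2)[OF \<mu>]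
  have "measure \<mu> A \<in> {0, 1}" if A: "\<And>n. A \<in> sets (future n)" for A
  proof -
    have A\<mu>: "A \<in> sets \<mu>" using A future_sets_path_space sets by blast
    \<comment> \<open>Tail events lie in the future of every time, so
      \<open>measure_cylinder_future\<close> makes the choice of the path immaterial.\<close>
    define f where "f \<tau> = measure \<mu> (cylinder (SOME s. rooted_path s \<and> last s = \<tau>) \<inter> A)" for \<tau>
    have f: "f (last s) = measure \<mu> (cylinder s \<inter> A)" if s: "rooted_path s" for s
    proof -
      let ?t = "SOME t. rooted_path t \<and> last t = last s"
      have t: "rooted_path ?t \<and> last ?t = last s" by (rule someI[of _ s]) (use s in simp)
      then show ?thesis
        unfolding f_def using A by (intro measure_cylinder_future[OF \<mu> _ s]) auto
    qed
    have dom: "f \<tau> = f root_tree * nnhf_of \<mu> \<tau>" if "\<tau> \<in> ptrees" for \<tau>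
    proof (rule extremal_dominated[OF ex _ _ _ that])
      show "harmonic_at f \<sigma>" if "\<sigma> \<in> ptrees" for \<sigma>
        by (rule harmonic_at_of_cylinders[OF \<mu> A\<mu> f that])
      show "f \<sigma> \<ge> 0" for \<sigma> by (simp add: f_def)
      show "f \<sigma> \<le> nnhf_of \<mu> \<sigma>" if \<sigma>: "\<sigma> \<in> ptrees" for \<sigma>
      proof -
        obtain s where s: "rooted_path s" "last s = \<sigma>" using rooted_path_exists[OF \<sigma>] .
        have "measure \<mu> (cylinder s \<inter> A) \<le> measure \<mu> (cylinder s)"
          using cylinder_sets[OF s(1)] sets by (intro finite_measure_mono) auto
        then show ?thesis using f[OF s(1)] nnhf_of_last[OF \<mu> s(1)] s(2) by simp
      qed
    qed
    have root: "f root_tree = measure \<mu> A"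
    proof -
      have "infinite_paths \<inter> A = A" using A\<mu> sets.sets_into_space space by blast
      then show ?thesis using f[of "[root_tree]"] by (simp add: rooted_path_single cylinder_root)
    qed
    have indep: "measure \<mu> (cylinder s \<inter> A) = measure \<mu> A * measure \<mu> (cylinder s)" if s: "rooted_path s" for s
      using dom[OF rooted_path_last[OF s]] f[OF s] nnhf_of_last[OF \<mu> s] root by simp
    have "measure \<mu> (B \<inter> A) = measure \<mu> A * measure \<mu> B" if "B \<in> sigma_sets infinite_paths cylinders" for B
      using Int_stable_cylinders cylinders_Pow that
    proof (induction rule: sigma_sets_induct_disjoint)
      case (basic B)
      then show ?case using indep by (auto simp: cylinders_def)
    next
      case empty
      then show ?case by simp
    next
      case (compl B)
      have B: "B \<in> sets \<mu>" using compl.hyps sets sets_path_space by simp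
      have "(infinite_paths - B) \<inter> A = A - B \<inter> A" using A\<mu> sets.sets_into_space space by blast
      then have "measure \<mu> ((infinite_paths - B) \<inter> A) = measure \<mu> A - measure \<mu> (B \<inter> A)"
        using A\<mu> B by (simp add: finite_measure_Diff)
      moreover have "measure \<mu> (infinite_paths - B) = 1 - measure \<mu> B"
        using prob_compl[OF B] space by simp
      ultimately show ?case using compl.IH by (simp only: right_diff_distrib mult_1_right)
    next
      case (union B)
      have B: "range B \<subseteq> sets \<mu>" using union.hyps(2) sets sets_path_space by simp
      have "(\<lambda>i. measure \<mu> (B i)) sums measure \<mu> (\<Union>i. B i)"
        by (rule finite_measure_UNION[OF B union.hyps(1)])
      then have s1: "(\<lambda>i. measure \<mu> A * measure \<mu> (B i)) sums (measure \<mu> A * measure \<mu> (\<Union>i. B i))"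
        by (rule sums_mult)
      have "(\<lambda>i. measure \<mu> (B i \<inter> A)) sums measure \<mu> (\<Union>i. B i \<inter> A)"
      proof (rule finite_measure_UNION)
        show "range (\<lambda>i. B i \<inter> A) \<subseteq> sets \<mu>" using B A\<mu> by auto
        show "disjoint_family (\<lambda>i. B i \<inter> A)"
          using union.hyps(1) unfolding disjoint_family_on_def by blast
      qed
      then have "(\<lambda>i. measure \<mu> A * measure \<mu> (B i)) sums measure \<mu> (\<Union>i. B i \<inter> A)"
        using union.IH by simp
      then have "measure \<mu> (\<Union>i. B i \<inter> A) = measure \<mu> A * measure \<mu> (\<Union>i. B i)"
        using s1 sums_unique2 by blast
      moreover have U: "(\<Union>i. B i) \<inter> A = (\<Union>i. B i \<inter> A)" by blast
      ultimately show ?case unfolding U by blast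
    qed
    then have "measure \<mu> A = measure \<mu> A * measure \<mu> A" using A\<mu> sets sets_path_space by (metis Int_absorb)
    then show ?thesis by auto
  qed
  then show ?thesis
    using \<mu> tail_events_eq[OF sat_centralD(1,2)[OF \<mu>]] by (auto simp: ergodic_central_def)
qed

text \<open>A function that is negative almost surely cannot have integral 0, which leaves the other
  alternative.\<close>

lemma (in prob_space) AE_nonneg_of_zero_one:
  fixes g :: "'a \<Rightarrow> real"
  assumes g: "integrable M g" "(\<integral>x. g x \<partial>M) = 0" and "prob {x \<in> space M. g x < 0} \<in> {0, 1}"
  shows "AE x in M. g x \<ge> 0"
proof -
  have [measurable]: "g \<in> borel_measurable M" using g(1) by auto
  have neg: "{x \<in> space M. g x < 0} \<in> events" by measurable
  show ?thesis
  proof (cases "prob {x \<in> space M. g x < 0} = 1")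
    case True
    then have *: "AE x in M. g x < 0" using prob_Collect_eq_1[OF neg] by simp
    have "AE x in M. 0 \<le> - g x" using * by eventually_elim simp
    moreover have "(\<integral>x. - g x \<partial>M) = 0" using g by simp
    ultimately have "AE x in M. - g x = 0"
      using integral_nonneg_eq_0_iff_AE[of M "\<lambda>x. - g x"] g(1) by simp
    with * have "AE x in M. False" by eventually_elim simp
    then show ?thesis by simp
  next
    case False
    then have "prob {x \<in> space M. g x < 0} = 0" using assms(3) by auto
    then have "AE x in M. \<not> g x < 0" using prob_Collect_eq_0[OF neg] by simp
    then show ?thesis by eventually_elim simp
  qed
qed

lemma state_measurable:
  assumes "n \<le> k"
  shows "(\<lambda>\<omega>. \<omega> k) \<in> measurable (future n) (count_space ptrees)"
  unfolding measurable_count_space_eq_countable[OF countable_ptrees]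
proof (intro conjI ballI)
  show "(\<lambda>\<omega>. \<omega> k) \<in> space (future n) \<rightarrow> ptrees" using infinite_pathsD(3) by (auto simp: space_future)
  fix \<tau> assume "\<tau> \<in> ptrees"
  then have "{\<omega> \<in> infinite_paths. \<omega> k \<in> {\<tau>}} \<in> \<Union>(state_events ` {n..})"
    using assms unfolding state_events_def by blast
  moreover have "(\<lambda>\<omega>. \<omega> k) -` {\<tau>} \<inter> space (future n) = {\<omega> \<in> infinite_paths. \<omega> k \<in> {\<tau>}}"
    by (auto simp: space_future)
  ultimately show "(\<lambda>\<omega>. \<omega> k) -` {\<tau>} \<inter> space (future n) \<in> sets (future n)"
    unfolding sets_future by (simp add: sigma_sets.Basic)
qed

lemma future_subalgebra:
  assumes "\<mu> \<in> sat_central"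
  shows "subalgebra \<mu> (future n)"
  using future_sets_path_space sat_centralD(2,3)[OF assms] by (auto simp: subalgebra_def space_future)

text \<open>A martingale argument: for harmonic \<open>\<psi> \<le> C * \<phi>\<close> the ratios \<open>\<psi> (\<omega> n) / \<phi> (\<omega> n)\<close> form a
  bounded martingale, whose limit is measurable with respect to the tail, hence constant.\<close>

locale dominated_harmonic =
  fixes \<mu> :: "(nat \<Rightarrow> tree) measure" and \<psi> :: "tree \<Rightarrow> real" and C :: real
  assumes \<mu>: "\<mu> \<in> sat_central" and \<psi>: "\<psi> \<in> nnhf"
    and le: "\<And>\<tau>. \<tau> \<in> ptrees \<Longrightarrow> \<psi> \<tau> \<le> C * nnhf_of \<mu> \<tau>"
begin

sublocale prob_space \<mu> by (rule sat_centralD(1)[OF \<mu>])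

text \<open>Where \<open>nnhf_of \<mu>\<close> vanishes, so does \<open>\<psi>\<close> by
  domination, and the quotient is 0.\<close>

definition H :: "nat \<Rightarrow> (nat \<Rightarrow> tree) \<Rightarrow> real" where
  "H n \<omega> = \<psi> (\<omega> n) / nnhf_of \<mu> (\<omega> n)"

lemma space_eq: "space \<mu> = infinite_paths" and sets_eq: "sets \<mu> = sets path_space"
  using sat_centralD(2,3)[OF \<mu>] by auto

lemma cyl_events: "rooted_path s \<Longrightarrow> cylinder s \<in> events"
  using cylinder_sets sets_eq by simp

lemma H_future: "n \<le> k \<Longrightarrow> H k \<in> borel_measurable (future n)"
  unfolding H_def by (rule measurable_compose[OF state_measurable]) simp_all

lemma H_measurable [measurable]: "H k \<in> borel_measurable \<mu>"
  by (rule measurable_from_subalg[OF future_subalgebra[OF \<mu>] H_future[OF order_refl]])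

lemma C_ge_1: "1 \<le> C"
  using le[OF root_in_ptrees] nnhf_root[OF \<psi>] nnhf_root[OF nnhf_of_nnhf[OF \<mu>]] by simp

lemma H_bounds:
  assumes "\<omega> \<in> space \<mu>"
  shows "0 \<le> H k \<omega>" "H k \<omega> \<le> C"
proof -
  have \<tau>: "\<omega> k \<in> ptrees" using assms infinite_pathsD(3) by (simp add: space_eq)
  have nn: "\<psi> (\<omega> k) \<ge> 0" "nnhf_of \<mu> (\<omega> k) \<ge> 0"
    using nnhf_nonneg[OF \<psi> \<tau>] nnhf_nonneg[OF nnhf_of_nnhf[OF \<mu>] \<tau>] by auto
  then show "0 \<le> H k \<omega>" by (simp add: H_def)
  show "H k \<omega> \<le> C" using C_ge_1 le[OF \<tau>] nn by (cases "nnhf_of \<mu> (\<omega> k) = 0") (auto simp: H_def field_simps)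
qed

lemma integrable_bounded:
  fixes g :: "(nat \<Rightarrow> tree) \<Rightarrow> real"
  assumes [measurable]: "g \<in> borel_measurable \<mu>" and "\<And>\<omega>. \<omega> \<in> space \<mu> \<Longrightarrow> \<bar>g \<omega>\<bar> \<le> B"
  shows "integrable \<mu> g"
  by (rule integrable_const_bound[of _ B]) (use assms in \<open>auto intro: AE_I2\<close>)

lemma integrable_H [simp]: "integrable \<mu> (H k)"
  by (rule integrable_bounded[of _ C]) (use H_bounds in auto)

lemma integrable_HH [simp]: "integrable \<mu> (\<lambda>\<omega>. H k \<omega> * H l \<omega>)"
proof (rule integrable_bounded[of _ "C * C"])
  show "\<bar>H k \<omega> * H l \<omega>\<bar> \<le> C * C" if "\<omega> \<in> space \<mu>" for \<omega>
    using H_bounds[OF that, of k] H_bounds[OF that, of l] by (auto simp: abs_mult intro!: mult_mono)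
qed measurable

text \<open>These measures express the martingale property without conditional expectations:
  \<open>\<nu> m\<close> gives a cylinder up to time \<open>m\<close> the value of
  \<open>\<psi>\<close> at its last tree, whatever \<open>m\<close> is.\<close>

definition \<nu> :: "nat \<Rightarrow> (nat \<Rightarrow> tree) measure" where
  "\<nu> m = density \<mu> (\<lambda>\<omega>. ennreal (H m \<omega>))"

lemma integrable_ind:
  assumes "A \<in> events"
  shows "integrable \<mu> (\<lambda>\<omega>. H m \<omega> * indicator A \<omega>)"
  by (rule integrable_bounded[of _ C])
     (use assms H_bounds[of _ m] in \<open>auto simp: indicator_def intro: order_trans\<close>)

lemma emeasure_\<nu>:
  assumes A: "A \<in> events"
  shows "emeasure (\<nu> m) A = ennreal (\<integral>\<omega>. H m \<omega> * indicator A \<omega> \<partial>\<mu>)"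
proof -
  have "emeasure (\<nu> m) A = (\<integral>\<^sup>+\<omega>. ennreal (H m \<omega>) * indicator A \<omega> \<partial>\<mu>)"
    unfolding \<nu>_def using A by (intro emeasure_density) measurable
  also have "\<dots> = (\<integral>\<^sup>+\<omega>. ennreal (H m \<omega> * indicator A \<omega>) \<partial>\<mu>)"
    by (intro nn_integral_cong) (auto simp: indicator_def)
  also have "\<dots> = ennreal (\<integral>\<omega>. H m \<omega> * indicator A \<omega> \<partial>\<mu>)"
    by (rule nn_integral_eq_integral[OF integrable_ind[OF A]]) (use H_bounds in \<open>auto intro!: AE_I2\<close>)
  finally show ?thesis .
qed

lemma measure_\<nu>:
  assumes "A \<in> events"
  shows "measure (\<nu> m) A = (\<integral>\<omega>. H m \<omega> * indicator A \<omega> \<partial>\<mu>)"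
proof -
  have "(\<integral>\<omega>. H m \<omega> * indicator A \<omega> \<partial>\<mu>) \<ge> 0"
    by (intro Bochner_Integration.integral_nonneg) (use H_bounds in auto)
  then show ?thesis using emeasure_\<nu>[OF assms] by (simp add: measure_def)
qed

lemma sets_\<nu>: "sets (\<nu> m) = sets \<mu>" and space_\<nu>: "space (\<nu> m) = space \<mu>"
  by (simp_all add: \<nu>_def)

lemma finite_\<nu>: "finite_measure (\<nu> m)"
  by (rule finite_measureI) (simp add: space_\<nu> emeasure_\<nu>)

text \<open>Downward induction on the length: at length \<open>m + 1\<close> the density is constant
  on the cylinder; shorter cylinders split into their continuations, which harmonicity of
  \<open>\<psi>\<close> adds up.\<close>

lemma \<nu>_cylinder:
  assumes "rooted_path s" "length s \<le> Suc m"
  shows "measure (\<nu> m) (cylinder s) = \<psi> (last s)"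
  using assms
proof (induction "Suc m - length s" arbitrary: s)
  case 0
  then have len: "length s = Suc m" by simp
  have last: "last s \<in> ptrees" by (rule rooted_path_last[OF 0(2)])
  have "measure (\<nu> m) (cylinder s) = (\<integral>\<omega>. H m \<omega> * indicator (cylinder s) \<omega> \<partial>\<mu>)"
    by (rule measure_\<nu>[OF cyl_events[OF 0(2)]])
  also have "\<dots> = (\<integral>\<omega>. (\<psi> (last s) / nnhf_of \<mu> (last s)) * indicator (cylinder s) \<omega> \<partial>\<mu>)"
  proof (rule Bochner_Integration.integral_cong[OF refl])
    fix \<omega> show "H m \<omega> * indicator (cylinder s) \<omega> =
        (\<psi> (last s) / nnhf_of \<mu> (last s)) * indicator (cylinder s) \<omega>"
      using cylinder_nonempty_rooted(2)[of \<omega> s] rooted_path_neq_Nil[OF 0(2)] len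
      by (cases "\<omega> \<in> cylinder s") (auto simp: H_def)
  qed
  also have "\<dots> = \<psi> (last s) / nnhf_of \<mu> (last s) * measure \<mu> (cylinder s)"
    using cyl_events[OF 0(2)] by simp
  also have "\<dots> = \<psi> (last s)"
    using nnhf_of_last[OF \<mu> 0(2)] le[OF last] nnhf_nonneg[OF \<psi> last] by (cases "nnhf_of \<mu> (last s) = 0") auto
  finally show ?case .
next
  case (Suc d)
  have last: "last s \<in> ptrees" by (rule rooted_path_last[OF Suc.prems(1)])
  have ne: "s \<noteq> []" by (rule rooted_path_neq_Nil[OF Suc.prems(1)])
  have "((\<lambda>\<sigma>. measure (\<nu> m) (cylinder (s @ [\<sigma>]) \<inter> space \<mu>)) has_sum measure (\<nu> m) (cylinder s \<inter> space \<mu>))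
      {\<sigma>. tree_edge (last s) \<sigma>}"
    by (rule has_sum_measure_cylinder[OF finite_\<nu> _ Suc.prems(1)]) (auto simp: sets_\<nu> sets_eq[symmetric])
  moreover have "cylinder u \<inter> space \<mu> = cylinder u" for u using cylinder_subset space_eq by blast
  ultimately have "((\<lambda>\<sigma>. measure (\<nu> m) (cylinder (s @ [\<sigma>]))) has_sum measure (\<nu> m) (cylinder s))
      {\<sigma>. tree_edge (last s) \<sigma>}" by simp
  moreover have "measure (\<nu> m) (cylinder (s @ [\<sigma>])) = \<psi> \<sigma>" if "\<sigma> \<in> {\<sigma>. tree_edge (last s) \<sigma>}" for \<sigma>
    using Suc.hyps(1)[of "s @ [\<sigma>]"] Suc.hyps(2) Suc.prems rooted_path_append[OF ne, of \<sigma>] that by simp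
  ultimately have "(\<psi> has_sum measure (\<nu> m) (cylinder s)) {\<sigma>. tree_edge (last s) \<sigma>}"
    by (rule has_sum_cong[THEN iffD1, rotated])
  moreover have "(\<psi> has_sum \<psi> (last s)) {\<sigma>. tree_edge (last s) \<sigma>}"
    using nnhf_harmonic[OF \<psi> last] has_sum_edges[OF last, of \<psi> "\<psi> (last s)"] by (simp add: harmonic_at_def)
  ultimately show ?case by (rule has_sum_unique)
qed

lemma \<nu>_state:
  assumes "n \<le> m" "\<tau> \<in> ptrees"
  shows "measure (\<nu> m) {\<omega> \<in> infinite_paths. \<omega> n = \<tau>} = measure (\<nu> n) {\<omega> \<in> infinite_paths. \<omega> n = \<tau>}"
proof -
  define R where "R = {s. rooted_path s \<and> length s = Suc n \<and> last s = \<tau>}"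
  have "{\<omega> \<in> infinite_paths. \<omega> n = \<tau>} = (\<Union>s\<in>R. cylinder s)"
    using state_set_eq[of n "{\<tau>}"] by (simp add: R_def)
  moreover have "((\<lambda>s. measure (\<nu> k) (cylinder s)) has_sum measure (\<nu> k) (\<Union>s\<in>R. cylinder s)) R" for k
  proof (rule has_sum_measure_UN[OF finite_\<nu>])
    show "countable R" by (rule countable_subset[OF _ countable_rooted_paths]) (auto simp: R_def)
    show "cylinder s \<in> sets (\<nu> k)" if "s \<in> R" for s
      using that cyl_events by (auto simp: R_def sets_\<nu>)
    show "disjoint_family_on cylinder R"
      unfolding disjoint_family_on_def
    proof (intro ballI impI)
      fix s t assume "s \<in> R" "t \<in> R" "s \<noteq> t"
      then show "cylinder s \<inter> cylinder t = {}"
        using seg_Int_le[of s t 0] by (auto simp: R_def cylinder_eq_seg)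
    qed
  qed
  then have "((\<lambda>s. \<psi> \<tau>) has_sum measure (\<nu> k) (\<Union>s\<in>R. cylinder s)) R" if "n \<le> k" for k
    by (rule has_sum_cong[THEN iffD1, rotated]) (use that \<nu>_cylinder in \<open>auto simp: R_def\<close>)
  from this[OF assms(1)] this[OF order_refl]
  have "measure (\<nu> m) (\<Union>s\<in>R. cylinder s) = measure (\<nu> n) (\<Union>s\<in>R. cylinder s)"
    by (rule has_sum_unique)
  ultimately show ?thesis by simp
qed

lemma state_measurable': "(\<lambda>\<omega>. \<omega> n) \<in> measurable \<mu> (count_space ptrees)"
  by (rule measurable_from_subalg[OF future_subalgebra[OF \<mu>] state_measurable[OF order_refl]])

text \<open>Orthogonality of increments: \<open>H n\<close> depends only on the tree at time
  \<open>n\<close>, whose law is the same under \<open>\<nu> m\<close> and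
  \<open>\<nu> n\<close>.\<close>

lemma H_cross:
  assumes "n \<le> m"
  shows "(\<integral>\<omega>. H m \<omega> * H n \<omega> \<partial>\<mu>) = (\<integral>\<omega>. H n \<omega> * H n \<omega> \<partial>\<mu>)"
proof -
  let ?h = "\<lambda>\<tau>. \<psi> \<tau> / nnhf_of \<mu> \<tau>"
  have st: "(\<lambda>\<omega>. \<omega> n) \<in> measurable (\<nu> k) (count_space ptrees)" for k
    using state_measurable' by (simp add: \<nu>_def)
  have "distr (\<nu> m) (count_space ptrees) (\<lambda>\<omega>. \<omega> n) = distr (\<nu> n) (count_space ptrees) (\<lambda>\<omega>. \<omega> n)"
  proof (rule measure_eqI_countable[of _ ptrees])
    fix \<tau> assume \<tau>: "\<tau> \<in> ptrees"
    have pre: "(\<lambda>\<omega>. \<omega> n) -` {\<tau>} \<inter> space (\<nu> k) = {\<omega> \<in> infinite_paths. \<omega> n = \<tau>}" for k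
      by (auto simp: space_\<nu> space_eq)
    have "emeasure (\<nu> m) {\<omega> \<in> infinite_paths. \<omega> n = \<tau>} = emeasure (\<nu> n) {\<omega> \<in> infinite_paths. \<omega> n = \<tau>}"
      unfolding finite_measure.emeasure_eq_measure[OF finite_\<nu>] using \<nu>_state[OF assms \<tau>] by simp
    then show "emeasure (distr (\<nu> m) (count_space ptrees) (\<lambda>\<omega>. \<omega> n)) {\<tau>} =
        emeasure (distr (\<nu> n) (count_space ptrees) (\<lambda>\<omega>. \<omega> n)) {\<tau>}"
      using \<tau> st by (simp add: emeasure_distr pre)
  qed (auto simp: countable_ptrees)
  then have "(\<integral>\<tau>. ?h \<tau> \<partial>distr (\<nu> m) (count_space ptrees) (\<lambda>\<omega>. \<omega> n)) =
      (\<integral>\<tau>. ?h \<tau> \<partial>distr (\<nu> n) (count_space ptrees) (\<lambda>\<omega>. \<omega> n))" by simp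
  then have "(\<integral>\<omega>. H n \<omega> \<partial>\<nu> m) = (\<integral>\<omega>. H n \<omega> \<partial>\<nu> n)"
    using st by (simp add: integral_distr H_def)
  moreover have "(\<integral>\<omega>. H n \<omega> \<partial>\<nu> k) = (\<integral>\<omega>. H k \<omega> * H n \<omega> \<partial>\<mu>)" for k
    unfolding \<nu>_def by (subst integral_density) (use H_bounds in \<open>auto intro!: AE_I2\<close>)
  ultimately show ?thesis by simp
qed

lemma H_L2:
  assumes "n \<le> m"
  shows "(\<integral>\<omega>. (H m \<omega> - H n \<omega>)\<^sup>2 \<partial>\<mu>) = (\<integral>\<omega>. H m \<omega> * H m \<omega> \<partial>\<mu>) - (\<integral>\<omega>. H n \<omega> * H n \<omega> \<partial>\<mu>)"
proof -
  have "(\<integral>\<omega>. (H m \<omega> - H n \<omega>)\<^sup>2 \<partial>\<mu>) =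
      (\<integral>\<omega>. H m \<omega> * H m \<omega> - 2 * (H m \<omega> * H n \<omega>) + H n \<omega> * H n \<omega> \<partial>\<mu>)"
    by (rule arg_cong[where f = "integral\<^sup>L \<mu>"]) (auto simp: power2_eq_square algebra_simps)
  also have "\<dots> = (\<integral>\<omega>. H m \<omega> * H m \<omega> \<partial>\<mu>) - 2 * (\<integral>\<omega>. H m \<omega> * H n \<omega> \<partial>\<mu>) + (\<integral>\<omega>. H n \<omega> * H n \<omega> \<partial>\<mu>)"
    by simp
  finally show ?thesis using H_cross[OF assms] by simp
qed

text \<open>The second moments increase and stay below \<open>C * C\<close>, so the sequence is
  Cauchy in mean square, hence in mean.\<close>

lemma H_Cauchy_L1:
  assumes "e > 0"
  shows "\<exists>N. \<forall>i\<ge>N. \<forall>j\<ge>N. (\<integral>\<omega>. norm (H i \<omega> - H j \<omega>) \<partial>\<mu>) < e"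
proof -
  define a where "a n = (\<integral>\<omega>. H n \<omega> * H n \<omega> \<partial>\<mu>)" for n
  have sq: "(\<integral>\<omega>. (H m \<omega> - H n \<omega>)\<^sup>2 \<partial>\<mu>) = \<bar>a m - a n\<bar>" for m n
  proof -
    have le: "(\<integral>\<omega>. (H m \<omega> - H n \<omega>)\<^sup>2 \<partial>\<mu>) = \<bar>a m - a n\<bar>" if "n \<le> m" for m n
      using H_L2[OF that] Bochner_Integration.integral_nonneg[of \<mu> "\<lambda>\<omega>. (H m \<omega> - H n \<omega>)\<^sup>2"] by (simp add: a_def)
    show ?thesis
      using le[of n m] le[of m n] by (cases "n \<le> m") (auto simp: power2_commute abs_minus_commute)
  qed
  have inc: "incseq a"
  proof (rule incseq_SucI)
    show "a n \<le> a (Suc n)" for n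
      using H_L2[of n "Suc n"] Bochner_Integration.integral_nonneg[of \<mu> "\<lambda>\<omega>. (H (Suc n) \<omega> - H n \<omega>)\<^sup>2"]
      by (simp add: a_def)
  qed
  have bd: "a n \<le> C * C" for n
  proof -
    have "a n \<le> (\<integral>\<omega>. C * C \<partial>\<mu>)"
      unfolding a_def using H_bounds[of _ n] C_ge_1 by (intro integral_mono) (auto intro!: mult_mono)
    then show ?thesis by (simp add: prob_space)
  qed
  obtain L where "a \<longlonglongrightarrow> L" using incseq_convergent[OF inc, of "C * C"] bd by blast
  then have "Cauchy a" by (rule LIMSEQ_imp_Cauchy)
  moreover have "e\<^sup>2 > 0" using assms by simp
  ultimately obtain N where N: "\<And>i j. i \<ge> N \<Longrightarrow> j \<ge> N \<Longrightarrow> dist (a i) (a j) < e\<^sup>2"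
    unfolding Cauchy_def by blast
  have "(\<integral>\<omega>. norm (H i \<omega> - H j \<omega>) \<partial>\<mu>) < e" if ij: "i \<ge> N" "j \<ge> N" for i j
  proof -
    \<comment> \<open>Passes from squares to absolute values: once the mean square is below
      \<open>e\<^sup>2\<close>, the right side has mean below \<open>e\<close>.\<close>
    have amgm: "\<bar>x\<bar> \<le> e / 2 + x\<^sup>2 / (2 * e)" for x :: real
    proof -
      have "0 \<le> (\<bar>x\<bar> - e)\<^sup>2" by simp
      then have "2 * e * \<bar>x\<bar> \<le> e\<^sup>2 + x\<^sup>2" by (simp add: power2_eq_square algebra_simps)
      then show ?thesis using assms by (simp add: field_simps power2_eq_square)
    qed
    have int: "integrable \<mu> (\<lambda>\<omega>. (H i \<omega> - H j \<omega>)\<^sup>2)"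
      unfolding power2_eq_square left_diff_distrib right_diff_distrib by simp
    have "(\<integral>\<omega>. norm (H i \<omega> - H j \<omega>) \<partial>\<mu>) \<le> (\<integral>\<omega>. e / 2 + (H i \<omega> - H j \<omega>)\<^sup>2 / (2 * e) \<partial>\<mu>)"
      using int amgm by (intro integral_mono) auto
    also have "\<dots> = e / 2 + (\<integral>\<omega>. (H i \<omega> - H j \<omega>)\<^sup>2 \<partial>\<mu>) / (2 * e)"
      using int by (simp add: prob_space)
    also have "\<dots> < e / 2 + e\<^sup>2 / (2 * e)"
      using N[OF ij] assms unfolding sq dist_real_def by (intro add_strict_left_mono divide_strict_right_mono) auto
    also have "\<dots> = e" using assms by (simp add: power2_eq_square)
    finally show ?thesis .
  qed
  then show ?thesis by blast
qed

text \<open>A subsequence of the ratios converges almost surely to some \<open>f\<close> whose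
  integral over a cylinder is \<open>\<psi>\<close> at its last tree. Ergodicity makes
  \<open>f\<close> constant, and its total integral 1 identifies the constant.\<close>

lemma ergodic_dominated_eq:
  assumes erg: "\<mu> \<in> ergodic_central"
  shows "\<psi> = nnhf_of \<mu>"
proof -
  obtain r where r: "strict_mono r" and AE_Cauchy: "AE \<omega> in \<mu>. Cauchy (\<lambda>i. H (r i) \<omega>)"
    using cauchy_L1_AE_cauchy_subseq[of \<mu> H, OF integrable_H H_Cauchy_L1] by blast
  define f where "f \<omega> = lim (\<lambda>i. H (r i) \<omega>)" for \<omega>
  have f_future: "f \<in> borel_measurable (future n)" for n
  proof -
    \<comment> \<open>Dropping the first \<open>n\<close> indices keeps the limit and leaves only
      ratios at times from \<open>n\<close> on, since \<open>r k \<ge> k\<close>.\<close>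
    have "lim (\<lambda>i. H (r i) \<omega>) = lim (\<lambda>i. H (r (i + n)) \<omega>)" for \<omega>
    proof -
      have "(\<lambda>i. H (r (i + n)) \<omega>) \<longlonglongrightarrow> L \<longleftrightarrow> (\<lambda>i. H (r i) \<omega>) \<longlonglongrightarrow> L" for L
        using LIMSEQ_offset[of "\<lambda>i. H (r i) \<omega>" n L] LIMSEQ_ignore_initial_segment[of "\<lambda>i. H (r i) \<omega>" L n]
        by blast
      then show ?thesis by (simp add: lim_def)
    qed
    then have "f = (\<lambda>\<omega>. lim (\<lambda>i. H (r (i + n)) \<omega>))" by (simp add: f_def[abs_def])
    moreover have "(\<lambda>\<omega>. H (r (i + n)) \<omega>) \<in> borel_measurable (future n)" for i
      using seq_suble[OF r, of "i + n"] by (intro H_future) simp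
    ultimately show ?thesis by (simp add: borel_measurable_lim_metric)
  qed
  have [measurable]: "f \<in> borel_measurable \<mu>"
    by (rule measurable_from_subalg[OF future_subalgebra[OF \<mu>] f_future])
  have conv: "AE \<omega> in \<mu>. (\<lambda>i. H (r i) \<omega>) \<longlonglongrightarrow> f \<omega>"
    using AE_Cauchy by eventually_elim (simp add: f_def Cauchy_convergent_iff convergent_LIMSEQ_iff)
  have int_cyl: "integrable \<mu> (\<lambda>\<omega>. f \<omega> * indicator (cylinder s) \<omega>) \<and>
      (\<integral>\<omega>. f \<omega> * indicator (cylinder s) \<omega> \<partial>\<mu>) = \<psi> (last s)" if s: "rooted_path s" for s
  proof -
    have [measurable]: "cylinder s \<in> events" by (rule cyl_events[OF s])
    have c: "AE \<omega> in \<mu>. (\<lambda>i. H (r i) \<omega> * indicator (cylinder s) \<omega>) \<longlonglongrightarrow> f \<omega> * indicator (cylinder s) \<omega>"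
      using conv by eventually_elim (intro tendsto_mult_right)
    have b: "AE \<omega> in \<mu>. norm (H (r i) \<omega> * indicator (cylinder s) \<omega>) \<le> C" for i
      using H_bounds[of _ "r i"] by (intro AE_I2) (auto simp: indicator_def intro: order_trans)
    have 1: "integrable \<mu> (\<lambda>\<omega>. f \<omega> * indicator (cylinder s) \<omega>)"
      by (rule integrable_dominated_convergence[OF _ _ _ c b]) auto
    have lim: "(\<lambda>i. \<integral>\<omega>. H (r i) \<omega> * indicator (cylinder s) \<omega> \<partial>\<mu>) \<longlonglongrightarrow> (\<integral>\<omega>. f \<omega> * indicator (cylinder s) \<omega> \<partial>\<mu>)"
      by (rule integral_dominated_convergence[OF _ _ _ c b]) auto
    have "(\<integral>\<omega>. H (r i) \<omega> * indicator (cylinder s) \<omega> \<partial>\<mu>) = \<psi> (last s)" if "i \<ge> length s" for i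
      using \<nu>_cylinder[OF s, of "r i"] measure_\<nu>[OF cyl_events[OF s], of "r i"] seq_suble[OF r, of i] that by simp
    then have "eventually (\<lambda>i. (\<integral>\<omega>. H (r i) \<omega> * indicator (cylinder s) \<omega> \<partial>\<mu>) = \<psi> (last s)) sequentially"
      unfolding eventually_sequentially by blast
    then have "(\<lambda>i. \<integral>\<omega>. H (r i) \<omega> * indicator (cylinder s) \<omega> \<partial>\<mu>) \<longlonglongrightarrow> \<psi> (last s)"
      by (rule tendsto_eventually)
    then show ?thesis using 1 LIMSEQ_unique[OF lim] by blast
  qed
  have root: "rooted_path [root_tree]" by (simp add: rooted_path_single)
  have ind: "f \<omega> * indicator (cylinder [root_tree]) \<omega> = f \<omega>" if "\<omega> \<in> space \<mu>" for \<omega>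
    using that by (simp add: cylinder_root space_eq)
  have "integrable \<mu> (\<lambda>\<omega>. f \<omega> * indicator (cylinder [root_tree]) \<omega>) = integrable \<mu> f"
    by (rule Bochner_Integration.integrable_cong[OF refl ind])
  moreover have "(\<integral>\<omega>. f \<omega> * indicator (cylinder [root_tree]) \<omega> \<partial>\<mu>) = (\<integral>\<omega>. f \<omega> \<partial>\<mu>)"
    by (rule Bochner_Integration.integral_cong[OF refl ind])
  ultimately have f_int: "integrable \<mu> f" "(\<integral>\<omega>. f \<omega> \<partial>\<mu>) = 1"
    using int_cyl[OF root] nnhf_root[OF \<psi>] by simp_all
  have zero_one: "measure \<mu> {\<omega> \<in> space \<mu>. f \<omega> \<in> S} \<in> {0, 1}" if "S \<in> sets borel" for S
  proof -
    have "f -` S \<inter> space (future n) \<in> sets (future n)" for n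
      by (rule measurable_sets[OF f_future that])
    moreover have "f -` S \<inter> space (future n) = {\<omega> \<in> space \<mu>. f \<omega> \<in> S}" for n
      by (auto simp: space_future space_eq)
    ultimately have "{\<omega> \<in> space \<mu>. f \<omega> \<in> S} \<in> (\<Inter>n. sets (future n))" by simp
    then show ?thesis
      using erg tail_events_eq[OF sat_centralD(1,2)[OF \<mu>]] unfolding ergodic_central_def by blast
  qed
  \<comment> \<open>\<open>f - 1\<close> and \<open>1 - f\<close> both have integral 0, and the
    events where they are negative are tail events.\<close>
  have "AE \<omega> in \<mu>. f \<omega> - 1 \<ge> 0"
    using zero_one[of "{..<1}"] f_int by (intro AE_nonneg_of_zero_one) (auto simp: prob_space)
  moreover have "AE \<omega> in \<mu>. 1 - f \<omega> \<ge> 0"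
    using zero_one[of "{1<..}"] f_int by (intro AE_nonneg_of_zero_one) (auto simp: prob_space)
  ultimately have one: "AE \<omega> in \<mu>. f \<omega> = 1" by eventually_elim simp
  show ?thesis
  proof (rule extensionalityI[of _ ptrees])
    show "\<psi> \<in> extensional ptrees" by (rule nnhf_extensional[OF \<psi>])
    show "nnhf_of \<mu> \<in> extensional ptrees" by (rule nnhf_extensional[OF nnhf_of_nnhf[OF \<mu>]])
    fix \<tau> assume "\<tau> \<in> ptrees"
    then obtain s where s: "rooted_path s" "last s = \<tau>" using rooted_path_exists by blast
    have [measurable]: "cylinder s \<in> events" by (rule cyl_events[OF s(1)])
    have "\<psi> \<tau> = (\<integral>\<omega>. f \<omega> * indicator (cylinder s) \<omega> \<partial>\<mu>)" using int_cyl[OF s(1)] s(2) by simp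
    also have "\<dots> = (\<integral>\<omega>. indicator (cylinder s) \<omega> \<partial>\<mu>)"
    proof (rule integral_cong_AE)
      show "AE \<omega> in \<mu>. f \<omega> * indicator (cylinder s) \<omega> = indicator (cylinder s) \<omega>"
        using one by eventually_elim simp
    qed measurable
    also have "\<dots> = nnhf_of \<mu> \<tau>" using nnhf_of_last[OF \<mu> s(1)] s(2) by simp
    finally show "\<psi> \<tau> = nnhf_of \<mu> \<tau>" .
  qed
qed

end

lemma ergodic_imp_extremal:
  assumes erg: "\<mu> \<in> ergodic_central"
  shows "nnhf_of \<mu> \<in> extremal_nnhf"
proof -
  have \<mu>: "\<mu> \<in> sat_central" using erg by (simp add: ergodic_central_def)
  show ?thesis
  proof (rule extremal_nnhf_not_mono[OF nnhf_of_nnhf[OF \<mu>]])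
    fix \<psi> C assume \<psi>: "\<psi> \<in> nnhf" and "\<And>\<tau>. \<tau> \<in> ptrees \<Longrightarrow> \<psi> \<tau> \<le> C * nnhf_of \<mu> \<tau>"
    then interpret dominated_harmonic \<mu> \<psi> C by unfold_locales (use \<mu> in auto)
    show "\<psi> = nnhf_of \<mu>" by (rule ergodic_dominated_eq[OF erg])
  qed
qed

text \<open>Surjectivity passes through labels: a measure is constructed for each product of labels,
  and every extremal function is such a product.\<close>

lemma bij_betw_nnhf_of: "bij_betw nnhf_of ergodic_central extremal_nnhf"
  unfolding bij_betw_def
proof (intro conjI equalityI subsetI)
  show "inj_on nnhf_of ergodic_central"
    by (rule inj_on_subset[OF inj_on_nnhf_of]) (auto simp: ergodic_central_def)
  show "\<phi> \<in> extremal_nnhf" if "\<phi> \<in> nnhf_of ` ergodic_central" for \<phi>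
    using that ergodic_imp_extremal by blast
  fix \<phi> assume \<phi>: "\<phi> \<in> extremal_nnhf"
  then obtain \<alpha> where "\<alpha> \<in> labels" "\<phi> = label_fun \<alpha>" using extremal_is_label_fun by blast
  then obtain \<mu> where "\<mu> \<in> sat_central" "nnhf_of \<mu> = \<phi>" using exists_central_measure by blast
  then show "\<phi> \<in> nnhf_of ` ergodic_central" using extremal_imp_ergodic \<phi> by blast
qed

lemma central_kernel_label:
  assumes "nnhf_of \<mu> = label_fun \<alpha>" "\<tau> \<in> ptrees" "v \<in> addable \<tau>" "label_fun \<alpha> \<tau> > 0"
  shows "central_kernel \<mu> \<tau> (insert v \<tau>) = \<alpha> v"
  using assms by (simp add: central_kernel_def label_fun_insert)

text \<open>The witness for \<open>A\<close> is \<open>label_of\<close>. It is injective on the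
  whole boundary but matched with \<open>labels\<close> only on the harmonic part, because mass can
  escape along infinitely many children. The kernel formula is restricted to positive
  \<open>label_fun \<alpha> \<tau>\<close>, the denominator of the kernel.\<close>

theorem theorem3p1:
  fixes \<epsilon> :: "tree \<Rightarrow> real"
    and X :: "'b set" and D :: "'b \<Rightarrow> 'b \<Rightarrow> real" and emb :: "tree \<Rightarrow> 'b"
  assumes eps_pos: "\<forall>\<tau>\<in>ptrees. \<epsilon> \<tau> > 0"
    and eps_summable: "\<epsilon> summable_on ptrees"
    and completion: "is_completion ptrees (martin_dist \<epsilon>) X D emb"
  shows
    "(\<forall>\<omega>\<in>infinite_paths. regular_path X D emb \<omega> \<longleftrightarrow>
        (\<forall>i\<in>indivs. \<exists>\<alpha>\<^sub>i. 0 \<le> \<alpha>\<^sub>i \<and> \<alpha>\<^sub>i \<le> 1 \<and>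
           (\<lambda>n. real (card (subtree (\<omega> n) i)) / real n) \<longlonglongrightarrow> \<alpha>\<^sub>i))
     \<and>
     (\<exists>A :: 'b \<Rightarrow> indiv \<Rightarrow> real.
        inj_on A (martin_boundary X D emb) \<and>
        bij_betw A (harmonic_boundary X D emb) labels \<and>
        (\<forall>\<zeta>\<in>martin_boundary X D emb.
           A \<zeta> \<in> indivs \<rightarrow>\<^sub>E {0..1} \<and>
           boundary_fun X D emb \<zeta> = label_fun (A \<zeta>) \<and>
           (\<forall>\<omega>\<in>infinite_paths. converges_to X D emb \<omega> \<zeta> \<longrightarrow>
              (\<forall>i\<in>indivs. (\<lambda>n. real (card (subtree (\<omega> n) i)) / real n) \<longlonglongrightarrow> A \<zeta> i))))
     \<and>
     bij_betw label_fun labels extremal_nnhf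
     \<and>
     bij_betw nnhf_of ergodic_central extremal_nnhf
     \<and>
     (\<forall>\<alpha>\<in>labels. \<forall>\<mu>\<in>ergodic_central. nnhf_of \<mu> = label_fun \<alpha> \<longrightarrow>
        (\<forall>\<tau>\<in>ptrees. \<forall>i\<in>\<tau>. \<forall>j\<ge>1. i @ [j] \<notin> \<tau> \<and> label_fun \<alpha> \<tau> > 0 \<longrightarrow>
           central_kernel \<mu> \<tau> (insert (i @ [j]) \<tau>) = \<alpha> (i @ [j])))
     \<and>
     (\<forall>n\<ge>1. \<forall>\<alpha>\<in>labels.
        ((\<lambda>\<sigma>. fact n / (\<Prod>i\<in>\<sigma>. real (card (subtree \<sigma> i))) * (\<Prod>i\<in>\<sigma>. \<alpha> i)) has_sum 1)
          (trees_of_size n))"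
proof -
  interpret martin_completion \<epsilon> X D emb
    by unfold_locales (use assms in auto)
  have "\<forall>\<zeta>\<in>martin_boundary X D emb.
      label_of \<zeta> \<in> indivs \<rightarrow>\<^sub>E {0..1} \<and> boundary_fun X D emb \<zeta> = label_fun (label_of \<zeta>) \<and>
      (\<forall>\<omega>\<in>infinite_paths. converges_to X D emb \<omega> \<zeta> \<longrightarrow>
        (\<forall>i\<in>indivs. (\<lambda>n. real (card (subtree (\<omega> n) i)) / real n) \<longlonglongrightarrow> label_of \<zeta> i))"
    using label_of_range boundary_fun_eq label_of_tendsto infinite_pathsD(3)
    by (simp add: path_ratio_tendsto_iff)
  then have "\<exists>A :: 'b \<Rightarrow> indiv \<Rightarrow> real.
      inj_on A (martin_boundary X D emb) \<and> bij_betw A (harmonic_boundary X D emb) labels \<and>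
      (\<forall>\<zeta>\<in>martin_boundary X D emb.
        A \<zeta> \<in> indivs \<rightarrow>\<^sub>E {0..1} \<and> boundary_fun X D emb \<zeta> = label_fun (A \<zeta>) \<and>
        (\<forall>\<omega>\<in>infinite_paths. converges_to X D emb \<omega> \<zeta> \<longrightarrow>
          (\<forall>i\<in>indivs. (\<lambda>n. real (card (subtree (\<omega> n) i)) / real n) \<longlonglongrightarrow> A \<zeta> i)))"
    using inj_on_label_of bij_betw_label_of by blast
  then show ?thesis
    using regular_path_iff bij_betw_label_fun bij_betw_nnhf_of central_kernel_label label_fun_has_sum_one
    by simp
qed

end
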